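(* Let $G$ and $H$ be infinite, finitely generated, residually finite groups, and let $X$ and $Y$ be free exact odometers of $G$ and $H$, respectively. Then the following statements are equivalent (isomorphisms in (1)–(3) being of abstract groups): (1) $\mathrm{Aut}^{\infty}(X,\alpha_X,G)\cong \mathrm{Aut}^{\infty}(Y,\alpha_Y,H)$. (2) $[[L_X]]\cong [[L_Y]]$. (3) $[[R_X]]\cong [[R_Y]]$. (4) There exist clopen subgroups $U_1\subseteq X$ and $U_2\subseteq Y$ such that $U_1$ and $U_2$ are isomorphic as topological groups and $[X:U_1]=[Y:U_2]<\infty$.
   Context: Let $G$ be a countable group. A scale of $G$ is a decreasing sequence $(\Gamma_n)_{n\in\mathbb{N}}$ of normal finite-index subgroups of $G$ with $\bigcap_n\Gamma_n=\{1_G\}$. The free exact odometer associated with the scale is $X=G_{(\Gamma_n)}=\{(x_n)_n\in\prod_n G/\Gamma_n : x_{n+1}\mapsto x_n \text{ under } G/\Gamma_{n+1}\to G/\Gamma_n \text{ for all } n\}$, a subgroup of the product group with the topology induced by the product of the discrete topologies. A free exact odometer of $G$ is one associated with some scale of $G$. The injective homomorphism $\tau:G\to X$, $\tau(g)=(g\Gamma_n)_n$, has dense image, and $\alpha_X$ is the action of $G$ on $X$ given by $\alpha_X^g(x)=\tau(g)x$. $L_X$ and $R_X$ are the left actions of the group $X$ on the space $X$ given by $L_X^{\xi}(x)=\xi x$ and $R_X^{\xi}(x)=x\xi^{-1}$. For an action $\alpha$ of a (not necessarily countable) group $K$ by homeomorphisms on a compact totally disconnected metrizable space $Z$, the topological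 full group $[[\alpha]]$ is the group of all homeomorphisms $f$ of $Z$ for which there exist a finite clopen partition $\{A_1,\dots,A_k\}$ of $Z$ and $g_1,\dots,g_k\in K$ with $f(y)=\alpha^{g_i}(y)$ for all $y\in A_i$, $1\le i\le k$. For an action $\alpha$ of a group $G$ on $X$ by homeomorphisms, $\mathrm{Aut}(X,\alpha,G)$ is the group of homeomorphisms $f$ of $X$ with $f\circ\alpha^g=\alpha^g\circ f$ for all $g\in G$. The stabilized automorphism group is $\mathrm{Aut}^\infty(X,\alpha,G)=\bigcup_{K}\mathrm{Aut}(X,\alpha|_K,K)$, the union over all finite-index subgroups $K$ of $G$, where $\alpha|_K$ is the restriction of the action to $K$. *)

theory Defs
  imports "HOL-Algebra.Bij" "HOL-Algebra.Generated_Groups" "HOL-Algebra.Product_Groups"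
    "HOL-Analysis.Analysis"
begin

section \<open>Groups\<close>

definition finite_index :: "('a, 'm) monoid_scheme \<Rightarrow> 'a set \<Rightarrow> bool" where
  "finite_index G K \<longleftrightarrow> finite (rcosets\<^bsub>G\<^esub> K)"

definition finitely_generated :: "('a, 'm) monoid_scheme \<Rightarrow> bool" where
  "finitely_generated G \<longleftrightarrow> (\<exists>S. finite S \<and> S \<subseteq> carrier G \<and> generate G S = carrier G)"

definition residually_finite :: "('a, 'm) monoid_scheme \<Rightarrow> bool" where
  "residually_finite G \<longleftrightarrow>
     (\<forall>g\<in>carrier G - {\<one>\<^bsub>G\<^esub>}. \<exists>N. N \<lhd> G \<and> finite_index G N \<and> g \<notin> N)"


section \<open>Scales and odometers\<close>

definition is_scale :: "('a, 'm) monoid_scheme \<Rightarrow> (nat \<Rightarrow> 'a set) \<Rightarrow> bool" where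
  "is_scale G \<Gamma> \<longleftrightarrow>
     (\<forall>n. \<Gamma> n \<lhd> G \<and> finite_index G (\<Gamma> n)) \<and> decseq \<Gamma> \<and> (\<Inter>n. \<Gamma> n) = {\<one>\<^bsub>G\<^esub>}"

text \<open>
  The canonical map \<open>G/M \<rightarrow> G/N\<close> for normal subgroups \<open>M \<subseteq> N\<close>: the coset \<open>C\<close> of \<open>M\<close> is sent to
  the common value of \<open>N #> g\<close> over all \<open>g \<in> C\<close>. The cosets of the library's quotient group
  \<open>G Mod N\<close> are right cosets, which for normal \<open>N\<close> coincide with the left cosets.
\<close>

definition quotient_projection :: "('a, 'm) monoid_scheme \<Rightarrow> 'a set \<Rightarrow> 'a set \<Rightarrow> 'a set" where
  "quotient_projection G N C = the_elem ((\<lambda>g. N #>\<^bsub>G\<^esub> g) ` C)"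

lemma quotient_projection_rcos:
  assumes "M \<lhd> G" "N \<lhd> G" "M \<subseteq> N" "g \<in> carrier G"
  shows "quotient_projection G N (M #>\<^bsub>G\<^esub> g) = N #>\<^bsub>G\<^esub> g"
proof -
  interpret M: normal M G by fact
  interpret N: normal N G by fact
  have "N #>\<^bsub>G\<^esub> x = N #>\<^bsub>G\<^esub> g" if "x \<in> M #>\<^bsub>G\<^esub> g" for x
  proof -
    have "x \<in> N #>\<^bsub>G\<^esub> g"
      using that assms(3) by (auto simp: r_coset_def)
    then show ?thesis
      using M.repr_independence N.is_subgroup assms(4) by metis
  qed
  moreover have "g \<in> M #>\<^bsub>G\<^esub> g"
    by (simp add: M.rcos_self M.is_subgroup assms(4))
  ultimately have "(\<lambda>x. N #>\<^bsub>G\<^esub> x) ` (M #>\<^bsub>G\<^esub> g) = {N #>\<^bsub>G\<^esub> g}"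
    by blast
  then show ?thesis
    by (simp add: quotient_projection_def)
qed

definition odometer_product ::
    "('a, 'm) monoid_scheme \<Rightarrow> (nat \<Rightarrow> 'a set) \<Rightarrow> (nat \<Rightarrow> 'a set) monoid" where
  "odometer_product G \<Gamma> = product_group UNIV (\<lambda>n. G Mod \<Gamma> n)"

definition odometer :: "('a, 'm) monoid_scheme \<Rightarrow> (nat \<Rightarrow> 'a set) \<Rightarrow> (nat \<Rightarrow> 'a set) monoid" where
  "odometer G \<Gamma> = (odometer_product G \<Gamma>)
     \<lparr>carrier := {x \<in> carrier (odometer_product G \<Gamma>).
                    \<forall>n. quotient_projection G (\<Gamma> n) (x (Suc n)) = x n}\<rparr>"

definition odometer_topology ::
    "('a, 'm) monoid_scheme \<Rightarrow> (nat \<Rightarrow> 'a set) \<Rightarrow> (nat \<Rightarrow> 'a set) topology" where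
  "odometer_topology G \<Gamma> =
     subtopology (product_topology (\<lambda>n. discrete_topology (carrier (G Mod \<Gamma> n))) UNIV)
       (carrier (odometer G \<Gamma>))"

lemma topspace_odometer_topology [simp]:
  "topspace (odometer_topology G \<Gamma>) = carrier (odometer G \<Gamma>)"
  by (auto simp: odometer_topology_def odometer_def odometer_product_def)

definition odometer_embedding ::
    "('a, 'm) monoid_scheme \<Rightarrow> (nat \<Rightarrow> 'a set) \<Rightarrow> 'a \<Rightarrow> nat \<Rightarrow> 'a set" where
  "odometer_embedding G \<Gamma> g = (\<lambda>n. \<Gamma> n #>\<^bsub>G\<^esub> g)"

lemma odometer_embedding_closed:
  assumes "is_scale G \<Gamma>" "g \<in> carrier G"
  shows "odometer_embedding G \<Gamma> g \<in> carrier (odometer G \<Gamma>)"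
proof -
  have "quotient_projection G (\<Gamma> n) (\<Gamma> (Suc n) #>\<^bsub>G\<^esub> g) = \<Gamma> n #>\<^bsub>G\<^esub> g" for n
    using assms by (intro quotient_projection_rcos) (auto simp: is_scale_def decseq_Suc_iff)
  then show ?thesis
    using assms(2)
    by (auto simp: odometer_def odometer_product_def odometer_embedding_def carrier_FactGroup)
qed

lemma subgroup_odometer:
  assumes "is_scale G \<Gamma>"
  shows "subgroup (carrier (odometer G \<Gamma>)) (odometer_product G \<Gamma>)"
proof -
  have N: "\<Gamma> n \<lhd> G" for n using assms by (simp add: is_scale_def)
  then interpret G: group G by (meson normal_def)
  have le: "\<Gamma> (Suc n) \<subseteq> \<Gamma> n" for n using assms by (simp add: is_scale_def decseq_Suc_iff)
  have grp: "group (G Mod \<Gamma> n)" for n using N normal.factorgroup_is_group by blast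
  have q: "quotient_projection G (\<Gamma> n) (\<Gamma> (Suc n) #>\<^bsub>G\<^esub> g) = \<Gamma> n #>\<^bsub>G\<^esub> g"
    if "g \<in> carrier G" for n g by (rule quotient_projection_rcos[OF N N le that])
  have hom: "quotient_projection G (\<Gamma> n) \<in> hom (G Mod \<Gamma> (Suc n)) (G Mod \<Gamma> n)" for n
    by (auto simp: hom_def carrier_FactGroup q normal.rcos_sum[OF N])
  then have gh: "group_hom (G Mod \<Gamma> (Suc n)) (G Mod \<Gamma> n) (quotient_projection G (\<Gamma> n))" for n
    using grp by (simp add: group_hom_def group_hom_axioms_def)
  interpret P: group "odometer_product G \<Gamma>"
    by (simp add: odometer_product_def grp)
  show ?thesis
  proof (rule P.subgroupI)
    show "carrier (odometer G \<Gamma>) \<subseteq> carrier (odometer_product G \<Gamma>)"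
      by (auto simp: odometer_def)
    show "carrier (odometer G \<Gamma>) \<noteq> {}"
      using odometer_embedding_closed[OF assms G.one_closed] by blast
  next
    fix x assume "x \<in> carrier (odometer G \<Gamma>)"
    then have x: "x n \<in> carrier (G Mod \<Gamma> n)" "quotient_projection G (\<Gamma> n) (x (Suc n)) = x n" for n
      by (auto simp: odometer_def odometer_product_def)
    have "quotient_projection G (\<Gamma> n) (inv\<^bsub>G Mod \<Gamma> (Suc n)\<^esub> x (Suc n)) = inv\<^bsub>G Mod \<Gamma> n\<^esub> x n" for n
      using group_hom.hom_inv[OF gh x(1)] x(2) by metis
    moreover have "inv\<^bsub>odometer_product G \<Gamma>\<^esub> x = (\<lambda>n. inv\<^bsub>G Mod \<Gamma> n\<^esub> x n)"
      using inv_product_group[of x UNIV "\<lambda>n. G Mod \<Gamma> n"] x(1) grp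
      by (simp add: odometer_product_def PiE_def restrict_def)
    ultimately show "inv\<^bsub>odometer_product G \<Gamma>\<^esub> x \<in> carrier (odometer G \<Gamma>)"
      using x(1) grp by (simp add: odometer_def odometer_product_def group.inv_closed PiE_def)
  next
    fix x y assume "x \<in> carrier (odometer G \<Gamma>)" "y \<in> carrier (odometer G \<Gamma>)"
    then have x: "x n \<in> carrier (G Mod \<Gamma> n)" "quotient_projection G (\<Gamma> n) (x (Suc n)) = x n"
      and y: "y n \<in> carrier (G Mod \<Gamma> n)" "quotient_projection G (\<Gamma> n) (y (Suc n)) = y n" for n
      by (auto simp: odometer_def odometer_product_def)
    have "quotient_projection G (\<Gamma> n) (x (Suc n) <#>\<^bsub>G\<^esub> y (Suc n)) = x n <#>\<^bsub>G\<^esub> y n" for n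
      using hom_mult[OF hom x(1) y(1)] x(2) y(2) by simp
    moreover have "x n <#>\<^bsub>G\<^esub> y n \<in> carrier (G Mod \<Gamma> n)" for n
      using group.is_monoid[OF grp, THEN monoid.m_closed, OF x(1) y(1)] by simp
    ultimately show "x \<otimes>\<^bsub>odometer_product G \<Gamma>\<^esub> y \<in> carrier (odometer G \<Gamma>)"
      by (auto simp: odometer_def odometer_product_def)
  qed
qed


section \<open>Actions and groups of homeomorphisms\<close>

text \<open>
  As in \<open>BijGroup\<close>, self-maps of a set are represented by their extensional representatives, so
  that maps which agree on the set are equal.
\<close>

definition left_action :: "('x, 'm) monoid_scheme \<Rightarrow> 'x \<Rightarrow> 'x \<Rightarrow> 'x" where
  "left_action X \<xi> = (\<lambda>x\<in>carrier X. \<xi> \<otimes>\<^bsub>X\<^esub> x)"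

definition right_action :: "('x, 'm) monoid_scheme \<Rightarrow> 'x \<Rightarrow> 'x \<Rightarrow> 'x" where
  "right_action X \<xi> = (\<lambda>x\<in>carrier X. x \<otimes>\<^bsub>X\<^esub> inv\<^bsub>X\<^esub> \<xi>)"

definition odometer_action ::
    "('a, 'm) monoid_scheme \<Rightarrow> (nat \<Rightarrow> 'a set) \<Rightarrow> 'a \<Rightarrow> (nat \<Rightarrow> 'a set) \<Rightarrow> (nat \<Rightarrow> 'a set)" where
  "odometer_action G \<Gamma> g =
     (\<lambda>x\<in>carrier (odometer G \<Gamma>). odometer_embedding G \<Gamma> g \<otimes>\<^bsub>odometer G \<Gamma>\<^esub> x)"

definition homeo :: "'x topology \<Rightarrow> ('x \<Rightarrow> 'x) set" where
  "homeo T = {f \<in> Bij (topspace T). homeomorphic_map T T f}"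

definition full_group_set ::
    "('k, 'm) monoid_scheme \<Rightarrow> 'x topology \<Rightarrow> ('k \<Rightarrow> 'x \<Rightarrow> 'x) \<Rightarrow> ('x \<Rightarrow> 'x) set" where
  "full_group_set K T \<alpha> =
     {f \<in> homeo T. \<exists>P. finite P \<and> partition_on (topspace T) P \<and>
        (\<forall>A\<in>P. openin T A \<and> closedin T A \<and> (\<exists>g\<in>carrier K. \<forall>y\<in>A. f y = \<alpha> g y))}"

definition topological_full_group ::
    "('k, 'm) monoid_scheme \<Rightarrow> 'x topology \<Rightarrow> ('k \<Rightarrow> 'x \<Rightarrow> 'x) \<Rightarrow> ('x \<Rightarrow> 'x) monoid" where
  "topological_full_group K T \<alpha> = (BijGroup (topspace T)) \<lparr>carrier := full_group_set K T \<alpha>\<rparr>"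

definition Aut_set :: "'x topology \<Rightarrow> ('g \<Rightarrow> 'x \<Rightarrow> 'x) \<Rightarrow> 'g set \<Rightarrow> ('x \<Rightarrow> 'x) set" where
  "Aut_set T \<alpha> K = {f \<in> homeo T. \<forall>g\<in>K. \<forall>x\<in>topspace T. f (\<alpha> g x) = \<alpha> g (f x)}"

definition stabilized_Aut ::
    "('g, 'm) monoid_scheme \<Rightarrow> 'x topology \<Rightarrow> ('g \<Rightarrow> 'x \<Rightarrow> 'x) \<Rightarrow> ('x \<Rightarrow> 'x) monoid" where
  "stabilized_Aut G T \<alpha> = (BijGroup (topspace T))
     \<lparr>carrier := (\<Union>K\<in>{K. subgroup K G \<and> finite_index G K}. Aut_set T \<alpha> K)\<rparr>"


section \<open>Isomorphism of topological groups\<close>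

definition top_group_isomorphic ::
    "('x, 'm) monoid_scheme \<Rightarrow> 'x topology \<Rightarrow> ('y, 'n) monoid_scheme \<Rightarrow> 'y topology \<Rightarrow> bool" where
  "top_group_isomorphic X S Y T \<longleftrightarrow> (\<exists>\<phi>\<in>iso X Y. homeomorphic_map S T \<phi>)"

definition clopen_subgroup :: "'x set \<Rightarrow> ('x, 'm) monoid_scheme \<Rightarrow> 'x topology \<Rightarrow> bool" where
  "clopen_subgroup U X T \<longleftrightarrow> subgroup U X \<and> openin T U \<and> closedin T U"

end

theory Submission
  imports Defs
begin

text \<open>
  Let \<open>V n\<close> be the kernel of the \<open>n\<close>-th coordinate of an odometer \<open>X\<close> and let \<open>E\<close> be the group of
  all permutations of \<open>X\<close> that commute with the left translations by some \<open>V n\<close>. By compactness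
  \<open>E = [[R\<^sub>X]]\<close>. The elements whose left translation commutes with a given homeomorphism
  form a closed subgroup, which is open as soon as it contains the image of a finite-index subgroup
  of \<open>G\<close>; hence \<open>E\<close> is also the stabilized automorphism group. Conjugation by inversion identifies
  it with \<open>[[L\<^sub>X]]\<close>.

  If \<open>U1\<close> and \<open>U2\<close> are isomorphic clopen subgroups of the same index, a bijection of their cosets
  extends the isomorphism to an equivariant bijection, which conjugates one group \<open>E\<close> to the other.

  Conversely, the subgroup of \<open>E\<close> supported in the support of an involution \<open>g\<close> can be expressed by
  centralizers and squares alone (Fremlin's trick for groups with many involutions), so an
  isomorphism between the groups \<open>E\<close> preserves inclusion and disjointness of such supports. As these
  supports form bases of the topologies, it is conjugation by a homeomorphism \<open>h\<close>. Conjugates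
  under \<open>h\<close> of the right translations by finitely many topological generators all commute with the
  left translations by one \<open>W n\<close>; by density this holds for all right translations. Hence
  \<open>h\<close> pulls each left translation by \<open>w \<in> W n\<close> back to a left translation by some \<open>\<theta> w\<close>, and \<open>\<theta>\<close> is an
  isomorphism of \<open>W n\<close> onto a clopen subgroup whose cosets correspond to those of \<open>W n\<close> under \<open>h\<close>.
\<close>

section \<open>Groups of permutations\<close>

text \<open>An abstract isomorphism carries no points, so supports must first be recognised by
  formulas in the group operations. The centralizer of an involution \<open>g\<close> alone does not
  do this, since it also contains maps acting across the orbits of \<open>g\<close>. The flips
  repair this: they are the members of the group that fix or swap each pair \<open>{x, g x}\<close>.
  A map commuting with all of them can only fix or swap a pair in the support of \<open>g\<close>,
  so its square is trivial there.

  The resulting homeomorphism \<open>h\<close> need not be multiplicative, and only its behaviour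
  under small left translations can be controlled. A single right translation gives such control at
  a depth that depends on the translation; finite generation supplies one depth for all of them. In
  the other direction, an isomorphism of open subgroups says nothing about the remaining cosets, and
  equality of the indices is what lets it extend to the whole groups.\<close>

definition permutation_monoid :: "'x set \<Rightarrow> ('x \<Rightarrow> 'x) set \<Rightarrow> ('x \<Rightarrow> 'x) monoid" where
  "permutation_monoid S F = (BijGroup S)\<lparr>carrier := F\<rparr>"

lemma carrier_permutation_monoid [simp]: "carrier (permutation_monoid S F) = F"
  by (simp add: permutation_monoid_def)

locale permutation_group =
  fixes S :: "'x set" and F :: "('x \<Rightarrow> 'x) set"
  assumes subgroup_BijGroup: "subgroup F (BijGroup S)"
begin

abbreviation P where "P \<equiv> permutation_monoid S F"

sublocale group P
  unfolding permutation_monoid_def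
  using subgroup.subgroup_is_group[OF subgroup_BijGroup group_BijGroup] .

lemma F_Bij: "f \<in> F \<Longrightarrow> f \<in> Bij S"
  using subgroup.subset[OF subgroup_BijGroup] by (auto simp: BijGroup_def)

lemma F_bij_betw: "f \<in> F \<Longrightarrow> bij_betw f S S"
  using F_Bij by (auto simp: Bij_def)

lemma F_closed [simp]: "f \<in> F \<Longrightarrow> x \<in> S \<Longrightarrow> f x \<in> S"
  using F_bij_betw by (auto simp: bij_betw_def)

lemma F_eqI: "f \<in> F \<Longrightarrow> g \<in> F \<Longrightarrow> (\<And>x. x \<in> S \<Longrightarrow> f x = g x) \<Longrightarrow> f = g"
  using F_Bij by (auto simp: Bij_def intro: extensionalityI)

lemma mult_app [simp]: "f \<in> F \<Longrightarrow> g \<in> F \<Longrightarrow> x \<in> S \<Longrightarrow> (f \<otimes>\<^bsub>P\<^esub> g) x = f (g x)"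
  by (simp add: permutation_monoid_def BijGroup_def F_Bij compose_def)

lemma one_app [simp]: "x \<in> S \<Longrightarrow> \<one>\<^bsub>P\<^esub> x = x"
  by (simp add: permutation_monoid_def BijGroup_def)

lemma mult_F [simp]: "f \<in> F \<Longrightarrow> g \<in> F \<Longrightarrow> f \<otimes>\<^bsub>P\<^esub> g \<in> F"
  using m_closed by simp

lemma one_F [simp]: "\<one>\<^bsub>P\<^esub> \<in> F"
  using one_closed by simp

lemma inv_F [simp]: "f \<in> F \<Longrightarrow> inv\<^bsub>P\<^esub> f \<in> F"
  using inv_closed by simp

lemma inv_app [simp]: "f \<in> F \<Longrightarrow> x \<in> S \<Longrightarrow> (inv\<^bsub>P\<^esub> f) (f x) = x"
  using mult_app[of "inv\<^bsub>P\<^esub> f" f x] one_app[of x] l_inv[of f] by (simp del: mult_app one_app)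

lemma app_inv [simp]: "f \<in> F \<Longrightarrow> x \<in> S \<Longrightarrow> f ((inv\<^bsub>P\<^esub> f) x) = x"
  using mult_app[of f "inv\<^bsub>P\<^esub> f" x] one_app[of x] r_inv[of f] by (simp del: mult_app one_app)

lemma mult_eq_iff:
  assumes "f \<in> F" "g \<in> F" "f' \<in> F" "g' \<in> F"
  shows "f \<otimes>\<^bsub>P\<^esub> g = f' \<otimes>\<^bsub>P\<^esub> g' \<longleftrightarrow> (\<forall>x\<in>S. f (g x) = f' (g' x))"
proof
  assume "f \<otimes>\<^bsub>P\<^esub> g = f' \<otimes>\<^bsub>P\<^esub> g'"
  then have "(f \<otimes>\<^bsub>P\<^esub> g) x = (f' \<otimes>\<^bsub>P\<^esub> g') x" for x by (rule fun_cong)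
  then show "\<forall>x\<in>S. f (g x) = f' (g' x)" by (metis assms mult_app)
next
  assume "\<forall>x\<in>S. f (g x) = f' (g' x)"
  then show "f \<otimes>\<^bsub>P\<^esub> g = f' \<otimes>\<^bsub>P\<^esub> g'" using assms by (intro F_eqI mult_F) (simp_all only: mult_app)
qed

lemma mult_one_iff:
  assumes "f \<in> F" "g \<in> F"
  shows "f \<otimes>\<^bsub>P\<^esub> g = \<one>\<^bsub>P\<^esub> \<longleftrightarrow> (\<forall>x\<in>S. f (g x) = x)"
proof
  assume "f \<otimes>\<^bsub>P\<^esub> g = \<one>\<^bsub>P\<^esub>"
  then have "(f \<otimes>\<^bsub>P\<^esub> g) x = \<one>\<^bsub>P\<^esub> x" for x by (rule fun_cong)
  then show "\<forall>x\<in>S. f (g x) = x" by (metis assms mult_app one_app)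
next
  assume "\<forall>x\<in>S. f (g x) = x"
  then show "f \<otimes>\<^bsub>P\<^esub> g = \<one>\<^bsub>P\<^esub>"
    using assms by (intro F_eqI mult_F one_F) (simp_all only: mult_app one_app)
qed

lemma F_inj: "f \<in> F \<Longrightarrow> x \<in> S \<Longrightarrow> y \<in> S \<Longrightarrow> f x = f y \<longleftrightarrow> x = y"
  by (metis inv_app)

end

text \<open>No closure is taken: in the groups of interest this set is clopen, so it is already the
  topological support.\<close>

definition moved :: "'x set \<Rightarrow> ('x \<Rightarrow> 'x) \<Rightarrow> 'x set" where
  "moved S f = {x \<in> S. f x \<noteq> x}"

context permutation_group
begin

lemma app_moved: "f \<in> F \<Longrightarrow> x \<in> S \<Longrightarrow> f x \<in> moved S f \<longleftrightarrow> x \<in> moved S f"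
  by (auto simp: moved_def F_inj)

text \<open>A permutation maps its support onto itself, so where one map acts, the other is trivial
  both before and after.\<close>

lemma commute_if_moved_disjoint:
  assumes "f \<in> F" "g \<in> F" "moved S f \<inter> moved S g = {}"
  shows "f \<otimes>\<^bsub>P\<^esub> g = g \<otimes>\<^bsub>P\<^esub> f"
proof -
  have g_fix: "g y = y" if "y \<in> moved S f" for y
    using assms(3) that by (auto simp: moved_def)
  have "f (g x) = g (f x)" if x: "x \<in> S" for x
  proof (cases "x \<in> moved S f")
    case True
    then show ?thesis using g_fix[of x] g_fix[of "f x"] app_moved[OF assms(1) x] by simp
  next
    case False
    then have "f x = x" using x by (simp add: moved_def)
    moreover have "f (g x) = g x"
    proof (cases "x \<in> moved S g")
      case True
      then have "g x \<in> moved S g" using app_moved[OF assms(2) x] by simp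
      then show ?thesis using assms(3) by (auto simp: moved_def)
    qed (use \<open>f x = x\<close> x in \<open>simp add: moved_def\<close>)
    ultimately show ?thesis by simp
  qed
  then show ?thesis using assms by (simp add: mult_eq_iff)
qed

end

section \<open>Recovering supports of involutions from the group structure\<close>

definition commutant :: "('g, 'm) monoid_scheme \<Rightarrow> 'g set \<Rightarrow> 'g set" where
  "commutant M A = {f \<in> carrier M. \<forall>a\<in>A. f \<otimes>\<^bsub>M\<^esub> a = a \<otimes>\<^bsub>M\<^esub> f}"

text \<open>The identity is included; its support is empty.\<close>

definition involutions :: "('g, 'm) monoid_scheme \<Rightarrow> 'g set" where
  "involutions M = {g \<in> carrier M. g \<otimes>\<^bsub>M\<^esub> g = \<one>\<^bsub>M\<^esub>}"

text \<open>
  If \<open>g\<close> is an involution of a sufficiently rich group of permutations, then the elements of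
  \<open>flips M g\<close> agree at every point with \<open>g\<close> or with the identity, and \<open>local_subgroup M g\<close>
  consists of all elements supported in the support of \<open>g\<close>: elements commuting with all flips
  have squares that are supported outside the support of \<open>g\<close>, and there are enough such squares.
\<close>

definition flips :: "('g, 'm) monoid_scheme \<Rightarrow> 'g \<Rightarrow> 'g set" where
  "flips M g = {\<phi> \<in> commutant M {g}. \<phi> \<in> involutions M \<and>
     (\<forall>\<psi>\<in>commutant M {g}. \<phi> \<in> commutant M {\<psi> \<otimes>\<^bsub>M\<^esub> \<phi> \<otimes>\<^bsub>M\<^esub> inv\<^bsub>M\<^esub> \<psi>})}"

definition local_subgroup :: "('g, 'm) monoid_scheme \<Rightarrow> 'g \<Rightarrow> 'g set" where
  "local_subgroup M g = commutant M ((\<lambda>f. f \<otimes>\<^bsub>M\<^esub> f) ` commutant M (flips M g))"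

section \<open>Invariance of the group-theoretic formulas under isomorphism\<close>

context
  fixes M :: "('g, 'm) monoid_scheme" and N :: "('h, 'n) monoid_scheme" and \<Phi>
  assumes M: "group M" and N: "group N" and iso: "\<Phi> \<in> iso M N"
begin

interpretation group_hom M N \<Phi>
  using M N iso by (simp add: group_hom_def group_hom_axioms_def iso_imp_homomorphism)

lemma iso_inj: "x \<in> carrier M \<Longrightarrow> y \<in> carrier M \<Longrightarrow> \<Phi> x = \<Phi> y \<longleftrightarrow> x = y"
  using iso by (auto simp: iso_def bij_betw_def inj_on_def)

lemma iso_surj: "\<Phi> ` carrier M = carrier N"
  using iso by (auto simp: iso_def bij_betw_def)

lemma iso_commutant_iff:
  assumes "f \<in> carrier M" "A \<subseteq> carrier M"
  shows "\<Phi> f \<in> commutant N (\<Phi> ` A) \<longleftrightarrow> f \<in> commutant M A"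
proof -
  have "\<Phi> f \<otimes>\<^bsub>N\<^esub> \<Phi> a = \<Phi> a \<otimes>\<^bsub>N\<^esub> \<Phi> f \<longleftrightarrow> f \<otimes>\<^bsub>M\<^esub> a = a \<otimes>\<^bsub>M\<^esub> f" if "a \<in> A" for a
    using that assms iso_inj[of "f \<otimes>\<^bsub>M\<^esub> a" "a \<otimes>\<^bsub>M\<^esub> f"] by (auto simp: subset_iff)
  then show ?thesis using assms by (auto simp: commutant_def)
qed

lemma iso_commutant:
  assumes "A \<subseteq> carrier M"
  shows "commutant N (\<Phi> ` A) = \<Phi> ` commutant M A"
proof -
  have "commutant N (\<Phi> ` A) \<subseteq> \<Phi> ` carrier M"
    by (auto simp: iso_surj commutant_def)
  moreover have "commutant M A \<subseteq> carrier M"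
    by (auto simp: commutant_def)
  ultimately show ?thesis
    using iso_commutant_iff[OF _ assms] by blast
qed

lemma iso_involutions_iff:
  assumes "f \<in> carrier M"
  shows "\<Phi> f \<in> involutions N \<longleftrightarrow> f \<in> involutions M"
  using assms iso_inj[of "f \<otimes>\<^bsub>M\<^esub> f" "\<one>\<^bsub>M\<^esub>"] by (auto simp: involutions_def)

lemma iso_involutions: "involutions N = \<Phi> ` involutions M"
proof -
  have "involutions N \<subseteq> \<Phi> ` carrier M" "involutions M \<subseteq> carrier M"
    by (auto simp: iso_surj involutions_def)
  then show ?thesis using iso_involutions_iff by blast
qed

lemma iso_flips:
  assumes "g \<in> carrier M"
  shows "flips N (\<Phi> g) = \<Phi> ` flips M g"
proof -
  have C: "commutant N {\<Phi> g} = \<Phi> ` commutant M {g}"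
    using iso_commutant[of "{g}"] assms by simp
  have sub: "commutant M {g} \<subseteq> carrier M" by (auto simp: commutant_def)
  have conj: "\<Phi> \<psi> \<otimes>\<^bsub>N\<^esub> \<Phi> \<phi> \<otimes>\<^bsub>N\<^esub> inv\<^bsub>N\<^esub> \<Phi> \<psi> = \<Phi> (\<psi> \<otimes>\<^bsub>M\<^esub> \<phi> \<otimes>\<^bsub>M\<^esub> inv\<^bsub>M\<^esub> \<psi>)"
    if "\<psi> \<in> carrier M" "\<phi> \<in> carrier M" for \<psi> \<phi>
    using that by simp
  have comm: "\<Phi> \<phi> \<in> commutant N {\<Phi> (\<psi> \<otimes>\<^bsub>M\<^esub> \<phi> \<otimes>\<^bsub>M\<^esub> inv\<^bsub>M\<^esub> \<psi>)} \<longleftrightarrow>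
      \<phi> \<in> commutant M {\<psi> \<otimes>\<^bsub>M\<^esub> \<phi> \<otimes>\<^bsub>M\<^esub> inv\<^bsub>M\<^esub> \<psi>}"
    if "\<psi> \<in> carrier M" "\<phi> \<in> carrier M" for \<psi> \<phi>
    using that iso_commutant_iff[of \<phi> "{\<psi> \<otimes>\<^bsub>M\<^esub> \<phi> \<otimes>\<^bsub>M\<^esub> inv\<^bsub>M\<^esub> \<psi>}"] by simp
  have "\<Phi> \<phi> \<in> flips N (\<Phi> g) \<longleftrightarrow> \<phi> \<in> flips M g" if \<phi>: "\<phi> \<in> commutant M {g}" for \<phi>
  proof -
    have "(\<forall>\<psi>\<in>commutant N {\<Phi> g}. \<Phi> \<phi> \<in> commutant N {\<psi> \<otimes>\<^bsub>N\<^esub> \<Phi> \<phi> \<otimes>\<^bsub>N\<^esub> inv\<^bsub>N\<^esub> \<psi>}) \<longleftrightarrow>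
        (\<forall>\<psi>\<in>commutant M {g}. \<phi> \<in> commutant M {\<psi> \<otimes>\<^bsub>M\<^esub> \<phi> \<otimes>\<^bsub>M\<^esub> inv\<^bsub>M\<^esub> \<psi>})"
      unfolding C ball_simps
    proof (rule ball_cong[OF refl])
      fix \<psi> assume "\<psi> \<in> commutant M {g}"
      then have "\<psi> \<in> carrier M" "\<phi> \<in> carrier M" using \<phi> sub by auto
      then show "\<Phi> \<phi> \<in> commutant N {\<Phi> \<psi> \<otimes>\<^bsub>N\<^esub> \<Phi> \<phi> \<otimes>\<^bsub>N\<^esub> inv\<^bsub>N\<^esub> \<Phi> \<psi>} \<longleftrightarrow>
          \<phi> \<in> commutant M {\<psi> \<otimes>\<^bsub>M\<^esub> \<phi> \<otimes>\<^bsub>M\<^esub> inv\<^bsub>M\<^esub> \<psi>}"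
        by (simp only: conj comm)
    qed
    moreover have "\<Phi> \<phi> \<in> commutant N {\<Phi> g}" unfolding C using \<phi> by (rule imageI)
    moreover have "\<Phi> \<phi> \<in> involutions N \<longleftrightarrow> \<phi> \<in> involutions M"
      using \<phi> sub by (intro iso_involutions_iff) auto
    ultimately show ?thesis using \<phi> by (simp only: flips_def mem_Collect_eq)
  qed
  moreover have "flips N (\<Phi> g) \<subseteq> \<Phi> ` commutant M {g}" "flips M g \<subseteq> commutant M {g}"
    unfolding C[symmetric] by (auto simp: flips_def)
  ultimately show ?thesis by blast
qed

text \<open>Commutants, flips and squares are all expressed by the group operations, so the
  isomorphism carries them over one layer at a time.\<close>

lemma iso_local_subgroup:
  assumes "g \<in> carrier M"
  shows "local_subgroup N (\<Phi> g) = \<Phi> ` local_subgroup M g"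
proof -
  have sub: "flips M g \<subseteq> carrier M" "commutant M (flips M g) \<subseteq> carrier M"
    by (auto simp: flips_def commutant_def)
  then have "(\<lambda>f. f \<otimes>\<^bsub>N\<^esub> f) ` \<Phi> ` commutant M (flips M g)
      = \<Phi> ` (\<lambda>f. f \<otimes>\<^bsub>M\<^esub> f) ` commutant M (flips M g)"
    by (force simp: image_image subset_iff)
  moreover have "(\<lambda>f. f \<otimes>\<^bsub>M\<^esub> f) ` commutant M (flips M g) \<subseteq> carrier M"
    using sub by auto
  ultimately show ?thesis
    by (simp add: local_subgroup_def iso_flips assms iso_commutant sub)
qed

end

text \<open>The axioms are what the support argument consumes. Fixed and moved sets are open, hence
  clopen; \<open>restrict_F\<close> supplies flips living on invariant clopen sets;
  \<open>ex_involution\<close> says that supports of involutions form a base. Compactness serves to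
  find the image points in \<open>ex_matching\<close>.\<close>

locale local_permutation_group = permutation_group "topspace T" F
  for T :: "'x topology" and F +
  assumes compact: "compact_space T" and hausdorff: "Hausdorff_space T"
    and openin_image: "f \<in> F \<Longrightarrow> openin T A \<Longrightarrow> openin T (f ` A)"
    and openin_moved: "f \<in> F \<Longrightarrow> openin T (moved (topspace T) f)"
    and openin_fixed: "f \<in> F \<Longrightarrow> openin T {x \<in> topspace T. f x = x}"
    and restrict_F: "f \<in> F \<Longrightarrow> openin T A \<Longrightarrow> closedin T A \<Longrightarrow> f ` A = A \<Longrightarrow>
      (\<lambda>x\<in>topspace T. if x \<in> A then f x else x) \<in> F"
    and ex_involution: "openin T A \<Longrightarrow> x \<in> A \<Longrightarrow>
      \<exists>g\<in>involutions P. x \<in> moved (topspace T) g \<and> moved (topspace T) g \<subseteq> A"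
begin

section \<open>Separation of images, flips and squares\<close>

abbreviation "S \<equiv> topspace T"

lemma involutions_F: "g \<in> involutions P \<Longrightarrow> g \<in> F"
  by (simp add: involutions_def)

lemma involution_app: "g \<in> involutions P \<Longrightarrow> x \<in> S \<Longrightarrow> g (g x) = x"
  using mult_one_iff[of g g] by (auto simp: involutions_def)

lemma closedin_moved: "f \<in> F \<Longrightarrow> closedin T (moved S f)"
proof -
  assume "f \<in> F"
  moreover have "S - moved S f = {x \<in> S. f x = x}" by (auto simp: moved_def)
  ultimately show ?thesis
    using openin_fixed by (auto simp: closedin_def moved_def)
qed

text \<open>Disjoint neighbourhoods of \<open>f x\<close> and \<open>g x\<close> are pulled back and
  intersected. As \<open>y\<close> and \<open>z\<close> vary independently, the whole images of
  \<open>B\<close> under \<open>f\<close> and \<open>g\<close> become disjoint.\<close>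

lemma separate_images:
  assumes "f \<in> F" "g \<in> F" "openin T U" "x \<in> U" "f x \<noteq> g x"
  obtains B where "openin T B" "x \<in> B" "B \<subseteq> U" "\<And>y z. y \<in> B \<Longrightarrow> z \<in> B \<Longrightarrow> f y \<noteq> g z"
proof -
  have x: "x \<in> S" using assms openin_subset by blast
  then obtain V W where VW: "openin T V" "openin T W" "f x \<in> V" "g x \<in> W" "disjnt V W"
    using hausdorff F_closed[OF assms(1) x] F_closed[OF assms(2) x] assms(5)
    unfolding Hausdorff_space_def by metis
  \<comment> \<open>Preimages are written as images under the inverse, the form in which openness is
    assumed.\<close>
  define B where "B = U \<inter> (inv\<^bsub>P\<^esub> f) ` V \<inter> (inv\<^bsub>P\<^esub> g) ` W"
  show thesis
  proof
    show "openin T B"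
      unfolding B_def using assms VW by (intro openin_Int openin_image) auto
    have "x \<in> (inv\<^bsub>P\<^esub> f) ` V" "x \<in> (inv\<^bsub>P\<^esub> g) ` W"
      using inv_app[OF assms(1) x] inv_app[OF assms(2) x] VW(3,4) by (metis imageI)+
    then show "x \<in> B" unfolding B_def using assms(4) by simp
    have "V \<subseteq> S" "W \<subseteq> S" using VW openin_subset by auto
    then have "f y \<in> V" if "y \<in> (inv\<^bsub>P\<^esub> f) ` V" for y
      using that app_inv[OF assms(1)] by auto
    moreover have "g y \<in> W" if "y \<in> (inv\<^bsub>P\<^esub> g) ` W" for y
      using that \<open>W \<subseteq> S\<close> app_inv[OF assms(2)] by auto
    ultimately have "f y \<in> V" "g y \<in> W" if "y \<in> B" for y
      using that unfolding B_def by simp_all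
    then show "f y \<noteq> g z" if "y \<in> B" "z \<in> B" for y z
      using VW(5) that by (force simp: disjnt_def)
  qed (auto simp: B_def)
qed

lemma separate_image:
  assumes "f \<in> F" "openin T U" "x \<in> U" "f x \<noteq> x"
  obtains B where "openin T B" "x \<in> B" "B \<subseteq> U" "\<And>y z. y \<in> B \<Longrightarrow> z \<in> B \<Longrightarrow> f y \<noteq> z"
proof -
  have US: "U \<subseteq> S" using assms(2) by (rule openin_subset)
  then have "f x \<noteq> \<one>\<^bsub>P\<^esub> x" using assms by auto
  then obtain B where B: "openin T B" "x \<in> B" "B \<subseteq> U"
      "\<And>y z. y \<in> B \<Longrightarrow> z \<in> B \<Longrightarrow> f y \<noteq> \<one>\<^bsub>P\<^esub> z"
    using separate_images[OF assms(1) one_F assms(2,3)] by metis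
  have "\<one>\<^bsub>P\<^esub> z = z" if "z \<in> B" for z using that B(3) US by auto
  then show thesis using that[of B] B by simp
qed

lemma moved_subsetD: "moved A f \<subseteq> B \<Longrightarrow> y \<in> A \<Longrightarrow> y \<notin> B \<Longrightarrow> f y = y"
  by (auto simp: moved_def)

text \<open>The witness \<open>\<beta>\<close> is a product of two involutions that do not commute.\<close>

lemma ex_nonvanishing_square:
  assumes "openin T A" "x \<in> A"
  obtains \<beta> w where "\<beta> \<in> F" "moved S \<beta> \<subseteq> A" "w \<in> A" "\<beta> (\<beta> w) \<noteq> w"
proof -
  have AS: "A \<subseteq> S" using assms openin_subset by blast
  obtain s where s: "s \<in> involutions P" "x \<in> moved S s" "moved S s \<subseteq> A"
    using ex_involution assms by blast
  have sF: "s \<in> F" using s involutions_F by blast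
  obtain B where B: "openin T B" "x \<in> B" "B \<subseteq> A" "\<And>y z. y \<in> B \<Longrightarrow> z \<in> B \<Longrightarrow> s y \<noteq> z"
    using separate_image[OF sF assms] s(2) by (auto simp: moved_def)
  obtain t where t: "t \<in> involutions P" "x \<in> moved S t" "moved S t \<subseteq> B"
    using ex_involution B by blast
  have tF: "t \<in> F" using t involutions_F by blast
  have x: "x \<in> S" using assms AS by blast
  have tx: "t x \<in> B" using t tF x by (auto simp: app_moved)
  \<comment> \<open>Since \<open>s\<close> throws \<open>B\<close> off itself, \<open>t\<close>
    fixes \<open>s x\<close> and \<open>s (t x)\<close>. In the square of the product at
    \<open>x\<close> the two factors \<open>s\<close> therefore cancel, leaving
    \<open>t x\<close>.\<close>
  then have "s x \<notin> B" "s (t x) \<notin> B" using B(2,4) by auto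
  then have fx: "t (s x) = s x" "t (s (t x)) = s (t x)" "t x \<noteq> x"
    using moved_subsetD[OF t(3)] t(2) x sF tF by (auto simp: moved_def)
  have "(s \<otimes>\<^bsub>P\<^esub> t) ((s \<otimes>\<^bsub>P\<^esub> t) x) = t x"
    using fx x sF tF s by (simp add: involution_app)
  moreover have "moved S (s \<otimes>\<^bsub>P\<^esub> t) \<subseteq> A"
  proof -
    have "moved S (s \<otimes>\<^bsub>P\<^esub> t) \<subseteq> moved S s \<union> moved S t"
      using sF tF by (auto simp: moved_def)
    then show ?thesis using s t B by blast
  qed
  ultimately show thesis
    using that[of "s \<otimes>\<^bsub>P\<^esub> t" x] sF tF assms fx by auto
qed

text \<open>Otherwise \<open>\<phi>\<close> carries a small neighbourhood \<open>B\<close> of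
  \<open>x\<close> off \<open>B\<close> and \<open>g\<close>
  B\<open>. A map\<close>\<psi>\<open>that commutes with\<close>g\<open>and lives on these two sets does not see\<close>\<phi>
  \<open>B\<close>, so commutation of \<open>\<phi>\<close> with its conjugate forces the square of
  \<open>\<psi>\<close> to be trivial on \<open>B\<close>. A \<open>\<psi>\<close> with nontrivial
  square refutes this.\<close>

lemma flips_app:
  assumes g: "g \<in> involutions P" and "\<phi> \<in> flips P g" and x: "x \<in> S"
  shows "\<phi> x = x \<or> \<phi> x = g x"
proof (rule ccontr)
  assume "\<not> ?thesis"
  then have ne: "\<phi> x \<noteq> x" "\<phi> x \<noteq> g x" by auto
  have gF: "g \<in> F" and \<phi>F: "\<phi> \<in> F"
    using assms by (auto simp: flips_def commutant_def involutions_F)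
  have \<phi>g: "\<phi> (g y) = g (\<phi> y)" if "y \<in> S" for y
    using assms(2) gF \<phi>F that by (auto simp: flips_def commutant_def mult_eq_iff)
  have \<phi>\<phi>: "\<phi> (\<phi> y) = y" if "y \<in> S" for y
    using assms(2) that by (auto simp: flips_def involution_app)
  obtain B1 where B1: "openin T B1" "x \<in> B1" "B1 \<subseteq> S" "\<And>y z. y \<in> B1 \<Longrightarrow> z \<in> B1 \<Longrightarrow> \<phi> y \<noteq> z"
    using separate_image[OF \<phi>F openin_topspace x ne(1)] by metis
  obtain B2 where B2: "openin T B2" "x \<in> B2" "B2 \<subseteq> B1" "\<And>y z. y \<in> B2 \<Longrightarrow> z \<in> B2 \<Longrightarrow> \<phi> y \<noteq> g z"
    using separate_images[OF \<phi>F gF B1(1,2) ne(2)] by metis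
  \<comment> \<open>After shrinking, \<open>g\<close> is either trivial on \<open>B\<close> or
    displaces it; in both cases a map supported in \<open>B\<close> can be completed to one
    commuting with \<open>g\<close>.\<close>
  obtain B where B: "openin T B" "x \<in> B" "B \<subseteq> B2"
      "(\<forall>y\<in>B. g y = y) \<or> (\<forall>y\<in>B. \<forall>z\<in>B. g y \<noteq> z)"
  proof (cases "g x = x")
    case True
    then show thesis
      using that[of "B2 \<inter> {y \<in> S. g y = y}"] openin_fixed[OF gF] B2 x by auto
  next
    case False
    then show thesis
      using separate_image[OF gF B2(1,2)] that by metis
  qed
  have BS: "B \<subseteq> S" using B(3) B2(3) B1(3) by auto
  have \<phi>B: "\<phi> y \<noteq> z" "\<phi> y \<noteq> g z" if "y \<in> B" "z \<in> B" for y z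
    using that B(3) B2(3) B2(4)[of y z] B1(4)[of y z] by auto
  obtain \<beta> w where \<beta>: "\<beta> \<in> F" "moved S \<beta> \<subseteq> B" "w \<in> B" "\<beta> (\<beta> w) \<noteq> w"
    using ex_nonvanishing_square[OF B(1,2)] by metis
  have \<beta>_fix: "\<beta> y = y" if "y \<in> S" "y \<notin> B" for y
    using moved_subsetD[OF \<beta>(2)] that by simp
  have \<beta>B: "\<beta> y \<in> B" if "y \<in> B" for y
    using app_moved[OF \<beta>(1), of y] \<beta>(2) that BS by (cases "\<beta> y = y") (auto simp: moved_def)
  obtain \<psi> where \<psi>: "\<psi> \<in> F" "\<psi> \<in> commutant P {g}" "\<And>y. y \<in> B \<Longrightarrow> \<psi> y = \<beta> y"
      "\<And>y. y \<in> S \<Longrightarrow> y \<notin> B \<Longrightarrow> y \<notin> g ` B \<Longrightarrow> \<psi> y = y"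
  proof (cases "\<forall>y\<in>B. g y = y")
    case True
    then have "moved S \<beta> \<inter> moved S g = {}" using \<beta>(2) by (auto simp: moved_def)
    then have "\<beta> \<in> commutant P {g}"
      using commute_if_moved_disjoint[OF \<beta>(1) gF] \<beta>(1) by (simp add: commutant_def)
    then show thesis using that[of \<beta>] \<beta>(1) \<beta>_fix by simp
  next
    case False
    then have gB: "g y \<notin> B" if "y \<in> B" for y using B(4) that by auto
    define \<gamma> where "\<gamma> = g \<otimes>\<^bsub>P\<^esub> \<beta> \<otimes>\<^bsub>P\<^esub> g"
    have \<gamma>F: "\<gamma> \<in> F" using gF \<beta>(1) by (simp add: \<gamma>_def)
    have \<gamma>_app: "\<gamma> y = g (\<beta> (g y))" if "y \<in> S" for y
      using gF \<beta>(1) that by (simp add: \<gamma>_def)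
    have \<gamma>_fix: "\<gamma> y = y" if "y \<in> S" "y \<notin> g ` B" for y
    proof -
      have "g y \<notin> B" using that involution_app[OF g, of y] by (metis image_eqI)
      then show ?thesis using \<gamma>_app that gF \<beta>_fix involution_app[OF g] by simp
    qed
    have comm: "\<beta> \<otimes>\<^bsub>P\<^esub> \<gamma> = \<gamma> \<otimes>\<^bsub>P\<^esub> \<beta>"
    proof (rule commute_if_moved_disjoint[OF \<beta>(1) \<gamma>F])
      show "moved S \<beta> \<inter> moved S \<gamma> = {}"
        using \<beta>(2) \<gamma>_fix gB by (fastforce simp: moved_def)
    qed
    have "(\<beta> \<otimes>\<^bsub>P\<^esub> \<gamma>) (g y) = g ((\<beta> \<otimes>\<^bsub>P\<^esub> \<gamma>) y)" if "y \<in> S" for y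
    proof -
      have "(\<beta> \<otimes>\<^bsub>P\<^esub> \<gamma>) (g y) = \<beta> (g (\<beta> y))"
        using that gF \<gamma>F \<beta>(1) by (simp add: \<gamma>_app involution_app[OF g])
      moreover have "g ((\<gamma> \<otimes>\<^bsub>P\<^esub> \<beta>) y) = \<beta> (g (\<beta> y))"
        using that gF \<gamma>F \<beta>(1) by (simp add: \<gamma>_app involution_app[OF g])
      ultimately show ?thesis using comm by simp
    qed
    then have "\<beta> \<otimes>\<^bsub>P\<^esub> \<gamma> \<in> commutant P {g}"
      using gF \<beta>(1) \<gamma>F by (simp add: commutant_def mult_eq_iff)
    moreover have "(\<beta> \<otimes>\<^bsub>P\<^esub> \<gamma>) y = \<beta> y" if "y \<in> B" for y
    proof -
      have "y \<notin> g ` B" using that gB by blast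
      then show ?thesis using \<gamma>_fix[of y] that \<beta>(1) \<gamma>F BS by auto
    qed
    moreover have "(\<beta> \<otimes>\<^bsub>P\<^esub> \<gamma>) y = y" if "y \<in> S" "y \<notin> B" "y \<notin> g ` B" for y
      using that \<gamma>_fix[of y] \<beta>_fix[of y] \<beta>(1) \<gamma>F by simp
    ultimately show thesis using that[of "\<beta> \<otimes>\<^bsub>P\<^esub> \<gamma>"] \<beta>(1) \<gamma>F by simp
  qed
  have wS: "w \<in> S" "\<beta> w \<in> B" "\<beta> w \<in> S" using \<beta> BS \<beta>B by auto
  have \<psi>_fix: "\<psi> (\<phi> y) = \<phi> y" if "y \<in> B" for y
  proof -
    have "\<phi> y \<notin> B" "\<phi> y \<notin> g ` B" using \<phi>B[OF that] by auto
    moreover have "\<phi> y \<in> S" using that BS \<phi>F by auto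
    ultimately show ?thesis using \<psi>(4) by simp
  qed
  have conj: "\<phi> \<otimes>\<^bsub>P\<^esub> (\<psi> \<otimes>\<^bsub>P\<^esub> \<phi> \<otimes>\<^bsub>P\<^esub> inv\<^bsub>P\<^esub> \<psi>) = (\<psi> \<otimes>\<^bsub>P\<^esub> \<phi> \<otimes>\<^bsub>P\<^esub> inv\<^bsub>P\<^esub> \<psi>) \<otimes>\<^bsub>P\<^esub> \<phi>"
    using assms(2) \<psi>(2) by (auto simp: flips_def commutant_def)
  have "\<phi> (\<psi> (\<phi> ((inv\<^bsub>P\<^esub> \<psi>) (\<psi> w)))) = \<psi> (\<phi> ((inv\<^bsub>P\<^esub> \<psi>) (\<phi> (\<psi> w))))"
    using fun_cong[OF conj, of "\<psi> w"] \<phi>F \<psi>(1) wS by simp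
  moreover have "(inv\<^bsub>P\<^esub> \<psi>) (\<phi> (\<psi> w)) = \<phi> (\<psi> w)"
    using \<psi>_fix[of "\<psi> w"] inv_app[OF \<psi>(1), of "\<phi> (\<psi> w)"] \<phi>F \<psi> \<beta>(3) wS by simp
  ultimately have "w = \<psi> (\<psi> w)"
    using \<psi>_fix[OF \<beta>(3)] \<phi>\<phi> \<psi>(1) wS by simp
  then show False using \<psi>(3) wS \<beta> by simp
qed

definition cut :: "('x \<Rightarrow> 'x) \<Rightarrow> 'x set \<Rightarrow> 'x \<Rightarrow> 'x" where
  "cut g A = (\<lambda>x\<in>S. if x \<in> A then g x else x)"

text \<open>On a pair \<open>{y, g y}\<close> the cut is the identity or the swap, and so is each of
  its conjugates by a map commuting with \<open>g\<close>. Two such maps commute on the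
  pair.\<close>

lemma cut_flips:
  assumes g: "g \<in> involutions P" and A: "openin T A" "closedin T A" "g ` A = A"
  shows "cut g A \<in> flips P g"
proof -
  have gF: "g \<in> F" using g involutions_F by blast
  have cF: "cut g A \<in> F" using restrict_F[OF gF A] by (simp add: cut_def)
  have AS: "A \<subseteq> S" using A openin_subset by blast
  have gA: "g y \<in> A \<longleftrightarrow> y \<in> A" if "y \<in> S" for y
    using A(3) involution_app[OF g that] by (metis image_eqI)
  have 1: "cut g A \<in> commutant P {g}"
    using gF cF gA by (simp add: commutant_def mult_eq_iff) (simp add: cut_def)
  have 2: "cut g A \<in> involutions P"
    using gF cF gA involution_app[OF g] by (simp add: involutions_def mult_one_iff) (simp add: cut_def)
  have 3: "cut g A \<in> commutant P {\<psi> \<otimes>\<^bsub>P\<^esub> cut g A \<otimes>\<^bsub>P\<^esub> inv\<^bsub>P\<^esub> \<psi>}" if "\<psi> \<in> commutant P {g}" for \<psi>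
  proof -
    have \<psi>F: "\<psi> \<in> F" using that by (simp add: commutant_def)
    have \<psi>g: "\<psi> (g y) = g (\<psi> y)" if "y \<in> S" for y
      using \<open>\<psi> \<in> commutant P {g}\<close> \<psi>F gF that by (simp add: commutant_def mult_eq_iff)
    let ?c = "\<psi> \<otimes>\<^bsub>P\<^esub> cut g A \<otimes>\<^bsub>P\<^esub> inv\<^bsub>P\<^esub> \<psi>"
    have c: "?c y = y \<and> ?c (g y) = g y \<or> ?c y = g y \<and> ?c (g y) = y" if y: "y \<in> S" for y
    proof -
      define z where "z = (inv\<^bsub>P\<^esub> \<psi>) y"
      have z: "z \<in> S" "y = \<psi> z" using y \<psi>F by (auto simp: z_def)
      have "?c (\<psi> z) = \<psi> (cut g A z)" "?c (\<psi> (g z)) = \<psi> (cut g A (g z))"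
        using z \<psi>F cF gF by simp_all
      then show ?thesis
        using z \<psi>g gA[of z] involution_app[OF g, of z] gF by (simp add: cut_def)
    qed
    have "cut g A (?c y) = ?c (cut g A y)" if y: "y \<in> S" for y
    proof -
      have "cut g A y = y \<and> cut g A (g y) = g y \<or> cut g A y = g y \<and> cut g A (g y) = y"
        using y gA gF involution_app[OF g y] by (simp add: cut_def)
      then show ?thesis using c[OF y] by (elim disjE conjE) simp_all
    qed
    then show ?thesis using \<psi>F cF by (simp add: commutant_def mult_eq_iff del: mult_app)
  qed
  show ?thesis using 1 2 3 by (simp add: flips_def)
qed

text \<open>If \<open>f x\<close> lay outside \<open>{x, g x}\<close>, a clopen
  \<open>g\<close>-invariant set could contain \<open>x\<close> but not \<open>f x\<close>;
  commuting with the cut of \<open>g\<close> there would give \<open>f (g x) = f x\<close>. So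
  \<open>f x\<close> is \<open>x\<close> or \<open>g x\<close>, and \<open>f\<close> also commutes
  with \<open>g\<close>.\<close>

lemma commutant_flips_square:
  assumes g: "g \<in> involutions P" and f: "f \<in> commutant P (flips P g)" and x: "x \<in> moved S g"
  shows "f (f x) = x"
proof -
  have gF: "g \<in> F" and fF: "f \<in> F" using g f by (auto simp: involutions_F commutant_def)
  have xS: "x \<in> S" using x by (simp add: moved_def)
  have comm: "f (\<phi> y) = \<phi> (f y)" if "\<phi> \<in> flips P g" "y \<in> S" for \<phi> y
  proof -
    have "\<phi> \<in> F" using that by (simp add: flips_def involutions_F)
    moreover have "f \<otimes>\<^bsub>P\<^esub> \<phi> = \<phi> \<otimes>\<^bsub>P\<^esub> f" using f that(1) by (simp add: commutant_def)
    ultimately show ?thesis using mult_eq_iff[of f \<phi> \<phi> f] fF that(2) by simp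
  qed
  have "cut g S \<in> flips P g"
    using F_bij_betw[OF gF] by (intro cut_flips[OF g]) (auto simp: bij_betw_def)
  then have fg: "f (g y) = g (f y)" if "y \<in> S" for y
    using comm[of "cut g S" y] that fF by (simp add: cut_def)
  have "f x = x \<or> f x = g x"
  proof (rule ccontr)
    assume "\<not> ?thesis"
    then have "f x \<noteq> x" "f x \<noteq> g x" by auto
    have "\<exists>A. openin T A \<and> closedin T A \<and> x \<in> A \<and> g ` A = A \<and> f x \<notin> A"
    proof -
      \<comment> \<open>Both points are removed, because the set to be built inside has to be
        enlarged by its image under \<open>g\<close>.\<close>
      define C where "C = S - {f x, g (f x)}"
      have "closedin T {f x, g (f x)}"
        using closedin_Hausdorff_sing_eq[OF hausdorff] xS gF fF
        by (metis F_closed closedin_Un insert_is_Un)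
      then have "openin T C" unfolding C_def by blast
      moreover have xC: "x \<in> C"
        using xS \<open>f x \<noteq> x\<close> \<open>f x \<noteq> g x\<close> involution_app[OF g F_closed[OF fF xS]] by (auto simp: C_def)
      ultimately obtain t where t: "t \<in> involutions P" "x \<in> moved S t" "moved S t \<subseteq> C"
        using ex_involution by metis
      have tF: "t \<in> F" using t involutions_F by simp
      have clo: "openin T (moved S t)" "closedin T (moved S t)" "openin T (g ` moved S t)"
        using tF gF openin_moved closedin_moved openin_image by auto
      \<comment> \<open>Images are only known to preserve openness. Recognising this image as the
        support of a conjugate shows that it is closed as well.\<close>
      have "g ` moved S t = moved S (g \<otimes>\<^bsub>P\<^esub> t \<otimes>\<^bsub>P\<^esub> g)"
      proof -
        have "y \<in> g ` moved S t \<longleftrightarrow> y \<in> moved S (g \<otimes>\<^bsub>P\<^esub> t \<otimes>\<^bsub>P\<^esub> g)" if y: "y \<in> S" for y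
        proof -
          have "y \<in> g ` moved S t \<longleftrightarrow> g y \<in> moved S t"
          proof
            assume "y \<in> g ` moved S t"
            then show "g y \<in> moved S t" using involution_app[OF g] by (auto simp: moved_def)
          next
            assume "g y \<in> moved S t"
            then have "g (g y) \<in> g ` moved S t" by (rule imageI)
            then show "y \<in> g ` moved S t" using involution_app[OF g y] by simp
          qed
          also have "\<dots> \<longleftrightarrow> t (g y) \<noteq> g y" using y gF by (simp add: moved_def)
          also have "\<dots> \<longleftrightarrow> g (t (g y)) \<noteq> y"
            using F_inj[OF gF, of "t (g y)" "g y"] y gF tF involution_app[OF g y] by simp
          finally show ?thesis using y gF tF by (simp add: moved_def)
        qed
        moreover have "g ` moved S t \<subseteq> S" "moved S (g \<otimes>\<^bsub>P\<^esub> t \<otimes>\<^bsub>P\<^esub> g) \<subseteq> S"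
          using gF by (auto simp: moved_def)
        ultimately show ?thesis by (meson subsetD subsetI subset_antisym)
      qed
      then have "closedin T (g ` moved S t)" using closedin_moved gF tF by simp
      moreover have "g ` (moved S t \<union> g ` moved S t) = moved S t \<union> g ` moved S t"
      proof -
        have "g ` g ` moved S t = moved S t"
          using involution_app[OF g] by (force simp: moved_def image_image)
        then show ?thesis by blast
      qed
      moreover have "f x \<notin> g ` moved S t"
      proof
        assume "f x \<in> g ` moved S t"
        then obtain y where "y \<in> moved S t" "f x = g y" by blast
        then have "y = g (f x)" using involution_app[OF g] by (simp add: moved_def)
        then show False using \<open>y \<in> moved S t\<close> t(3) by (auto simp: C_def)
      qed
      moreover have "f x \<notin> moved S t" using t(3) by (auto simp: C_def)
      ultimately show ?thesis using clo t(2)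
        by (intro exI[of _ "moved S t \<union> g ` moved S t"]) auto
    qed
    then obtain A where A: "openin T A" "closedin T A" "x \<in> A" "g ` A = A" "f x \<notin> A" by blast
    have "f (g x) = f x"
      using comm[OF cut_flips[OF g A(1,2,4)] xS] A xS fF by (simp add: cut_def)
    then show False using x xS gF fF by (auto simp: F_inj moved_def)
  qed
  then show ?thesis using fg[OF xS] involution_app[OF g xS] by auto
qed

theorem local_subgroup_eq:
  assumes g: "g \<in> involutions P"
  shows "local_subgroup P g = {k \<in> F. moved S k \<subseteq> moved S g}"
proof (intro Set.set_eqI iffI)
  have gF: "g \<in> F" using g involutions_F by blast
  fix k assume "k \<in> local_subgroup P g"
  then have kF: "k \<in> F"
    and k: "\<And>f. f \<in> commutant P (flips P g) \<Longrightarrow> k \<otimes>\<^bsub>P\<^esub> (f \<otimes>\<^bsub>P\<^esub> f) = (f \<otimes>\<^bsub>P\<^esub> f) \<otimes>\<^bsub>P\<^esub> k"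
    by (auto simp: local_subgroup_def commutant_def)
  have "x \<in> moved S g" if x: "x \<in> moved S k" for x
  proof (rule ccontr)
    assume "x \<notin> moved S g"
    then have xg: "x \<in> {y \<in> S. g y = y}" using x by (auto simp: moved_def)
    obtain B where B: "openin T B" "x \<in> B" "B \<subseteq> {y \<in> S. g y = y}" "\<And>y z. y \<in> B \<Longrightarrow> z \<in> B \<Longrightarrow> k y \<noteq> z"
      using separate_image[OF kF openin_fixed[OF gF] xg] x by (auto simp: moved_def)
    obtain \<beta> w where \<beta>: "\<beta> \<in> F" "moved S \<beta> \<subseteq> B" "w \<in> B" "\<beta> (\<beta> w) \<noteq> w"
      using ex_nonvanishing_square[OF B(1,2)] by metis
    \<comment> \<open>By \<open>flips_app\<close> every flip is trivial where \<open>g\<close> is,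
      in particular on the support of \<open>\<beta>\<close>.\<close>
    have "\<beta> \<in> commutant P (flips P g)"
    proof -
      have "\<beta> \<otimes>\<^bsub>P\<^esub> \<phi> = \<phi> \<otimes>\<^bsub>P\<^esub> \<beta>" if "\<phi> \<in> flips P g" for \<phi>
      proof (rule commute_if_moved_disjoint[OF \<beta>(1)])
        show "\<phi> \<in> F" using that by (simp add: flips_def involutions_F)
        have "\<phi> y = y" if "y \<in> B" for y
          using flips_app[OF g \<open>\<phi> \<in> flips P g\<close>, of y] B(3) that by auto
        then show "moved S \<beta> \<inter> moved S \<phi> = {}" using \<beta>(2) by (auto simp: moved_def)
      qed
      then show ?thesis using \<beta>(1) by (simp add: commutant_def)
    qed
    then have "k \<otimes>\<^bsub>P\<^esub> (\<beta> \<otimes>\<^bsub>P\<^esub> \<beta>) = (\<beta> \<otimes>\<^bsub>P\<^esub> \<beta>) \<otimes>\<^bsub>P\<^esub> k" by (rule k)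
    moreover have wS: "w \<in> S" using \<beta>(3) B(3) by blast
    ultimately have "k (\<beta> (\<beta> w)) = \<beta> (\<beta> (k w))"
      using \<beta>(1) kF by (simp add: mult_eq_iff)
    \<comment> \<open>\<open>k\<close> takes \<open>w\<close> out of the support of
      \<open>\<beta>\<close>, so commuting with the square of \<open>\<beta>\<close> would force
      that square to fix \<open>w\<close>.\<close>
    moreover have "k w \<notin> B" using B(4) \<beta>(3) by auto
    then have "\<beta> (k w) = k w" using moved_subsetD[OF \<beta>(2)] wS kF by simp
    ultimately have "k (\<beta> (\<beta> w)) = k w" by simp
    then show False using \<beta> wS kF by (simp add: F_inj)
  qed
  then show "k \<in> {k \<in> F. moved S k \<subseteq> moved S g}" using kF by blast
next
  have gF: "g \<in> F" using g involutions_F by blast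
  fix k assume k: "k \<in> {k \<in> F. moved S k \<subseteq> moved S g}"
  have "k \<otimes>\<^bsub>P\<^esub> (f \<otimes>\<^bsub>P\<^esub> f) = (f \<otimes>\<^bsub>P\<^esub> f) \<otimes>\<^bsub>P\<^esub> k" if f: "f \<in> commutant P (flips P g)" for f
  proof (rule commute_if_moved_disjoint)
    have fF: "f \<in> F" using f by (simp add: commutant_def)
    then show "f \<otimes>\<^bsub>P\<^esub> f \<in> F" by simp
    show "k \<in> F" using k by simp
    have "moved S g \<inter> moved S (f \<otimes>\<^bsub>P\<^esub> f) = {}"
      using commutant_flips_square[OF g f] fF by (auto simp: moved_def)
    then show "moved S k \<inter> moved S (f \<otimes>\<^bsub>P\<^esub> f) = {}" using k by blast
  qed
  then show "k \<in> local_subgroup P g"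
    using k by (auto simp: local_subgroup_def commutant_def)
qed

end

section \<open>Isomorphisms of local permutation groups are spatial\<close>

context permutation_group
begin

text \<open>This turns the position of an image point into the position of the point itself relative
  to another support, which is how the action on points is read off from supports.\<close>

lemma moved_conj_iff:
  assumes "f \<in> F" "g \<in> F" "x \<in> S"
  shows "x \<in> moved S (inv\<^bsub>P\<^esub> f \<otimes>\<^bsub>P\<^esub> g \<otimes>\<^bsub>P\<^esub> f) \<longleftrightarrow> f x \<in> moved S g"
  using assms F_inj[of "inv\<^bsub>P\<^esub> f" "g (f x)" "f x"] by (simp add: moved_def)

lemma conj_involution:
  assumes "f \<in> F" "g \<in> involutions P"
  shows "inv\<^bsub>P\<^esub> f \<otimes>\<^bsub>P\<^esub> g \<otimes>\<^bsub>P\<^esub> f \<in> involutions P"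
proof -
  have g: "g \<in> F" "\<forall>x\<in>S. g (g x) = x"
    using assms(2) mult_one_iff[of g g] by (auto simp: involutions_def)
  then show ?thesis using assms(1) by (simp add: involutions_def mult_one_iff)
qed

lemma moved_empty: "f \<in> F \<Longrightarrow> moved S f = {} \<Longrightarrow> f = \<one>\<^bsub>P\<^esub>"
  by (intro F_eqI) (auto simp: moved_def)

end

locale local_permutation_group_iso =
  M: local_permutation_group T F + N: local_permutation_group T' F'
  for T :: "'x topology" and F and T' :: "'y topology" and F' +
  fixes \<Phi>
  assumes \<Phi>: "\<Phi> \<in> iso M.P N.P"
begin

sublocale hom: group_hom M.P N.P \<Phi>
  using \<Phi> by (simp add: group_hom_def group_hom_axioms_def iso_imp_homomorphism
      M.is_group N.is_group)

section \<open>Inclusion and disjointness of supports under an isomorphism\<close>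

lemma \<Phi>_bij: "bij_betw \<Phi> F F'"
  using \<Phi> by (simp add: iso_def)

lemma involutions_\<Phi>: "g \<in> involutions M.P \<Longrightarrow> \<Phi> g \<in> involutions N.P"
  using iso_involutions[OF M.is_group N.is_group \<Phi>] by simp

text \<open>By \<open>local_subgroup_eq\<close> the inclusion is membership in
  \<open>local_subgroup\<close>, which isomorphisms preserve. Only the larger support has to come
  from an involution.\<close>

lemma moved_mono:
  assumes "g \<in> involutions M.P" "k \<in> F" "moved M.S k \<subseteq> moved M.S g"
  shows "moved N.S (\<Phi> k) \<subseteq> moved N.S (\<Phi> g)"
proof -
  have "k \<in> local_subgroup M.P g"
    using assms by (simp add: M.local_subgroup_eq)
  then have "\<Phi> k \<in> local_subgroup N.P (\<Phi> g)"
    using iso_local_subgroup[OF M.is_group N.is_group \<Phi>] assms(1) M.involutions_F by simp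
  then show ?thesis using assms(1) involutions_\<Phi> by (simp add: N.local_subgroup_eq)
qed

text \<open>The inverse isomorphism is another instance of the locale, so every one-sided result can
  also be used backwards.\<close>

lemma swap: "local_permutation_group_iso T' F' T F (inv_into F \<Phi>)"
  using M.iso_set_sym[OF \<Phi>]
  by (simp add: local_permutation_group_iso_def local_permutation_group_iso_axioms_def
      M.local_permutation_group_axioms N.local_permutation_group_axioms)

lemma inv_\<Phi>: "f \<in> F \<Longrightarrow> inv_into F \<Phi> (\<Phi> f) = f" "f' \<in> F' \<Longrightarrow> \<Phi> (inv_into F \<Phi> f') = f'"
  using \<Phi>_bij by (auto simp: bij_betw_inv_into_left bij_betw_inv_into_right)

text \<open>An involution supported in the intersection of the two image supports pulls back, by
  monotonicity in the reverse direction, to an element with empty support.\<close>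

lemma moved_disjoint:
  assumes "g \<in> involutions M.P" "k \<in> involutions M.P" "moved M.S k \<inter> moved M.S g = {}"
  shows "moved N.S (\<Phi> k) \<inter> moved N.S (\<Phi> g) = {}"
proof (rule ccontr)
  interpret R: local_permutation_group_iso T' F' T F "inv_into F \<Phi>" by (rule swap)
  assume "\<not> ?thesis"
  then obtain y where y: "y \<in> moved N.S (\<Phi> k) \<inter> moved N.S (\<Phi> g)" by auto
  have gk: "g \<in> F" "k \<in> F" using assms M.involutions_F by auto
  then have "openin T' (moved N.S (\<Phi> k) \<inter> moved N.S (\<Phi> g))"
    using hom.hom_closed by (intro openin_Int N.openin_moved) auto
  then obtain t where t: "t \<in> involutions N.P" "y \<in> moved N.S t"
      "moved N.S t \<subseteq> moved N.S (\<Phi> k) \<inter> moved N.S (\<Phi> g)"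
    using N.ex_involution[OF _ y] by auto
  have tF: "t \<in> F'" using t N.involutions_F by simp
  have "moved M.S (inv_into F \<Phi> t) \<subseteq> moved M.S (inv_into F \<Phi> (\<Phi> k))"
    using t assms tF by (intro R.moved_mono involutions_\<Phi>) auto
  moreover have "moved M.S (inv_into F \<Phi> t) \<subseteq> moved M.S (inv_into F \<Phi> (\<Phi> g))"
    using t assms tF by (intro R.moved_mono involutions_\<Phi>) auto
  ultimately have "moved M.S (inv_into F \<Phi> t) = {}"
    using assms(3) gk by (simp add: inv_\<Phi>) blast
  then have "inv_into F \<Phi> t = \<one>\<^bsub>M.P\<^esub>"
    using R.hom.hom_closed tF by (intro M.moved_empty) auto
  then have "t = \<one>\<^bsub>N.P\<^esub>" using inv_\<Phi>(2)[OF tF] by simp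
  then show False using t(2) by (auto simp: moved_def)
qed

text \<open>The graph of the homeomorphism to be found: a point is encoded by the supports of
  involutions that contain it.\<close>

definition matching :: "'x \<Rightarrow> 'y \<Rightarrow> bool" where
  "matching x y \<longleftrightarrow> x \<in> M.S \<and> y \<in> N.S \<and>
     (\<forall>g\<in>involutions M.P. x \<in> moved M.S g \<longleftrightarrow> y \<in> moved N.S (\<Phi> g))"

text \<open>The image supports of the involutions moving \<open>x\<close> are closed. Finitely many
  of them meet, because some nontrivial involution lives inside all the original supports;
  compactness then gives a common point.\<close>

lemma ex_matching:
  assumes x: "x \<in> M.S"
  shows "\<exists>y. matching x y"
proof -
  define Q where "Q = {g \<in> involutions M.P. x \<in> moved M.S g}"
  define \<C> where "\<C> = (\<lambda>g. moved N.S (\<Phi> g)) ` Q"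
  have QF: "Q \<subseteq> F" using M.involutions_F by (auto simp: Q_def)
  have "\<Inter>\<C> \<noteq> {}"
  proof -
    have "closedin T' C" if "C \<in> \<C>" for C
      using that QF hom.hom_closed N.closedin_moved by (auto simp: \<C>_def)
    moreover have "\<Inter>\<D> \<noteq> {}" if \<D>: "finite \<D>" "\<D> \<subseteq> \<C>" for \<D>
    proof -
      obtain R where R: "R \<subseteq> Q" "finite R" "\<D> = (\<lambda>g. moved N.S (\<Phi> g)) ` R"
        using finite_subset_image[OF \<D>[unfolded \<C>_def]] by auto
      \<comment> \<open>The factor \<open>M.S\<close> gives the empty subfamily a meaning.\<close>
      have "openin T (M.S \<inter> (\<Inter>g\<in>R. moved M.S g))"
      proof (cases "R = {}")
        case False
        then have "openin T (\<Inter>g\<in>R. moved M.S g)"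
          using R QF M.openin_moved by (intro openin_INT2) auto
        then show ?thesis by (intro openin_Int) auto
      qed auto
      moreover have "x \<in> M.S \<inter> (\<Inter>g\<in>R. moved M.S g)" using R x by (auto simp: Q_def)
      ultimately obtain k where k: "k \<in> involutions M.P" "x \<in> moved M.S k"
          "moved M.S k \<subseteq> M.S \<inter> (\<Inter>g\<in>R. moved M.S g)"
        using M.ex_involution by metis
      have kF: "k \<in> F" using k M.involutions_F by simp
      have "\<Phi> k \<noteq> \<one>\<^bsub>N.P\<^esub>"
      proof
        assume "\<Phi> k = \<one>\<^bsub>N.P\<^esub>"
        then have "k = \<one>\<^bsub>M.P\<^esub>"
          using \<Phi>_bij kF hom.hom_one by (metis M.one_F bij_betw_imp_inj_on inj_onD)
        then show False using k(2) by (auto simp: moved_def)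
      qed
      then have "moved N.S (\<Phi> k) \<noteq> {}"
        using N.moved_empty[of "\<Phi> k"] hom.hom_closed kF by auto
      moreover have "moved N.S (\<Phi> k) \<subseteq> moved N.S (\<Phi> g)" if "g \<in> R" for g
        using that R(1) k(3) kF by (intro moved_mono) (auto simp: Q_def)
      ultimately show ?thesis using R(3) by blast
    qed
    ultimately show ?thesis
      using N.compact[unfolded compact_space_fip, rule_format, of \<C>] by simp
  qed
  then obtain y where y: "y \<in> \<Inter>\<C>" by blast
  obtain k where k: "k \<in> Q"
    using M.ex_involution[OF openin_topspace x] by (auto simp: Q_def)
  then have yS: "y \<in> N.S" using y by (auto simp: \<C>_def moved_def)
  have fwd: "y \<in> moved N.S (\<Phi> g)" if "g \<in> involutions M.P" "x \<in> moved M.S g" for g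
    using y that by (auto simp: \<C>_def Q_def)
  \<comment> \<open>For the converse, an involution supported near \<open>x\<close> and off the
    support of \<open>g\<close> has an image support containing \<open>y\<close>, but disjoint from
    that of \<open>\<Phi> g\<close>.\<close>
  have "x \<in> moved M.S g" if g: "g \<in> involutions M.P" "y \<in> moved N.S (\<Phi> g)" for g
  proof (rule ccontr)
    assume "x \<notin> moved M.S g"
    moreover have "openin T (M.S - moved M.S g)"
      using M.closedin_moved[OF M.involutions_F[OF g(1)]] by blast
    ultimately obtain k where k: "k \<in> involutions M.P" "x \<in> moved M.S k" "moved M.S k \<subseteq> M.S - moved M.S g"
      using M.ex_involution x by (metis DiffI)
    have "moved N.S (\<Phi> k) \<inter> moved N.S (\<Phi> g) = {}"
      using g(1) k(1,3) by (intro moved_disjoint) auto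
    then show False using fwd[OF k(1,2)] g(2) by auto
  qed
  then have "matching x y" unfolding matching_def using x yS fwd by auto
  then show ?thesis ..
qed

text \<open>In a Hausdorff space, supports of involutions separate points, and every involution on
  the target side is an image.\<close>

lemma matching_unique:
  assumes "matching x y" "matching x y'"
  shows "y = y'"
proof (rule ccontr)
  assume ne: "y \<noteq> y'"
  have y: "y \<in> N.S" "y' \<in> N.S" using assms by (auto simp: matching_def)
  then have "closedin T' {y'}" using closedin_Hausdorff_sing_eq[OF N.hausdorff] by simp
  then have "openin T' (N.S - {y'})" by blast
  then obtain g where g: "g \<in> involutions N.P" "y \<in> moved N.S g" "moved N.S g \<subseteq> N.S - {y'}"
    using N.ex_involution[of "N.S - {y'}" y] y ne by auto
  then obtain k where k: "k \<in> involutions M.P" "g = \<Phi> k"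
    using iso_involutions[OF M.is_group N.is_group \<Phi>] by auto
  have "y' \<in> moved N.S g" using assms k g(2) by (simp add: matching_def)
  then show False using g(3) by auto
qed

lemma matching_swap:
  "matching x y \<longleftrightarrow> local_permutation_group_iso.matching T' F' T (inv_into F \<Phi>) y x"
proof -
  interpret R: local_permutation_group_iso T' F' T F "inv_into F \<Phi>" by (rule swap)
  have "inv_into F \<Phi> (\<Phi> g) = g" if "g \<in> involutions M.P" for g
    using that M.involutions_F inv_\<Phi>(1) by simp
  then show ?thesis
    unfolding matching_def R.matching_def iso_involutions[OF M.is_group N.is_group \<Phi>] by auto
qed

lemma matching_equivariant:
  assumes xy: "matching x y" and f: "f \<in> F"
  shows "matching (f x) (\<Phi> f y)"
proof -
  have S: "x \<in> M.S" "y \<in> N.S" "\<Phi> f \<in> F'" using xy f hom.hom_closed by (auto simp: matching_def)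
  have "f x \<in> moved M.S g \<longleftrightarrow> \<Phi> f y \<in> moved N.S (\<Phi> g)" if g: "g \<in> involutions M.P" for g
  proof -
    have gF: "g \<in> F" "\<Phi> g \<in> F'" using g M.involutions_F hom.hom_closed by auto
    let ?c = "inv\<^bsub>M.P\<^esub> f \<otimes>\<^bsub>M.P\<^esub> g \<otimes>\<^bsub>M.P\<^esub> f"
    have "f x \<in> moved M.S g \<longleftrightarrow> x \<in> moved M.S ?c"
      using M.moved_conj_iff f gF S by simp
    also have "\<dots> \<longleftrightarrow> y \<in> moved N.S (\<Phi> ?c)"
      using xy M.conj_involution[OF f g] by (simp add: matching_def)
    also have "\<Phi> ?c = inv\<^bsub>N.P\<^esub> \<Phi> f \<otimes>\<^bsub>N.P\<^esub> \<Phi> g \<otimes>\<^bsub>N.P\<^esub> \<Phi> f"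
      using f gF by simp
    also have "y \<in> moved N.S \<dots> \<longleftrightarrow> \<Phi> f y \<in> moved N.S (\<Phi> g)"
      using N.moved_conj_iff gF S by simp
    finally show ?thesis .
  qed
  then show ?thesis using S f by (simp add: matching_def)
qed

text \<open>Under the matching, supports of involutions correspond to supports of involutions. As
  these form bases on both sides, the map is continuous and open.\<close>

theorem spatial:
  obtains h where "bij_betw h M.S N.S" "homeomorphic_map T T' h"
    "\<And>f x. f \<in> F \<Longrightarrow> x \<in> M.S \<Longrightarrow> h (f x) = \<Phi> f (h x)"
proof -
  interpret R: local_permutation_group_iso T' F' T F "inv_into F \<Phi>" by (rule swap)
  define h where "h x = (THE y. matching x y)" for x
  have h: "matching x (h x)" if "x \<in> M.S" for x
    unfolding h_def using ex_matching[OF that] matching_unique by (metis theI)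
  have h_eq: "h x = y" if "matching x y" for x y
    unfolding h_def using that matching_unique by blast
  have S: "x \<in> M.S" "y \<in> N.S" if "matching x y" for x y using that by (auto simp: matching_def)
  have inj: "x = x'" if "matching x y" "matching x' y" for x x' y
    using that R.matching_unique matching_swap by metis
  have surj: "\<exists>x. matching x y" if "y \<in> N.S" for y
    using R.ex_matching[OF that] matching_swap by metis
  have bij: "bij_betw h M.S N.S"
  proof (rule bij_betw_imageI)
    show "inj_on h M.S" using h inj by (metis inj_onI)
    have "h x \<in> N.S" if "x \<in> M.S" for x using S(2)[OF h[OF that]] .
    moreover have "y \<in> h ` M.S" if y: "y \<in> N.S" for y
    proof -
      obtain x where "matching x y" using surj[OF y] by auto
      then have "h x = y" "x \<in> M.S" using h_eq S(1) by simp_all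
      then show ?thesis by auto
    qed
    ultimately show "h ` M.S = N.S" by auto
  qed
  have moved: "h x \<in> moved N.S (\<Phi> k) \<longleftrightarrow> x \<in> moved M.S k" if "k \<in> involutions M.P" "x \<in> M.S" for k x
    using h[OF that(2)] that(1) by (simp add: matching_def)
  have "continuous_map T T' h"
    unfolding continuous_map_def
  proof (intro conjI allI impI)
    show "h \<in> M.S \<rightarrow> N.S" using h S by blast
    fix B assume B: "openin T' B"
    have "\<exists>A. openin T A \<and> x \<in> A \<and> A \<subseteq> {x \<in> M.S. h x \<in> B}" if x: "x \<in> M.S" "h x \<in> B" for x
    proof -
      obtain g where g: "g \<in> involutions N.P" "h x \<in> moved N.S g" "moved N.S g \<subseteq> B"
        using N.ex_involution[OF B x(2)] by auto
      then obtain k where k: "k \<in> involutions M.P" "g = \<Phi> k"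
        using iso_involutions[OF M.is_group N.is_group \<Phi>] by auto
      have "openin T (moved M.S k)" using k M.involutions_F M.openin_moved by simp
      moreover have "z \<in> M.S \<and> h z \<in> B" if "z \<in> moved M.S k" for z
        using that moved[OF k(1), of z] g(3) k(2) by (auto simp: moved_def)
      ultimately show ?thesis using moved[OF k(1) x(1)] g(2) k(2) by blast
    qed
    then show "openin T {x \<in> M.S. h x \<in> B}"
      by (subst openin_subopen) simp
  qed
  moreover have "open_map T T' h"
    unfolding open_map_def
  proof (intro allI impI)
    fix A assume A: "openin T A"
    have "\<exists>B. openin T' B \<and> h x \<in> B \<and> B \<subseteq> h ` A" if x: "x \<in> A" for x
    proof -
      have xS: "x \<in> M.S" using x A openin_subset by blast
      obtain k where k: "k \<in> involutions M.P" "x \<in> moved M.S k" "moved M.S k \<subseteq> A"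
        using M.ex_involution[OF A x] by auto
      have "\<Phi> k \<in> F'" using k M.involutions_F hom.hom_closed by simp
      then have "openin T' (moved N.S (\<Phi> k))" by (rule N.openin_moved)
      moreover have "y \<in> h ` A" if y: "y \<in> moved N.S (\<Phi> k)" for y
      proof -
        have "y \<in> N.S" using y by (simp add: moved_def)
        then obtain z where "matching z y" using surj by auto
        then have "y = h z" "z \<in> M.S" using h_eq S by auto
        then show ?thesis using y moved[OF k(1)] k(3) by auto
      qed
      ultimately show ?thesis using moved[OF k(1) xS] k(2) by blast
    qed
    then show "openin T' (h ` A)"
      by (subst openin_subopen) auto
  qed
  ultimately have "homeomorphic_map T T' h"
    using bij by (simp add: bijective_open_imp_homeomorphic_map bij_betw_def)
  moreover have "h (f x) = \<Phi> f (h x)" if "f \<in> F" "x \<in> M.S" for f x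
    using h_eq matching_equivariant[OF h] that by simp
  ultimately show thesis using that bij by simp
qed

end

section \<open>Groups with a compact topology given by a scale\<close>

text \<open>An odometer without its coordinates: the cosets of the normal subgroups
  \<open>V n\<close> form a base of the topology. \<open>V_nontrivial\<close> excludes isolated
  points, since a singleton leaves no room for a nontrivial involution.\<close>

locale scaled_group = group X for X (structure) +
  fixes V :: "nat \<Rightarrow> 'x set" and T :: "'x topology"
  assumes V_normal: "V n \<lhd> X"
    and V_decseq: "decseq V"
    and V_Inter: "(\<Inter>n. V n) = {\<one>}"
    and V_nontrivial: "V n \<noteq> {\<one>}"
    and openin_iff: "openin T A \<longleftrightarrow>
      A \<subseteq> carrier X \<and> (\<forall>x\<in>A. \<exists>n. \<forall>v\<in>V n. v \<otimes> x \<in> A)"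
    and compact: "compact_space T"
begin

section \<open>Cosets of the scale and uniformity by compactness\<close>

lemma V_subgroup: "subgroup (V n) X"
  using V_normal normal_imp_subgroup by blast

lemma V_carrier [simp]: "v \<in> V n \<Longrightarrow> v \<in> carrier X"
  using V_subgroup subgroup.mem_carrier by metis

lemma V_mult [simp]: "v \<in> V n \<Longrightarrow> w \<in> V n \<Longrightarrow> v \<otimes> w \<in> V n"
  using V_subgroup subgroup.m_closed by metis

lemma V_inv [simp]: "v \<in> V n \<Longrightarrow> inv v \<in> V n"
  using V_subgroup subgroup.m_inv_closed by metis

lemma V_one [simp]: "\<one> \<in> V n"
  using V_subgroup subgroup.one_closed by metis

lemma V_conj [simp]: "v \<in> V n \<Longrightarrow> x \<in> carrier X \<Longrightarrow> x \<otimes> v \<otimes> inv x \<in> V n"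
  using V_normal normal_inv_iff by metis

lemma V_mono: "n \<le> m \<Longrightarrow> v \<in> V m \<Longrightarrow> v \<in> V n"
  using V_decseq by (auto simp: decseq_def)

lemma V_max: "v \<in> V (max n m) \<Longrightarrow> v \<in> V n" "v \<in> V (max n m) \<Longrightarrow> v \<in> V m"
  by (rule V_mono[rotated], assumption, simp)+

lemma mult_inv_cancel: "a \<in> carrier X \<Longrightarrow> x \<in> carrier X \<Longrightarrow> a \<otimes> x \<otimes> inv x = a"
  "a \<in> carrier X \<Longrightarrow> x \<in> carrier X \<Longrightarrow> a \<otimes> inv x \<otimes> x = a"
  by (simp_all add: m_assoc)

lemma coset_iff: "y \<in> V n #> x \<longleftrightarrow> (\<exists>v\<in>V n. y = v \<otimes> x)"
  by (auto simp: r_coset_def)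

lemma coset_iff': "x \<in> carrier X \<Longrightarrow> y \<in> carrier X \<Longrightarrow> y \<in> V n #> x \<longleftrightarrow> y \<otimes> inv x \<in> V n"
  by (auto simp: coset_iff mult_inv_cancel intro: bexI[of _ "y \<otimes> inv x"])

lemma coset_carrier: "x \<in> carrier X \<Longrightarrow> V n #> x \<subseteq> carrier X"
  by (auto simp: coset_iff)

lemma coset_self: "x \<in> carrier X \<Longrightarrow> x \<in> V n #> x"
  using rcos_self V_subgroup by blast

lemma coset_shift: "x \<in> carrier X \<Longrightarrow> y \<in> V n #> x \<Longrightarrow> v \<in> V n \<Longrightarrow> v \<otimes> y \<in> V n #> x"
  by (auto simp: coset_iff m_assoc[symmetric])

lemma coset_shift_iff:
  assumes "x \<in> carrier X" "y \<in> carrier X" "v \<in> V n"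
  shows "v \<otimes> y \<in> V n #> x \<longleftrightarrow> y \<in> V n #> x"
proof
  assume "v \<otimes> y \<in> V n #> x"
  then have "inv v \<otimes> (v \<otimes> y) \<in> V n #> x" using assms coset_shift by simp
  then show "y \<in> V n #> x" using assms by (simp add: m_assoc[symmetric])
qed (use assms coset_shift in simp)

lemma topspace [simp]: "topspace T = carrier X"
proof
  show "topspace T \<subseteq> carrier X" by (metis openin_iff openin_topspace)
  have "openin T (carrier X)" by (simp add: openin_iff)
  then show "carrier X \<subseteq> topspace T" by (rule openin_subset)
qed

text \<open>Such sets are unions of cosets of \<open>V n\<close>; invariance passes to the
  complement by shifting back.\<close>

lemma shift_invariant_clopen:
  assumes "A \<subseteq> carrier X" "\<And>v x. v \<in> V n \<Longrightarrow> x \<in> A \<Longrightarrow> v \<otimes> x \<in> A"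
  shows "openin T A" "closedin T A"
proof -
  show "openin T A" using assms by (auto simp: openin_iff)
  have "v \<otimes> x \<notin> A" if "v \<in> V n" "x \<in> carrier X" "x \<notin> A" for v x
  proof
    assume "v \<otimes> x \<in> A"
    then have "inv v \<otimes> (v \<otimes> x) \<in> A" using assms(2) that by simp
    then show False using that by (simp add: m_assoc[symmetric])
  qed
  then have "openin T (carrier X - A)" by (auto simp: openin_iff)
  then show "closedin T A" using assms(1) by (simp add: closedin_def)
qed

lemma coset_clopen:
  assumes "x \<in> carrier X"
  shows "openin T (V n #> x)" "closedin T (V n #> x)"
  using shift_invariant_clopen[of "V n #> x" n] coset_carrier coset_shift assms by auto

lemma coset_eq: "x \<in> carrier X \<Longrightarrow> y \<in> V n #> x \<Longrightarrow> V n #> y = V n #> x"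
  using repr_independence V_subgroup by metis

text \<open>A Lebesgue number argument. \<open>mono\<close> lets a property found at
  \<open>x\<close> spread over the coset of \<open>x\<close> and to greater depths, so the largest
  depth of a finite subcover serves everywhere.\<close>

lemma uniform:
  assumes ex: "\<And>x. x \<in> carrier X \<Longrightarrow> \<exists>n. Q n x"
    and mono: "\<And>n m x y. x \<in> carrier X \<Longrightarrow> Q n x \<Longrightarrow> y \<in> V n #> x \<Longrightarrow> n \<le> m \<Longrightarrow> Q m y"
  shows "\<exists>n. \<forall>x\<in>carrier X. Q n x"
proof -
  obtain k where k: "Q (k x) x" if "x \<in> carrier X" for x using ex by metis
  define \<U> where "\<U> = (\<lambda>x. V (k x) #> x) ` carrier X"
  have "\<forall>U\<in>\<U>. openin T U" using coset_clopen by (auto simp: \<U>_def)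
  moreover have "topspace T \<subseteq> \<Union>\<U>" using coset_self by (auto simp: \<U>_def)
  ultimately obtain \<F> where \<F>: "finite \<F>" "\<F> \<subseteq> \<U>" "topspace T \<subseteq> \<Union>\<F>"
    using compact unfolding compact_space_alt by metis
  obtain I where I: "I \<subseteq> carrier X" "finite I" "\<F> = (\<lambda>x. V (k x) #> x) ` I"
    using finite_subset_image[OF \<F>(1) \<F>(2)[unfolded \<U>_def]] by metis
  have "Q (Max (k ` I)) y" if y: "y \<in> carrier X" for y
  proof -
    obtain x where x: "x \<in> I" "y \<in> V (k x) #> x" using \<F>(3) I(3) y by auto
    moreover have "k x \<le> Max (k ` I)" using I(2) x(1) by simp
    ultimately show ?thesis using mono k I(1) by blast
  qed
  then show ?thesis by blast
qed

lemma clopen_uniform: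
  assumes "openin T A" "closedin T A"
  shows "\<exists>n. \<forall>v\<in>V n. \<forall>x\<in>carrier X. v \<otimes> x \<in> A \<longleftrightarrow> x \<in> A"
proof -
  have op: "openin T (carrier X - A)" using assms(2) by (simp add: closedin_def)
  have "\<exists>n. \<forall>x\<in>carrier X. V n #> x \<subseteq> A \<or> V n #> x \<subseteq> carrier X - A"
  proof (rule uniform)
    fix x assume x: "x \<in> carrier X"
    show "\<exists>n. V n #> x \<subseteq> A \<or> V n #> x \<subseteq> carrier X - A"
    proof (cases "x \<in> A")
      case True
      then obtain n where "\<forall>v\<in>V n. v \<otimes> x \<in> A" using assms(1) by (auto simp: openin_iff)
      then show ?thesis by (auto simp: coset_iff intro!: exI[of _ n])
    next
      case False
      then obtain n where "\<forall>v\<in>V n. v \<otimes> x \<in> carrier X - A" using op x unfolding openin_iff by blast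
      then show ?thesis by (auto simp: coset_iff intro!: exI[of _ n])
    qed
  next
    fix n m x y
    assume "x \<in> carrier X" "V n #> x \<subseteq> A \<or> V n #> x \<subseteq> carrier X - A" "y \<in> V n #> x" "n \<le> m"
    moreover from this have "V m #> y \<subseteq> V n #> x"
      using coset_shift V_mono by (auto simp: coset_iff[of _ m])
    ultimately show "V m #> y \<subseteq> A \<or> V m #> y \<subseteq> carrier X - A" by blast
  qed
  then obtain n where n: "\<forall>x\<in>carrier X. V n #> x \<subseteq> A \<or> V n #> x \<subseteq> carrier X - A" ..
  have "v \<otimes> x \<in> A \<longleftrightarrow> x \<in> A" if "v \<in> V n" "x \<in> carrier X" for v x
    using n that coset_self[of x n] coset_shift[of x x n v] by blast
  then show ?thesis by blast
qed

text \<open>The cosets form an open cover by disjoint sets, so a finite subcover omits none of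
  them.\<close>

lemma finite_rcosets_V: "finite (rcosets V n)"
proof -
  have sub: "rcosets V n = (\<lambda>x. V n #> x) ` carrier X" by (auto simp: RCOSETS_def)
  have "\<forall>U\<in>rcosets V n. openin T U" using coset_clopen by (auto simp: sub)
  moreover have "topspace T \<subseteq> \<Union>(rcosets V n)" using coset_self by (auto simp: sub)
  ultimately obtain \<F> where \<F>: "finite \<F>" "\<F> \<subseteq> rcosets V n" "topspace T \<subseteq> \<Union>\<F>"
    using compact unfolding compact_space_alt by metis
  have "C \<in> \<F>" if C: "C \<in> rcosets V n" for C
  proof -
    obtain x where x: "x \<in> carrier X" "C = V n #> x" using C sub by auto
    then obtain D where D: "D \<in> \<F>" "x \<in> D" using \<F>(3) by auto
    then obtain y where "y \<in> carrier X" "D = V n #> y" using \<F>(2) sub by auto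
    then show ?thesis using coset_eq D x by metis
  qed
  then show ?thesis using \<F>(1) by (meson finite_subset subsetI)
qed

lemma separate_cosets:
  assumes "x \<in> carrier X" "y \<in> carrier X" "x \<noteq> y"
  obtains n where "y \<notin> V n #> x"
proof -
  have "y \<otimes> inv x \<noteq> \<one>"
    using assms by (metis inv_closed inv_equality inv_inv)
  then obtain n where "y \<otimes> inv x \<notin> V n" using V_Inter by auto
  then show thesis using that assms coset_iff' by blast
qed

lemma Hausdorff: "Hausdorff_space T"
  unfolding Hausdorff_space_def
proof (intro allI impI)
  fix x y assume xy: "x \<in> topspace T \<and> y \<in> topspace T \<and> x \<noteq> y"
  then obtain n where n: "y \<notin> V n #> x" using separate_cosets by auto
  have "openin T (V n #> x)" "openin T (carrier X - (V n #> x))"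
    using coset_clopen[of x n] xy by auto (simp add: closedin_def)
  then show "\<exists>U W. openin T U \<and> openin T W \<and> x \<in> U \<and> y \<in> W \<and> disjnt U W"
    using n xy coset_self by (intro exI[of _ "V n #> x"] exI[of _ "carrier X - (V n #> x)"]) (auto simp: disjnt_def)
qed

text \<open>
  The members of \<open>E\<close> are automatically homeomorphisms, and \<open>E\<close> is both the topological full
  group of the right action and the stabilized automorphism group.
\<close>

definition E :: "('x \<Rightarrow> 'x) set" where
  "E = {f \<in> Bij (carrier X). \<exists>n. \<forall>v\<in>V n. \<forall>x\<in>carrier X. f (v \<otimes> x) = v \<otimes> f x}"

lemma E_Bij: "f \<in> E \<Longrightarrow> f \<in> Bij (carrier X)"
  by (simp add: E_def)

lemma E_I:
  assumes "f \<in> Bij (carrier X)" "\<And>v x. v \<in> V n \<Longrightarrow> x \<in> carrier X \<Longrightarrow> f (v \<otimes> x) = v \<otimes> f x"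
  shows "f \<in> E"
  using assms unfolding E_def by blast

lemma E_subgroup: "subgroup E (BijGroup (carrier X))"
proof (rule group.subgroupI[OF group_BijGroup])
  show "E \<subseteq> carrier (BijGroup (carrier X))" by (auto simp: E_def BijGroup_def)
  have "(\<lambda>x\<in>carrier X. x) \<in> E" by (simp add: E_def id_Bij)
  then show "E \<noteq> {}" by blast
next
  fix f assume "f \<in> E"
  then obtain n where f: "f \<in> Bij (carrier X)" "\<And>v x. v \<in> V n \<Longrightarrow> x \<in> carrier X \<Longrightarrow> f (v \<otimes> x) = v \<otimes> f x"
    by (auto simp: E_def)
  have inj: "inj_on f (carrier X)" and surj: "f ` carrier X = carrier X"
    using f(1) by (auto simp: Bij_def bij_betw_def)
  have "inv_into (carrier X) f (v \<otimes> x) = v \<otimes> inv_into (carrier X) f x"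
    if v: "v \<in> V n" and x: "x \<in> carrier X" for v x
  proof -
    obtain z where z: "z \<in> carrier X" "x = f z" using x surj by auto
    then have "v \<otimes> x = f (v \<otimes> z)" using f v by simp
    then show ?thesis using inj z v by (simp add: inv_into_f_f)
  qed
  then show "inv\<^bsub>BijGroup (carrier X)\<^esub> f \<in> E"
    using f(1) by (auto simp: E_def inv_BijGroup restrict_inv_into_Bij intro!: exI[of _ n])
next
  fix f g assume "f \<in> E" "g \<in> E"
  then obtain n where f: "f \<in> Bij (carrier X)" "\<And>v x. v \<in> V n \<Longrightarrow> x \<in> carrier X \<Longrightarrow> f (v \<otimes> x) = v \<otimes> f x"
    by (auto simp: E_def)
  from \<open>g \<in> E\<close> obtain m where g: "g \<in> Bij (carrier X)" "\<And>v x. v \<in> V m \<Longrightarrow> x \<in> carrier X \<Longrightarrow> g (v \<otimes> x) = v \<otimes> g x"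
    by (auto simp: E_def)
  have "v \<in> V n" "v \<in> V m" if "v \<in> V (max n m)" for v
    using V_max[OF that] by simp_all
  then have "\<forall>v\<in>V (max n m). \<forall>x\<in>carrier X. compose (carrier X) f g (v \<otimes> x) = v \<otimes> compose (carrier X) f g x"
    using f(2) g(2) Bij_imp_funcset[OF g(1)] by (simp add: compose_def Pi_iff)
  then show "f \<otimes>\<^bsub>BijGroup (carrier X)\<^esub> g \<in> E"
    using f(1) g(1) by (auto simp: E_def BijGroup_def compose_Bij)
qed

interpretation E: permutation_group "carrier X" E
  by (rule permutation_group.intro[OF E_subgroup])

lemma E_obtain:
  assumes "f \<in> E"
  obtains n where "\<And>v x. v \<in> V n \<Longrightarrow> x \<in> carrier X \<Longrightarrow> f (v \<otimes> x) = v \<otimes> f x"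
  using assms by (auto simp: E_def)

lemma E_open:
  assumes "f \<in> E" "openin T A"
  shows "openin T (f ` A)"
proof -
  obtain n where f: "\<And>v x. v \<in> V n \<Longrightarrow> x \<in> carrier X \<Longrightarrow> f (v \<otimes> x) = v \<otimes> f x"
    using E_obtain assms(1) by blast
  have A: "A \<subseteq> carrier X" using assms(2) by (simp add: openin_iff)
  have "\<exists>m. \<forall>v\<in>V m. v \<otimes> f x \<in> f ` A" if x: "x \<in> A" for x
  proof -
    obtain k where k: "\<forall>v\<in>V k. v \<otimes> x \<in> A" using assms(2) x by (auto simp: openin_iff)
    have "v \<otimes> f x \<in> f ` A" if v: "v \<in> V (max n k)" for v
    proof -
      have "v \<in> V n" "v \<in> V k" using V_max[OF v] by simp_all
      then have "v \<otimes> f x = f (v \<otimes> x)" "v \<otimes> x \<in> A" using f k x A by auto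
      then show ?thesis by auto
    qed
    then show ?thesis by blast
  qed
  moreover have "f ` A \<subseteq> carrier X" using A assms(1) by auto
  ultimately show ?thesis by (auto simp: openin_iff)
qed

text \<open>\<open>E\<close> is closed under inverses, so openness of all its members also yields
  their continuity.\<close>

lemma E_homeo: "f \<in> E \<Longrightarrow> f \<in> homeo T"
proof -
  assume f: "f \<in> E"
  have bij: "bij_betw f (carrier X) (carrier X)" using E.F_bij_betw f by blast
  have "open_map T T f" using E_open f by (simp add: open_map_def)
  moreover have "continuous_map T T f"
    unfolding continuous_map_def
  proof (intro conjI allI impI)
    show "f \<in> topspace T \<rightarrow> topspace T" using f by simp
    fix U assume U: "openin T U"
    have "{x \<in> topspace T. f x \<in> U} = (inv\<^bsub>E.P\<^esub> f) ` U"
    proof -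
      have "U \<subseteq> carrier X" using U by (simp add: openin_iff)
      moreover have "x \<in> (inv\<^bsub>E.P\<^esub> f) ` U" if "x \<in> carrier X" "f x \<in> U" for x
        using that E.inv_app[OF f that(1)] by (metis imageI)
      ultimately show ?thesis using f E.app_inv[OF f] E.inv_F[OF f] E.F_closed by auto
    qed
    then show "openin T {x \<in> topspace T. f x \<in> U}" using E_open E.inv_F f U by simp
  qed
  ultimately have "homeomorphic_map T T f"
    using bij by (intro bijective_open_imp_homeomorphic_map) (auto simp: bij_betw_def)
  then show ?thesis using E_Bij[OF f] by (simp add: homeo_def)
qed

lemma involution_Bij:
  assumes "s \<in> extensional S" "\<And>x. x \<in> S \<Longrightarrow> s x \<in> S" "\<And>x. x \<in> S \<Longrightarrow> s (s x) = x"
  shows "s \<in> Bij S"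
proof -
  have "bij_betw s S S"
    by (rule bij_betw_byWitness[where f' = s]) (use assms in auto)
  then show ?thesis using assms(1) by (simp add: Bij_def)
qed

text \<open>The involution swaps two disjoint cosets inside \<open>A\<close> by a right
  multiplication and its inverse. Right multiplications commute with left shifts, and the cosets are
  invariant under \<open>V m\<close>, hence the swap lies in \<open>E\<close>.\<close>

lemma ex_involution_E:
  assumes "openin T A" "x \<in> A"
  shows "\<exists>s\<in>involutions E.P. x \<in> moved (carrier X) s \<and> moved (carrier X) s \<subseteq> A"
proof -
  have x: "x \<in> carrier X" using assms by (auto simp: openin_iff)
  have "\<exists>n. \<forall>v\<in>V n. v \<otimes> x \<in> A" using assms by (simp add: openin_iff)
  then obtain n where n: "\<And>v. v \<in> V n \<Longrightarrow> v \<otimes> x \<in> A" by metis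
  obtain \<xi> where \<xi>: "\<xi> \<in> V n" "\<xi> \<noteq> \<one>" using V_nontrivial[of n] V_one by blast
  obtain m' where "\<xi> \<notin> V m'" using \<xi>(2) V_Inter by auto
  \<comment> \<open>Deep enough to separate \<open>\<xi>\<close> from the unit, which makes the
    cosets disjoint, and at least \<open>n\<close>, which keeps them inside
    \<open>A\<close>.\<close>
  define m where "m = max n m'"
  have m: "\<xi> \<notin> V m" "\<And>v. v \<in> V m \<Longrightarrow> v \<in> V n"
    using \<open>\<xi> \<notin> V m'\<close> V_max(2)[of \<xi> n m'] V_max(1)[of _ n m'] unfolding m_def by metis+
  \<comment> \<open>Chosen so that \<open>x \<otimes> c = \<xi> \<otimes> x\<close>: right
    multiplication by \<open>c\<close> moves the coset of \<open>x\<close> to that of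
    \<open>\<xi> \<otimes> x\<close>.\<close>
  define c where "c = inv x \<otimes> \<xi> \<otimes> x"
  have \<xi>c: "\<xi> \<in> carrier X" and c: "c \<in> carrier X" using \<xi> x by (auto simp: c_def)
  have xc: "v \<otimes> x \<otimes> c = v \<otimes> (\<xi> \<otimes> x)" "v \<otimes> (\<xi> \<otimes> x) \<otimes> inv c = v \<otimes> x" if "v \<in> carrier X" for v
  proof -
    have "x \<otimes> c = \<xi> \<otimes> x" using x \<xi>c by (simp add: c_def m_assoc[symmetric])
    then show "v \<otimes> x \<otimes> c = v \<otimes> (\<xi> \<otimes> x)" using that x c by (simp add: m_assoc)
    then show "v \<otimes> (\<xi> \<otimes> x) \<otimes> inv c = v \<otimes> x" using that x c by (metis m_closed mult_inv_cancel(1))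
  qed
  define B C where "B = V m #> x" and "C = V m #> (\<xi> \<otimes> x)"
  define s where "s = (\<lambda>y\<in>carrier X. if y \<in> B then y \<otimes> c else if y \<in> C then y \<otimes> inv c else y)"
  have disj: "y \<notin> C" if yB: "y \<in> B" for y
  proof
    assume "y \<in> C"
    then obtain v w where "v \<in> V m" "w \<in> V m" "v \<otimes> x = w \<otimes> \<xi> \<otimes> x"
      using yB \<xi>c x by (auto simp: B_def C_def coset_iff m_assoc)
    then have "v = w \<otimes> \<xi>" using x \<xi>c by simp
    then have "\<xi> = inv w \<otimes> v" using \<open>v \<in> V m\<close> \<open>w \<in> V m\<close> \<xi>c by (simp add: m_assoc[symmetric])
    then show False using m(1) \<open>v \<in> V m\<close> \<open>w \<in> V m\<close> by simp
  qed
  have BC: "B \<subseteq> carrier X" "C \<subseteq> carrier X" using x \<xi>c coset_carrier by (auto simp: B_def C_def)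
  have sB: "y \<otimes> c \<in> C" if "y \<in> B" for y
    using that xc(1) by (auto simp: B_def C_def coset_iff)
  have sC: "y \<otimes> inv c \<in> B" if "y \<in> C" for y
    using that xc(2) by (auto simp: B_def C_def coset_iff)
  have s_closed: "s y \<in> carrier X" if "y \<in> carrier X" for y
    using that c by (simp add: s_def)
  have ss: "s (s y) = y" if "y \<in> carrier X" for y
  proof -
    consider "y \<in> B" | "y \<in> C" "y \<notin> B" | "y \<notin> B" "y \<notin> C" by blast
    then show ?thesis
    proof cases
      case 1
      then show ?thesis using that c sB[of y] disj[of "y \<otimes> c"] by (auto simp: s_def mult_inv_cancel)
    next
      case 2
      then show ?thesis using that c sC[of y] by (simp add: s_def mult_inv_cancel)
    qed (use that in \<open>simp add: s_def\<close>)
  qed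
  have "s (v \<otimes> y) = v \<otimes> s y" if "v \<in> V m" "y \<in> carrier X" for v y
    using that x \<xi>c c by (simp add: s_def B_def C_def coset_shift_iff m_assoc)
  moreover have "s \<in> Bij (carrier X)"
    using s_closed ss by (intro involution_Bij) (auto simp: s_def)
  ultimately have sE: "s \<in> E" by (intro E_I)
  then have "s \<in> involutions E.P" using ss by (simp add: involutions_def E.mult_one_iff)
  moreover have "x \<in> moved (carrier X) s"
  proof -
    have "x \<in> B" using x coset_self by (simp add: B_def)
    then have "s x \<in> C" using sB x by (simp add: s_def)
    then show ?thesis using disj[OF \<open>x \<in> B\<close>] x by (auto simp: moved_def)
  qed
  moreover have "moved (carrier X) s \<subseteq> A"
  proof -
    have "moved (carrier X) s \<subseteq> B \<union> C" by (auto simp: moved_def s_def)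
    moreover have "B \<subseteq> A" using n m(2) by (auto simp: B_def coset_iff)
    moreover have "C \<subseteq> A"
    proof
      fix y assume "y \<in> C"
      then obtain v where "v \<in> V m" "y = v \<otimes> \<xi> \<otimes> x"
        using x \<xi>c by (auto simp: C_def coset_iff m_assoc)
      then show "y \<in> A" using n[of "v \<otimes> \<xi>"] m(2) \<xi>(1) by simp
    qed
    ultimately show ?thesis by blast
  qed
  ultimately show ?thesis by blast
qed

lemma local_permutation_group_E: "local_permutation_group T E"
proof (intro local_permutation_group.intro local_permutation_group_axioms.intro permutation_group.intro)
  show "subgroup E (BijGroup (topspace T))" using E_subgroup by simp
  show "compact_space T" "Hausdorff_space T" by (rule compact, rule Hausdorff)
  show "openin T (f ` A)" if "f \<in> E" "openin T A" for f A using that by (rule E_open)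
  show "openin T (moved (topspace T) f)" "openin T {x \<in> topspace T. f x = x}" if f: "f \<in> E" for f
  proof -
    obtain n where n: "\<And>v x. v \<in> V n \<Longrightarrow> x \<in> carrier X \<Longrightarrow> f (v \<otimes> x) = v \<otimes> f x"
      using E_obtain f by blast
    show "openin T (moved (topspace T) f)"
      by (rule shift_invariant_clopen(1)[of _ n]) (use f n in \<open>auto simp: moved_def\<close>)
    show "openin T {x \<in> topspace T. f x = x}"
      by (rule shift_invariant_clopen(1)[of _ n]) (use f n in auto)
  qed
  show "(\<lambda>x\<in>topspace T. if x \<in> A then f x else x) \<in> E"
    if f: "f \<in> E" and A: "openin T A" "closedin T A" "f ` A = A" for f A
  proof -
    obtain n where n: "\<And>v x. v \<in> V n \<Longrightarrow> x \<in> carrier X \<Longrightarrow> f (v \<otimes> x) = v \<otimes> f x"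
      using E_obtain f by blast
    obtain m where m: "\<forall>v\<in>V m. \<forall>x\<in>carrier X. v \<otimes> x \<in> A \<longleftrightarrow> x \<in> A"
      using clopen_uniform A by blast
    have AX: "A \<subseteq> carrier X" using A(1) by (simp add: openin_iff)
    let ?g = "\<lambda>x\<in>carrier X. if x \<in> A then f x else x"
    \<comment> \<open>One depth has to serve both the equivariance of \<open>f\<close> and the
      invariance of \<open>A\<close>.\<close>
    have "v \<in> V n" "v \<in> V m" if "v \<in> V (max n m)" for v
      using V_max[OF that] by simp_all
    then have g: "?g (v \<otimes> x) = v \<otimes> ?g x" if "v \<in> V (max n m)" "x \<in> carrier X" for v x
      using that n m by simp
    have "?g \<in> Bij (carrier X)"
    proof -
      have inj: "inj_on f (carrier X)" using f E.F_bij_betw by (auto simp: bij_betw_def)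
      have "bij_betw f A A" using inj AX A(3) by (auto simp: bij_betw_def intro: inj_on_subset)
      then have "bij_betw (\<lambda>x. if x \<in> A then f x else x) (A \<union> (carrier X - A)) (A \<union> (carrier X - A))"
        by (intro bij_betw_disjoint_Un) (auto simp: bij_betw_def inj_on_def)
      then have "bij_betw ?g (carrier X) (carrier X)"
        using AX by (simp add: Un_absorb1)
      then show ?thesis by (simp add: Bij_def)
    qed
    then have "?g \<in> E" using g by (rule E_I)
    then show ?thesis by simp
  qed
  show "\<exists>g\<in>involutions (permutation_monoid (topspace T) E).
      x \<in> moved (topspace T) g \<and> moved (topspace T) g \<subseteq> A"
    if "openin T A" "x \<in> A" for A x
    using ex_involution_E[OF that] by simp
qed

end

sublocale scaled_group \<subseteq> E: local_permutation_group T E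
  rewrites "topspace T = carrier X"
  using local_permutation_group_E by simp_all

text \<open>Serves for inversion within one group and for the coset-wise bijection between two
  groups; \<open>h\<close> needs no continuity.\<close>

lemma permutation_monoid_conj_iso:
  assumes h: "bij_betw h S S'" and F: "F \<subseteq> Bij S" "F' \<subseteq> Bij S'"
    and F': "\<And>f. f \<in> F \<Longrightarrow> (\<lambda>y\<in>S'. h (f (inv_into S h y))) \<in> F'"
    and F_inv: "\<And>f'. f' \<in> F' \<Longrightarrow> (\<lambda>x\<in>S. inv_into S h (f' (h x))) \<in> F"
  shows "permutation_monoid S F \<cong> permutation_monoid S' F'"
proof (rule is_isoI)
  define c where "c f = (\<lambda>y\<in>S'. h (f (inv_into S h y)))" for f
  define d where "d f' = (\<lambda>x\<in>S. inv_into S h (f' (h x)))" for f'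
  have inv: "inv_into S h (h x) = x" "h x \<in> S'" if "x \<in> S" for x
    using h that by (auto simp: bij_betw_inv_into_left bij_betw_def)
  have inv': "h (inv_into S h y) = y" "inv_into S h y \<in> S" if "y \<in> S'" for y
    using h that by (auto simp: bij_betw_inv_into_right bij_betw_def inv_into_into)
  have F_closed: "f x \<in> S" if "f \<in> F" "x \<in> S" for f x
    using that F(1) Bij_imp_funcset by blast
  have F'_closed: "f x \<in> S'" if "f \<in> F'" "x \<in> S'" for f x
    using that F(2) Bij_imp_funcset by blast
  have ext: "f \<in> extensional S" if "f \<in> F" for f
    using that F(1) Bij_imp_extensional by blast
  have ext': "f \<in> extensional S'" if "f \<in> F'" for f
    using that F(2) Bij_imp_extensional by blast
  have dc: "d (c f) = f" if "f \<in> F" for f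
    using that by (intro extensionalityI[of _ S]) (auto simp: c_def d_def inv F_closed ext)
  have cd: "c (d f) = f" if "f \<in> F'" for f
    using that by (intro extensionalityI[of _ S']) (auto simp: c_def d_def inv' F'_closed ext')
  have "bij_betw c F F'"
    by (rule bij_betw_byWitness[where f' = d]) (use dc cd F' F_inv in \<open>auto simp: c_def d_def\<close>)
  moreover have "c (f \<otimes>\<^bsub>permutation_monoid S F\<^esub> g) = c f \<otimes>\<^bsub>permutation_monoid S' F'\<^esub> c g"
    if fg: "f \<in> F" "g \<in> F" for f g
  proof -
    have B: "f \<in> Bij S" "g \<in> Bij S" using F(1) fg by auto
    have C: "c f \<in> Bij S'" "c g \<in> Bij S'" using F(2) F' fg by (auto simp: c_def)
    have "c (compose S f g) = compose S' (c f) (c g)"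
      by (rule extensionalityI[of _ S'])
        (auto simp: c_def compose_def inv inv' F_closed fg)
    then show ?thesis using B C by (simp add: permutation_monoid_def BijGroup_def)
  qed
  moreover have "c f \<in> F'" if "f \<in> F" for f using F' that by (simp add: c_def)
  ultimately show "c \<in> iso (permutation_monoid S F) (permutation_monoid S' F')"
    by (simp add: iso_def hom_def)
qed

section \<open>Topological full groups and stabilized automorphism groups\<close>

context scaled_group
begin

text \<open>By \<open>uniform\<close>, the clopen partition is refined by the cosets of a single
  \<open>V n\<close>; conversely these cosets form a finite clopen partition.\<close>

lemma full_group_set_iff:
  "f \<in> full_group_set X T \<alpha> \<longleftrightarrow>
    f \<in> homeo T \<and> (\<exists>n. \<forall>x\<in>carrier X. \<exists>g\<in>carrier X. \<forall>v\<in>V n. f (v \<otimes> x) = \<alpha> g (v \<otimes> x))"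
  (is "_ \<longleftrightarrow> _ \<and> ?R")
proof -
  have "?R" if f: "f \<in> full_group_set X T \<alpha>"
  proof -
    obtain P where P: "partition_on (carrier X) P"
      "\<And>A. A \<in> P \<Longrightarrow> openin T A \<and> (\<exists>g\<in>carrier X. \<forall>y\<in>A. f y = \<alpha> g y)"
      using f by (auto simp: full_group_set_def)
    have "\<exists>n. \<forall>x\<in>carrier X. \<exists>A\<in>P. V n #> x \<subseteq> A"
    proof (rule uniform)
      fix x assume "x \<in> carrier X"
      then obtain A where A: "A \<in> P" "x \<in> A" using P(1) by (auto simp: partition_on_def)
      then have "\<exists>n. \<forall>v\<in>V n. v \<otimes> x \<in> A" using P(2) by (simp add: openin_iff)
      then obtain n where "\<forall>v\<in>V n. v \<otimes> x \<in> A" ..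
      then have "V n #> x \<subseteq> A" by (auto simp: coset_iff)
      then show "\<exists>n. \<exists>A\<in>P. V n #> x \<subseteq> A" using A by blast
    next
      fix n m x y
      assume a: "x \<in> carrier X" "\<exists>A\<in>P. V n #> x \<subseteq> A" "y \<in> V n #> x" "n \<le> m"
      have "V m #> y \<subseteq> V n #> x"
        using a coset_shift V_mono by (auto simp: coset_iff[of _ m])
      then show "\<exists>A\<in>P. V m #> y \<subseteq> A" using a(2) by blast
    qed
    then obtain n where n: "\<And>x. x \<in> carrier X \<Longrightarrow> \<exists>A\<in>P. V n #> x \<subseteq> A" by auto
    have "\<exists>g\<in>carrier X. \<forall>v\<in>V n. f (v \<otimes> x) = \<alpha> g (v \<otimes> x)" if x: "x \<in> carrier X" for x
    proof -
      obtain A where A: "A \<in> P" "V n #> x \<subseteq> A" using n x by auto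
      have "v \<otimes> x \<in> V n #> x" if "v \<in> V n" for v using that by (auto simp: coset_iff)
      then have "v \<otimes> x \<in> A" if "v \<in> V n" for v using that A(2) by blast
      then show ?thesis using P(2)[OF A(1)] by auto
    qed
    then show ?thesis by blast
  qed
  moreover have "f \<in> full_group_set X T \<alpha>" if h: "f \<in> homeo T" and R: "?R"
  proof -
    obtain n where n: "\<And>x. x \<in> carrier X \<Longrightarrow> \<exists>g\<in>carrier X. \<forall>v\<in>V n. f (v \<otimes> x) = \<alpha> g (v \<otimes> x)"
      using R by auto
    have sub: "rcosets V n = (\<lambda>x. V n #> x) ` carrier X" by (auto simp: RCOSETS_def)
    have "partition_on (carrier X) (rcosets V n)"
      unfolding partition_on_def
    proof (intro conjI)
      show "\<Union>(rcosets V n) = carrier X" by (rule rcosets_part_G[OF V_subgroup])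
      show "disjoint (rcosets V n)"
        using rcos_disjoint[OF V_subgroup] by (simp add: disjoint_def pairwise_def disjnt_def)
      show "{} \<notin> rcosets V n" using coset_self by (force simp: sub)
    qed
    moreover have "openin T A \<and> closedin T A \<and> (\<exists>g\<in>carrier X. \<forall>y\<in>A. f y = \<alpha> g y)"
      if "A \<in> rcosets V n" for A
      using that coset_clopen n by (fastforce simp: sub coset_iff)
    ultimately show ?thesis
      using h finite_rcosets_V[of n] by (auto simp: full_group_set_def intro!: exI[of _ "rcosets V n"])
  qed
  moreover have "f \<in> homeo T" if "f \<in> full_group_set X T \<alpha>"
    using that by (simp add: full_group_set_def)
  ultimately show ?thesis by blast
qed

lemma homeo_Bij: "f \<in> homeo T \<Longrightarrow> f \<in> Bij (carrier X)"
  by (simp add: homeo_def)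

lemma Bij_closed: "f \<in> Bij (carrier X) \<Longrightarrow> x \<in> carrier X \<Longrightarrow> f x \<in> carrier X"
  using Bij_imp_funcset by blast

text \<open>A right translation commutes with left shifts. Conversely, an \<open>f\<close>
  equivariant under \<open>V n\<close> is determined on \<open>V n #> x\<close> by its value at
  \<open>x\<close>, and is a right translation there.\<close>

lemma full_group_right: "full_group_set X T (right_action X) = E"
proof (intro Set.set_eqI iffI)
  fix f assume "f \<in> full_group_set X T (right_action X)"
  then obtain n where f: "f \<in> homeo T"
    and n: "\<And>x. x \<in> carrier X \<Longrightarrow> \<exists>g\<in>carrier X. \<forall>v\<in>V n. f (v \<otimes> x) = right_action X g (v \<otimes> x)"
    by (auto simp: full_group_set_iff)
  show "f \<in> E"
  proof (rule E_I[of _ n])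
    fix v x assume v: "v \<in> V n" and x: "x \<in> carrier X"
    obtain g where g: "g \<in> carrier X" "\<And>v. v \<in> V n \<Longrightarrow> f (v \<otimes> x) = right_action X g (v \<otimes> x)"
      using n[OF x] by metis
    show "f (v \<otimes> x) = v \<otimes> f x"
      using g(2)[OF v] g(2)[OF V_one] g(1) v x by (simp add: right_action_def m_assoc)
  qed (use f homeo_Bij in blast)
next
  fix f assume f: "f \<in> E"
  then obtain n where n: "\<And>v x. v \<in> V n \<Longrightarrow> x \<in> carrier X \<Longrightarrow> f (v \<otimes> x) = v \<otimes> f x"
    using E_obtain by blast
  have "\<exists>g\<in>carrier X. \<forall>v\<in>V n. f (v \<otimes> x) = right_action X g (v \<otimes> x)" if x: "x \<in> carrier X" for x
  proof -
    have fx: "f x \<in> carrier X" using f x E.F_closed by blast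
    \<comment> \<open>The translating element is the inverse of \<open>inv x \<otimes> f x\<close>,
      because the right action multiplies by an inverse.\<close>
    have "right_action X (inv (f x) \<otimes> x) (v \<otimes> x) = v \<otimes> f x" if v: "v \<in> V n" for v
    proof -
      have "v \<otimes> x \<otimes> inv (inv (f x) \<otimes> x) = v \<otimes> x \<otimes> (inv x \<otimes> f x)"
        using x fx by (simp add: inv_mult_group)
      also have "\<dots> = v \<otimes> f x" using x fx v by (simp add: m_assoc[symmetric] mult_inv_cancel)
      finally show ?thesis using x v by (simp add: right_action_def)
    qed
    then show ?thesis using n x fx by (intro bexI[of _ "inv (f x) \<otimes> x"]) auto
  qed
  then show "f \<in> full_group_set X T (right_action X)"
    using E_homeo[OF f] by (auto simp: full_group_set_iff)
qed

section \<open>Inversion exchanges the left and right full groups\<close>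

lemma bij_betw_inv: "bij_betw (\<lambda>x. inv x) (carrier X) (carrier X)"
  by (rule bij_betw_byWitness[where f' = "\<lambda>x. inv x"]) auto

lemma inv_into_inv: "y \<in> carrier X \<Longrightarrow> inv_into (carrier X) (\<lambda>x. inv x) y = inv y"
  using bij_betw_inv bij_betw_inv_into_left[of "\<lambda>x. inv x" "carrier X" "carrier X" "inv y"] by simp

text \<open>By normality \<open>v \<otimes> inv x\<close> is the inverse of
  \<open>w \<otimes> x\<close>, where \<open>w = x \<otimes> inv v \<otimes> inv x\<close> again
  lies in \<open>V n\<close>.\<close>

lemma homeomorphic_inv: "homeomorphic_map T T (\<lambda>x. inv x)"
proof -
  have op: "openin T ((\<lambda>x. inv x) ` A)" if A: "openin T A" for A
  proof -
    have AX: "A \<subseteq> carrier X" using A by (simp add: openin_iff)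
    have "\<exists>n. \<forall>v\<in>V n. v \<otimes> inv x \<in> (\<lambda>x. inv x) ` A" if x: "x \<in> A" for x
    proof -
      have "\<exists>n. \<forall>v\<in>V n. v \<otimes> x \<in> A" using A x by (simp add: openin_iff)
      then obtain n where n: "\<And>v. v \<in> V n \<Longrightarrow> v \<otimes> x \<in> A" by auto
      have xX: "x \<in> carrier X" using x AX by auto
      have "v \<otimes> inv x \<in> (\<lambda>x. inv x) ` A" if v: "v \<in> V n" for v
      proof
        show "x \<otimes> inv v \<otimes> inv x \<otimes> x \<in> A" using n v xX by simp
        show "v \<otimes> inv x = inv (x \<otimes> inv v \<otimes> inv x \<otimes> x)"
          using v xX by (simp add: mult_inv_cancel inv_mult_group)
      qed
      then show ?thesis by blast
    qed
    then show ?thesis using AX by (auto simp: openin_iff)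
  qed
  have "continuous_map T T (\<lambda>x. inv x)"
    unfolding continuous_map_def
  proof (intro conjI allI impI)
    fix U assume U: "openin T U"
    then have "U \<subseteq> carrier X" by (simp add: openin_iff)
    then have "{x \<in> topspace T. inv x \<in> U} = (\<lambda>x. inv x) ` U"
      by (force simp: image_iff)
    then show "openin T {x \<in> topspace T. inv x \<in> U}" using op U by simp
  qed auto
  moreover have "open_map T T (\<lambda>x. inv x)" using op by (simp add: open_map_def)
  ultimately show ?thesis
    using bij_betw_inv by (intro bijective_open_imp_homeomorphic_map) (auto simp: bij_betw_def)
qed

lemma inv_conj_full_left:
  assumes "f \<in> full_group_set X T (left_action X)"
  shows "(\<lambda>y\<in>carrier X. inv (f (inv y))) \<in> E"
proof -
  obtain n where f: "f \<in> homeo T"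
    and n: "\<And>x. x \<in> carrier X \<Longrightarrow> \<exists>g\<in>carrier X. \<forall>v\<in>V n. f (v \<otimes> x) = left_action X g (v \<otimes> x)"
    using assms by (auto simp: full_group_set_iff)
  have fB: "f \<in> Bij (carrier X)" using f homeo_Bij by simp
  show ?thesis
  proof (rule E_I[of _ n])
    have "bij_betw (\<lambda>y. inv (f (inv y))) (carrier X) (carrier X)"
      using bij_betw_trans[OF bij_betw_trans[OF bij_betw_inv] bij_betw_inv, of f] fB
      by (simp add: Bij_def comp_def)
    then show "(\<lambda>y\<in>carrier X. inv (f (inv y))) \<in> Bij (carrier X)" by (simp add: Bij_def)
    fix v x assume v: "v \<in> V n" and x: "x \<in> carrier X"
    obtain g where g: "g \<in> carrier X"
        "\<And>v. v \<in> V n \<Longrightarrow> f (v \<otimes> inv x) = left_action X g (v \<otimes> inv x)"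
      using n[of "inv x"] inv_closed[OF x] by metis
    \<comment> \<open>Inverting \<open>v \<otimes> x\<close> puts the shift on the right of
      \<open>inv x\<close>; normality brings it back to the left, so the same translating element
      \<open>g\<close> applies.\<close>
    have "inv x \<otimes> inv v \<otimes> x \<in> V n" using V_conj[of "inv v" n "inv x"] x v by simp
    then have "f (inv x \<otimes> inv v \<otimes> x \<otimes> inv x) = left_action X g (inv x \<otimes> inv v \<otimes> x \<otimes> inv x)"
      by (rule g(2))
    moreover have "inv x \<otimes> inv v \<otimes> x \<otimes> inv x = inv x \<otimes> inv v" using x v by (simp add: mult_inv_cancel)
    ultimately have "f (inv x \<otimes> inv v) = g \<otimes> (inv x \<otimes> inv v)"
      using x v by (simp add: left_action_def)
    then have "f (inv (v \<otimes> x)) = g \<otimes> (inv x \<otimes> inv v)"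
      using x v by (simp add: mult_inv_cancel inv_mult_group)
    moreover have "f (inv x) = g \<otimes> inv x"
      using g(2)[OF V_one] g(1) x by (simp add: left_action_def)
    ultimately show "(\<lambda>y\<in>carrier X. inv (f (inv y))) (v \<otimes> x) = v \<otimes> (\<lambda>y\<in>carrier X. inv (f (inv y))) x"
      using g x v by (simp add: inv_mult_group m_assoc)
  qed
qed

lemma inv_conj_E:
  assumes f: "f \<in> E"
  shows "(\<lambda>x\<in>carrier X. inv (f (inv x))) \<in> full_group_set X T (left_action X)"
proof -
  obtain n where n: "\<And>v x. v \<in> V n \<Longrightarrow> x \<in> carrier X \<Longrightarrow> f (v \<otimes> x) = v \<otimes> f x"
    using E_obtain f by blast
  let ?c = "\<lambda>x\<in>carrier X. inv (f (inv x))"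
  have "homeomorphic_map T T f" using E_homeo[OF f] by (simp add: homeo_def)
  then have "homeomorphic_map T T ((\<lambda>x. inv x) \<circ> (f \<circ> (\<lambda>x. inv x)))"
    using homeomorphic_inv by (intro homeomorphic_map_compose)
  then have hc: "homeomorphic_map T T ?c"
    by (rule homeomorphic_map_eq) simp
  then have "bij_betw ?c (carrier X) (carrier X)"
    using bij_betw_def homeomorphic_imp_injective_map[OF hc] homeomorphic_imp_surjective_map[OF hc] by auto
  then have "?c \<in> homeo T" using hc by (simp add: homeo_def Bij_def)
  moreover have "\<exists>g\<in>carrier X. \<forall>v\<in>V n. ?c (v \<otimes> x) = left_action X g (v \<otimes> x)" if x: "x \<in> carrier X" for x
  proof -
    define y where "y = f (inv x)"
    have y: "y \<in> carrier X" using f x by (simp add: y_def)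
    \<comment> \<open>Inversion turns the value of \<open>f\<close> at
      \<open>inv (v \<otimes> x)\<close> into
      \<open>inv y \<otimes> inv x \<otimes> (v \<otimes> x)\<close>, with a translating element
      independent of \<open>v\<close>.\<close>
    have "?c (v \<otimes> x) = left_action X (inv y \<otimes> inv x) (v \<otimes> x)" if v: "v \<in> V n" for v
    proof -
      have w: "inv x \<otimes> inv v \<otimes> x \<in> V n" using V_conj[of "inv v" n "inv x"] x v by simp
      have "f (inv (v \<otimes> x)) = f (inv x \<otimes> inv v \<otimes> x \<otimes> inv x)"
        using x v by (simp add: mult_inv_cancel inv_mult_group)
      also have "\<dots> = inv x \<otimes> inv v \<otimes> x \<otimes> y" using n[OF w] x by (simp add: y_def)
      finally show ?thesis using x y v by (simp add: left_action_def inv_mult_group m_assoc)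
    qed
    then show ?thesis using x y by (intro bexI[of _ "inv y \<otimes> inv x"]) auto
  qed
  ultimately show ?thesis by (auto simp: full_group_set_iff)
qed

lemma topological_full_group_eq:
  "topological_full_group X T \<alpha> = permutation_monoid (carrier X) (full_group_set X T \<alpha>)"
  by (simp add: topological_full_group_def permutation_monoid_def)

lemma full_right_eq: "topological_full_group X T (right_action X) = E.P"
  by (simp add: topological_full_group_eq full_group_right)

lemma full_left_iso: "topological_full_group X T (left_action X) \<cong> E.P"
  unfolding topological_full_group_eq
proof (rule permutation_monoid_conj_iso[OF bij_betw_inv])
  show "full_group_set X T (left_action X) \<subseteq> Bij (carrier X)"
    using homeo_Bij by (auto simp: full_group_set_def)
  show "E \<subseteq> Bij (carrier X)" using E_Bij by blast
  have eq: "(\<lambda>y\<in>carrier X. inv (f (inv_into (carrier X) (\<lambda>x. inv x) y))) =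
      (\<lambda>y\<in>carrier X. inv (f (inv y)))" for f
    by (rule restrict_ext) (simp add: inv_into_inv)
  show "(\<lambda>y\<in>carrier X. inv (f (inv_into (carrier X) (\<lambda>x. inv x) y))) \<in> E"
    if "f \<in> full_group_set X T (left_action X)" for f
    unfolding eq using inv_conj_full_left[OF that] .
  have "(\<lambda>x\<in>carrier X. inv_into (carrier X) (\<lambda>x. inv x) (f (inv x))) =
      (\<lambda>y\<in>carrier X. inv (f (inv y)))" if "f \<in> E" for f
    using that by (intro restrict_ext) (simp add: inv_into_inv)
  then show "(\<lambda>x\<in>carrier X. inv_into (carrier X) (\<lambda>x. inv x) (f (inv x)))
      \<in> full_group_set X T (left_action X)" if "f \<in> E" for f
    using inv_conj_E that by simp
qed

text \<open>Inversion is its own inverse, so the two conjugation lemmas simply exchange their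
  roles.\<close>

lemma full_left_iso': "E.P \<cong> topological_full_group X T (left_action X)"
  unfolding topological_full_group_eq
proof (rule permutation_monoid_conj_iso[OF bij_betw_inv])
  show "full_group_set X T (left_action X) \<subseteq> Bij (carrier X)"
    using homeo_Bij by (auto simp: full_group_set_def)
  show "E \<subseteq> Bij (carrier X)" using E_Bij by blast
  have "(\<lambda>y\<in>carrier X. inv (f (inv_into (carrier X) (\<lambda>x. inv x) y))) =
      (\<lambda>y\<in>carrier X. inv (f (inv y)))" for f
    by (rule restrict_ext) (simp add: inv_into_inv)
  then show "(\<lambda>y\<in>carrier X. inv (f (inv_into (carrier X) (\<lambda>x. inv x) y)))
      \<in> full_group_set X T (left_action X)" if "f \<in> E" for f
    using inv_conj_E[OF that] by simp
  have "(\<lambda>x\<in>carrier X. inv_into (carrier X) (\<lambda>x. inv x) (f (inv x))) =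
      (\<lambda>y\<in>carrier X. inv (f (inv y)))" if "f \<in> full_group_set X T (left_action X)" for f
    using that homeo_Bij Bij_closed
    by (intro restrict_ext) (simp add: inv_into_inv full_group_set_def)
  then show "(\<lambda>x\<in>carrier X. inv_into (carrier X) (\<lambda>x. inv x) (f (inv x))) \<in> E"
    if "f \<in> full_group_set X T (left_action X)" for f
    using inv_conj_full_left that by simp
qed

section \<open>Equivariance subgroups and stabilized automorphisms\<close>

lemma continuous_at_coset:
  assumes f: "continuous_map T T f" and x: "x \<in> carrier X"
  shows "\<exists>m. \<forall>v\<in>V m. f (v \<otimes> x) \<in> V n #> f x"
proof -
  have fx: "f x \<in> carrier X" using f x by (auto simp: continuous_map_def)
  have "openin T {y \<in> topspace T. f y \<in> V n #> f x}"
    using f coset_clopen(1)[OF fx] by (simp add: continuous_map_def)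
  moreover have "x \<in> {y \<in> topspace T. f y \<in> V n #> f x}"
    using x coset_self[OF fx] by simp
  ultimately show ?thesis unfolding openin_iff by blast
qed

lemma homeo_continuous: "f \<in> homeo T \<Longrightarrow> continuous_map T T f"
  by (simp add: homeo_def homeomorphic_imp_continuous_map)

definition equivariants :: "('x \<Rightarrow> 'x) \<Rightarrow> 'x set" where
  "equivariants f = {\<xi> \<in> carrier X. \<forall>x\<in>carrier X. f (\<xi> \<otimes> x) = \<xi> \<otimes> f x}"

lemma equivariants_subgroup:
  assumes "f \<in> homeo T"
  shows "subgroup (equivariants f) X"
proof (rule subgroupI)
  have f: "f x \<in> carrier X" if "x \<in> carrier X" for x
    using assms homeo_Bij Bij_closed that by simp
  show "equivariants f \<subseteq> carrier X" by (auto simp: equivariants_def)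
  have "\<one> \<in> equivariants f" using f by (simp add: equivariants_def)
  then show "equivariants f \<noteq> {}" by auto
  show "inv \<xi> \<in> equivariants f" if "\<xi> \<in> equivariants f" for \<xi>
  proof -
    have \<xi>: "\<xi> \<in> carrier X" "\<And>x. x \<in> carrier X \<Longrightarrow> f (\<xi> \<otimes> x) = \<xi> \<otimes> f x"
      using that by (auto simp: equivariants_def)
    have "f (inv \<xi> \<otimes> x) = inv \<xi> \<otimes> f x" if x: "x \<in> carrier X" for x
      using \<xi>(2)[of "inv \<xi> \<otimes> x"] \<xi>(1) x f by (simp add: m_assoc[symmetric])
    then show ?thesis using \<xi>(1) by (simp add: equivariants_def)
  qed
  show "\<xi> \<otimes> \<eta> \<in> equivariants f" if "\<xi> \<in> equivariants f" "\<eta> \<in> equivariants f" for \<xi> \<eta>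
    using that f by (simp add: equivariants_def m_assoc)
qed

text \<open>A failure of equivariance for \<open>\<xi>\<close> is an inequality of two points. A
  coset separates them, and by continuity the failure persists for all
  \<open>v \<otimes> \<xi>\<close> with \<open>v\<close> small.\<close>

lemma closed_cosets_equivariants:
  assumes f: "f \<in> homeo T" and a: "a \<in> carrier X"
  shows "closedin T (equivariants f #> a)"
proof -
  have fc: "f x \<in> carrier X" if "x \<in> carrier X" for x
    using f homeo_Bij Bij_closed that by simp
  have eq_iff: "y \<in> equivariants f #> a \<longleftrightarrow> y \<otimes> inv a \<in> equivariants f" if y: "y \<in> carrier X" for y
  proof
    assume "y \<in> equivariants f #> a"
    then show "y \<otimes> inv a \<in> equivariants f"
      using a by (auto simp: r_coset_def mult_inv_cancel equivariants_def)
  next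
    assume "y \<otimes> inv a \<in> equivariants f"
    then show "y \<in> equivariants f #> a"
      using a y mult_inv_cancel(2)[of y a] by (force simp: r_coset_def)
  qed
  have "\<exists>n. \<forall>v\<in>V n. v \<otimes> y \<in> carrier X - (equivariants f #> a)"
    if y: "y \<in> carrier X - (equivariants f #> a)" for y
  proof -
    define \<xi> where "\<xi> = y \<otimes> inv a"
    have yX: "y \<in> carrier X" and \<xi>: "\<xi> \<in> carrier X" "\<xi> \<notin> equivariants f"
      using y a eq_iff by (auto simp: \<xi>_def)
    then obtain x where x: "x \<in> carrier X" "f (\<xi> \<otimes> x) \<noteq> \<xi> \<otimes> f x"
      by (auto simp: equivariants_def)
    obtain n where n: "\<xi> \<otimes> f x \<notin> V n #> f (\<xi> \<otimes> x)"
      using separate_cosets[of "f (\<xi> \<otimes> x)" "\<xi> \<otimes> f x"] x \<xi>(1) fc by auto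
    obtain m where m: "\<And>v. v \<in> V m \<Longrightarrow> f (v \<otimes> (\<xi> \<otimes> x)) \<in> V n #> f (\<xi> \<otimes> x)"
      using continuous_at_coset[OF homeo_continuous[OF f] m_closed[OF \<xi>(1) x(1)], of n] by metis
    \<comment> \<open>Depth \<open>n\<close> keeps the shifted \<open>\<xi> \<otimes> f x\<close>
      outside the separating coset, while depth \<open>m\<close> keeps the values of
      \<open>f\<close> inside it.\<close>
    have "v \<otimes> y \<notin> equivariants f #> a" if v: "v \<in> V (max n m)" for v
    proof
      assume "v \<otimes> y \<in> equivariants f #> a"
      moreover have "v \<otimes> y \<otimes> inv a = v \<otimes> \<xi>" using v yX a by (simp add: \<xi>_def m_assoc)
      ultimately have "v \<otimes> \<xi> \<in> equivariants f" using eq_iff[of "v \<otimes> y"] v yX by simp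
      then have "f (v \<otimes> (\<xi> \<otimes> x)) = v \<otimes> (\<xi> \<otimes> f x)"
        using x \<xi>(1) v fc by (simp add: equivariants_def m_assoc)
      then have "v \<otimes> (\<xi> \<otimes> f x) \<in> V n #> f (\<xi> \<otimes> x)" using m[OF V_max(2)[OF v]] by simp
      then show False using n coset_shift_iff[of "f (\<xi> \<otimes> x)" "\<xi> \<otimes> f x" v n] V_max(1)[OF v] x \<xi>(1) fc by simp
    qed
    then show ?thesis using yX by (auto intro!: exI[of _ "max n m"])
  qed
  then have "openin T (carrier X - (equivariants f #> a))" by (auto simp: openin_iff)
  moreover have "equivariants f #> a \<subseteq> carrier X" using a by (auto simp: r_coset_def equivariants_def)
  ultimately show ?thesis by (simp add: closedin_def)
qed

text \<open>Finitely many cosets of the equivariance subgroup \<open>C\<close> cover the image of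
  \<open>G\<close>. Their union is closed, hence by density everything. So \<open>C\<close> is the
  complement of finitely many closed cosets and is open; containing some \<open>V n\<close> is then
  what membership in \<open>E\<close> demands.\<close>

theorem stabilized_eq:
  fixes G :: "('g, 'm) monoid_scheme" and \<tau> :: "'g \<Rightarrow> 'x"
  assumes G: "group G" and \<tau>: "\<tau> \<in> hom G X"
    and dense: "\<And>x n. x \<in> carrier X \<Longrightarrow> \<exists>g\<in>carrier G. \<tau> g \<in> V n #> x"
    and index: "\<And>n. finite_index G {g \<in> carrier G. \<tau> g \<in> V n}"
    and \<alpha>: "\<And>g x. g \<in> carrier G \<Longrightarrow> x \<in> carrier X \<Longrightarrow> \<alpha> g x = \<tau> g \<otimes> x"
  shows "stabilized_Aut G T \<alpha> = E.P"
proof -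
  interpret \<tau>: group_hom G X \<tau>
    using G \<tau> by (simp add: group_hom_def group_hom_axioms_def is_group)
  have "f \<in> E" if K: "subgroup K G" "finite_index G K" and f: "f \<in> Aut_set T \<alpha> K" for f K
  proof -
    have fh: "f \<in> homeo T" and fK: "\<And>g x. g \<in> K \<Longrightarrow> x \<in> carrier X \<Longrightarrow> f (\<alpha> g x) = \<alpha> g (f x)"
      using f by (auto simp: Aut_set_def)
    have fc: "f x \<in> carrier X" if "x \<in> carrier X" for x
      using fh homeo_Bij Bij_closed that by simp
    have KG: "K \<subseteq> carrier G" using K(1) subgroup.subset by blast
    define C where "C = equivariants f"
    have C: "subgroup C X" using equivariants_subgroup fh by (simp add: C_def)
    have \<tau>K: "\<tau> k \<in> C" if "k \<in> K" for k
      using fK[OF that] that KG fc \<alpha> by (auto simp: C_def equivariants_def subset_iff)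
    \<comment> \<open>Any choice will do: representatives of one coset differ by an element of
      \<open>K\<close>, which \<open>\<tau>\<close> maps into \<open>C\<close>.\<close>
    define rep where "rep D = (SOME g. g \<in> D)" for D :: "'g set"
    define \<D> where "\<D> = (\<lambda>D. C #> \<tau> (rep D)) ` (rcosets\<^bsub>G\<^esub> K)"
    have rep: "\<exists>k\<in>K. rep (K #>\<^bsub>G\<^esub> g) = k \<otimes>\<^bsub>G\<^esub> g" if g: "g \<in> carrier G" for g
    proof -
      have "g \<in> K #>\<^bsub>G\<^esub> g" using \<tau>.G.rcos_self g K(1) by blast
      then have "rep (K #>\<^bsub>G\<^esub> g) \<in> K #>\<^bsub>G\<^esub> g" unfolding rep_def by (rule someI)
      then show ?thesis by (auto simp: r_coset_def)
    qed
    then have repX: "rep D \<in> carrier G" if "D \<in> rcosets\<^bsub>G\<^esub> K" for D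
      using that KG by (force simp: RCOSETS_def)
    have fin: "finite \<D>" using K(2) by (simp add: \<D>_def finite_index_def)
    have closed: "closedin T D" if "D \<in> \<D>" for D
      using that repX closed_cosets_equivariants[OF fh] by (auto simp: \<D>_def C_def)
    have cover: "\<tau> g \<in> \<Union>\<D>" if g: "g \<in> carrier G" for g
    proof -
      obtain k where k: "k \<in> K" "rep (K #>\<^bsub>G\<^esub> g) = k \<otimes>\<^bsub>G\<^esub> g" using rep g by blast
      then have "\<tau> g = inv (\<tau> k) \<otimes> \<tau> (rep (K #>\<^bsub>G\<^esub> g))"
        using g KG by (simp add: m_assoc[symmetric] subset_iff)
      moreover have "inv (\<tau> k) \<in> C" using \<tau>K k(1) subgroup.m_inv_closed[OF C] by simp
      ultimately have "\<tau> g \<in> C #> \<tau> (rep (K #>\<^bsub>G\<^esub> g))" by (auto simp: r_coset_def)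
      then show ?thesis using g by (auto simp: \<D>_def RCOSETS_def)
    qed
    have closedU: "closedin T (\<Union>\<F>)" if "\<F> \<subseteq> \<D>" for \<F>
      using that fin closed finite_subset by (intro closedin_Union) auto
    have all: "carrier X \<subseteq> \<Union>\<D>"
    proof
      fix x assume x: "x \<in> carrier X"
      show "x \<in> \<Union>\<D>"
      proof (rule ccontr)
        assume "x \<notin> \<Union>\<D>"
        moreover have "openin T (carrier X - \<Union>\<D>)" using closedU[of \<D>] by (simp add: closedin_def)
        ultimately obtain n where n: "\<forall>v\<in>V n. v \<otimes> x \<in> carrier X - \<Union>\<D>" using x unfolding openin_iff by blast
        obtain g where "g \<in> carrier G" "\<tau> g \<in> V n #> x" using dense x by blast
        then show False using n cover[of g] by (auto simp: coset_iff)
      qed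
    qed
    have "carrier X - \<Union>(\<D> - {C}) = C"
    proof -
      have disj: "D \<inter> C = {}" if D: "D \<in> \<D>" "D \<noteq> C" for D
      proof -
        obtain D' where D': "D' \<in> rcosets\<^bsub>G\<^esub> K" "D = C #> \<tau> (rep D')" using D(1) by (auto simp: \<D>_def)
        then have "\<tau> (rep D') \<in> carrier X" using repX by simp
        then have "D \<in> rcosets C" using D'(2) by (auto simp: RCOSETS_def)
        moreover have "C \<in> rcosets C"
          using C coset_mult_one[of C] by (force simp: RCOSETS_def subgroup.subset)
        ultimately show ?thesis
          using rcos_disjoint[OF C] D(2) by (auto simp: pairwise_def disjnt_def)
      qed
      show ?thesis
      proof (intro equalityI subsetI)
        fix x assume x: "x \<in> carrier X - \<Union>(\<D> - {C})"
        then obtain D where "D \<in> \<D>" "x \<in> D" using all by auto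
        then show "x \<in> C" using x by (cases "D = C") auto
      next
        fix x assume x: "x \<in> C"
        then have "x \<notin> D" if "D \<in> \<D> - {C}" for D using disj[of D] that by auto
        then show "x \<in> carrier X - \<Union>(\<D> - {C})" using subgroup.mem_carrier[OF C x] by simp
      qed
    qed
    then have "openin T C" using closedU[of "\<D> - {C}"] by (auto simp: closedin_def)
    moreover have "\<one> \<in> C" using C subgroup.one_closed by blast
    ultimately obtain n where "\<forall>v\<in>V n. v \<otimes> \<one> \<in> C" unfolding openin_iff by blast
    then have "f (v \<otimes> x) = v \<otimes> f x" if "v \<in> V n" "x \<in> carrier X" for v x
      using that by (auto simp: C_def equivariants_def)
    then show "f \<in> E" using E_I[of f n] homeo_Bij[OF fh] by blast
  qed
  moreover have "\<exists>K. subgroup K G \<and> finite_index G K \<and> f \<in> Aut_set T \<alpha> K" if f: "f \<in> E" for f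
  proof -
    obtain n where n: "\<And>v x. v \<in> V n \<Longrightarrow> x \<in> carrier X \<Longrightarrow> f (v \<otimes> x) = v \<otimes> f x"
      using E_obtain f by blast
    \<comment> \<open>The witness is the preimage of \<open>V n\<close>, of finite index by
      hypothesis.\<close>
    have "subgroup {g \<in> carrier G. \<tau> g \<in> V n} G"
      by (rule subgroup.intro) auto
    moreover have "f \<in> Aut_set T \<alpha> {g \<in> carrier G. \<tau> g \<in> V n}"
      using n E_homeo[OF f] f \<alpha> by (simp add: Aut_set_def)
    ultimately show ?thesis using index by blast
  qed
  ultimately have "(\<Union>K\<in>{K. subgroup K G \<and> finite_index G K}. Aut_set T \<alpha> K) = E"
    by blast
  then show ?thesis by (simp add: stabilized_Aut_def permutation_monoid_def)
qed

end

section \<open>Commensurability\<close>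

context scaled_group
begin

lemma right_mult_E: "g \<in> carrier X \<Longrightarrow> (\<lambda>x\<in>carrier X. x \<otimes> g) \<in> E"
\<comment> \<open>Right multiplication commutes with every left translation, so any depth would
  serve.\<close>
proof (rule E_I[of _ 0])
  assume g: "g \<in> carrier X"
  have "bij_betw (\<lambda>x. x \<otimes> g) (carrier X) (carrier X)"
    by (rule bij_betw_byWitness[where f' = "\<lambda>x. x \<otimes> inv g"]) (use g in \<open>auto simp: mult_inv_cancel\<close>)
  then show "(\<lambda>x\<in>carrier X. x \<otimes> g) \<in> Bij (carrier X)" by (simp add: Bij_def)
qed (simp add: m_assoc)

text \<open>A dense set contains some \<open>v \<otimes> g\<close> with \<open>v\<close> small.
  Normality moves \<open>v\<close> to the far left of the products, where continuity and separation
  by cosets apply.\<close>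

lemma commutes_right_mult_dense:
  assumes f: "continuous_map T T f" and D: "\<And>x n. x \<in> carrier X \<Longrightarrow> \<exists>d\<in>D. d \<in> V n #> x"
    and D_comm: "\<And>d x. d \<in> D \<Longrightarrow> x \<in> carrier X \<Longrightarrow> f (x \<otimes> d) = f x \<otimes> d"
    and x: "x \<in> carrier X" and g: "g \<in> carrier X"
  shows "f (x \<otimes> g) = f x \<otimes> g"
proof (rule ccontr)
  have fc: "f y \<in> carrier X" if "y \<in> carrier X" for y
    using f that by (auto simp: continuous_map_def)
  assume "f (x \<otimes> g) \<noteq> f x \<otimes> g"
  then obtain n where n: "f x \<otimes> g \<notin> V n #> f (x \<otimes> g)"
    using separate_cosets[of "f (x \<otimes> g)" "f x \<otimes> g"] x g fc by auto
  obtain m where m: "\<And>v. v \<in> V m \<Longrightarrow> f (v \<otimes> (x \<otimes> g)) \<in> V n #> f (x \<otimes> g)"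
    using continuous_at_coset[OF f m_closed[OF x g], of n] by metis
  obtain d where "d \<in> D" "d \<in> V (max n m) #> g" using D g by blast
  then obtain v where v: "v \<in> V (max n m)" "d = v \<otimes> g" by (auto simp: coset_iff)
  have conj: "y \<otimes> d = (y \<otimes> v \<otimes> inv y) \<otimes> (y \<otimes> g)" if "y \<in> carrier X" for y
    using that v g by (simp add: m_assoc[symmetric] mult_inv_cancel)
  have "f (x \<otimes> d) \<in> V n #> f (x \<otimes> g)"
    unfolding conj[OF x] using m V_conj[OF V_max(2)[OF v(1)] x] by blast
  then have "(f x \<otimes> v \<otimes> inv f x) \<otimes> (f x \<otimes> g) \<in> V n #> f (x \<otimes> g)"
    using D_comm[OF \<open>d \<in> D\<close> x] conj[OF fc[OF x]] by simp
  moreover have "f x \<otimes> v \<otimes> inv f x \<in> V n" using V_conj[OF V_max(1)[OF v(1)] fc[OF x]] .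
  ultimately show False using n coset_shift_iff[of "f (x \<otimes> g)" "f x \<otimes> g"] x g fc by simp
qed

end

locale scaled_group_pair = X: scaled_group X V T + Y: scaled_group Y W U
  for X :: "('x, 'm) monoid_scheme" (structure) and V and T
    and Y :: "('y, 'n) monoid_scheme" and W and U
begin

text \<open>Stronger than the usual notion of commensurability, since the indices have to
  agree.\<close>

definition commensurable :: bool where
  "commensurable \<longleftrightarrow> (\<exists>U1 U2. clopen_subgroup U1 X T \<and> clopen_subgroup U2 Y U \<and>
     top_group_isomorphic (X\<lparr>carrier := U1\<rparr>) (subtopology T U1) (Y\<lparr>carrier := U2\<rparr>) (subtopology U U2) \<and>
     finite_index X U1 \<and> finite_index Y U2 \<and> card (rcosets\<^bsub>X\<^esub> U1) = card (rcosets\<^bsub>Y\<^esub> U2))"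

text \<open>Conjugation by \<open>h\<close> turns equivariance under \<open>V m \<inter> U1\<close>
  into equivariance under its image by \<open>\<phi>\<close>, which by \<open>nbhd\<close> contains
  some \<open>W k\<close>.\<close>

lemma conj_E:
  assumes h: "bij_betw h (carrier X) (carrier Y)"
    and eq: "\<And>u x. u \<in> U1 \<Longrightarrow> x \<in> carrier X \<Longrightarrow> h (u \<otimes> x) = \<phi> u \<otimes>\<^bsub>Y\<^esub> h x"
    and nbhd: "\<And>m. \<exists>k. \<forall>w\<in>W k. \<exists>u\<in>V m \<inter> U1. w = \<phi> u"
    and f: "f \<in> X.E"
  shows "(\<lambda>y\<in>carrier Y. h (f (inv_into (carrier X) h y))) \<in> Y.E"
proof -
  obtain m where m: "\<And>v x. v \<in> V m \<Longrightarrow> x \<in> carrier X \<Longrightarrow> f (v \<otimes> x) = v \<otimes> f x"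
    using X.E_obtain f by blast
  obtain k where k: "\<And>w. w \<in> W k \<Longrightarrow> \<exists>u\<in>V m \<inter> U1. w = \<phi> u" using nbhd by blast
  have inv: "inv_into (carrier X) h (h x) = x" "h x \<in> carrier Y" if "x \<in> carrier X" for x
    using h that by (auto simp: bij_betw_inv_into_left bij_betw_def)
  show ?thesis
  proof (rule Y.E_I[of _ k])
    have "bij_betw (\<lambda>y. h (f (inv_into (carrier X) h y))) (carrier Y) (carrier Y)"
      using bij_betw_trans[OF bij_betw_trans[OF bij_betw_inv_into[OF h] X.E.F_bij_betw[OF f]] h]
      by (simp add: comp_def)
    then show "(\<lambda>y\<in>carrier Y. h (f (inv_into (carrier X) h y))) \<in> Bij (carrier Y)"
      by (simp add: Bij_def)
    fix w y assume w: "w \<in> W k" and y: "y \<in> carrier Y"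
    obtain u where u: "u \<in> V m" "u \<in> U1" "w = \<phi> u" using k[OF w] by auto
    obtain x where x: "x \<in> carrier X" "y = h x" using h y by (auto simp: bij_betw_def)
    have "w \<otimes>\<^bsub>Y\<^esub> y = h (u \<otimes> x)" using eq u x by simp
    moreover have "h (f (u \<otimes> x)) = w \<otimes>\<^bsub>Y\<^esub> h (f x)" using m u eq x f by simp
    ultimately show "(\<lambda>y\<in>carrier Y. h (f (inv_into (carrier X) h y))) (w \<otimes>\<^bsub>Y\<^esub> y)
        = w \<otimes>\<^bsub>Y\<^esub> (\<lambda>y\<in>carrier Y. h (f (inv_into (carrier X) h y))) y"
      using inv x u(1) w y by simp
  qed
qed

end

lemma scaled_group_pair_sym: "scaled_group_pair X V T Y W U \<Longrightarrow> scaled_group_pair Y W U X V T"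
  by (simp add: scaled_group_pair_def)

context scaled_group_pair
begin

text \<open>\<open>E\<close> is defined by equivariance alone, so an equivariant bijection
  \<open>h\<close> suffices; only near the unit does the topology enter, through
  \<open>\<phi>\<close>.\<close>

theorem E_iso_if_commensurable:
  assumes commensurable
  shows "X.E.P \<cong> Y.E.P"
proof -
  interpret R: scaled_group_pair Y W U X V T
    by (rule scaled_group_pair_sym) (rule scaled_group_pair_axioms)
  obtain U1 U2 \<phi> where U1: "subgroup U1 X" "openin T U1" and U2: "subgroup U2 Y" "openin U U2"
    and iso: "\<phi> \<in> iso (X\<lparr>carrier := U1\<rparr>) (Y\<lparr>carrier := U2\<rparr>)"
    and homeo: "homeomorphic_map (subtopology T U1) (subtopology U U2) \<phi>"
    and fin: "finite_index X U1" "finite_index Y U2" "card (rcosets\<^bsub>X\<^esub> U1) = card (rcosets\<^bsub>Y\<^esub> U2)"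
    using assms unfolding commensurable_def clopen_subgroup_def top_group_isomorphic_def by metis
  have U1X: "U1 \<subseteq> carrier X" and U2Y: "U2 \<subseteq> carrier Y" using U1 U2 subgroup.subset by blast+
  have \<phi>: "\<And>u v. u \<in> U1 \<Longrightarrow> v \<in> U1 \<Longrightarrow> \<phi> (u \<otimes> v) = \<phi> u \<otimes>\<^bsub>Y\<^esub> \<phi> v" "bij_betw \<phi> U1 U2"
    using iso by (auto simp: iso_def hom_def)
  have \<phi>U: "\<phi> u \<in> U2" if "u \<in> U1" for u using \<phi>(2) that by (auto simp: bij_betw_def)
  have one1: "\<one> \<in> U1" and one2: "\<one>\<^bsub>Y\<^esub> \<in> U2" using U1 U2 subgroup.one_closed by blast+
  have \<phi>1: "\<phi> \<one> = \<one>\<^bsub>Y\<^esub>"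
  proof -
    have "\<phi> \<one> \<otimes>\<^bsub>Y\<^esub> \<phi> \<one> = \<phi> \<one>" using \<phi>(1)[OF one1 one1] by simp
    then show ?thesis using \<phi>U[OF one1] U2Y by (metis Y.r_cancel_one' subsetD)
  qed
  \<comment> \<open>Equality of the finite indices enters here.\<close>
  obtain \<beta> where \<beta>: "bij_betw \<beta> (rcosets\<^bsub>X\<^esub> U1) (rcosets\<^bsub>Y\<^esub> U2)"
    using fin finite_same_card_bij unfolding finite_index_def by metis
  define r where "r C = (SOME x. x \<in> C)" for C :: "'x set"
  define s where "s D = (SOME y. y \<in> D)" for D :: "'y set"
  have r: "r C \<in> C" "r C \<in> carrier X" if C: "C \<in> rcosets\<^bsub>X\<^esub> U1" for C
  proof -
    obtain x where "x \<in> carrier X" "C = U1 #> x" using C by (auto simp: RCOSETS_def)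
    then have "x \<in> C" using X.rcos_self U1(1) by simp
    then show "r C \<in> C" unfolding r_def by (rule someI)
    then show "r C \<in> carrier X" using C X.rcosets_part_G[OF U1(1)] by blast
  qed
  have s: "s D \<in> D" "s D \<in> carrier Y" if D: "D \<in> rcosets\<^bsub>Y\<^esub> U2" for D
  proof -
    obtain y where "y \<in> carrier Y" "D = U2 #>\<^bsub>Y\<^esub> y" using D by (auto simp: RCOSETS_def)
    then have "y \<in> D" using Y.rcos_self U2(1) by simp
    then show "s D \<in> D" unfolding s_def by (rule someI)
    then show "s D \<in> carrier Y" using D Y.rcosets_part_G[OF U2(1)] by blast
  qed
  have coset_r: "U1 #> r C = C" if C: "C \<in> rcosets\<^bsub>X\<^esub> U1" for C
    using C r[OF C] X.repr_independence[OF _ _ U1(1)] by (auto simp: RCOSETS_def)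
  have coset_s: "U2 #>\<^bsub>Y\<^esub> s D = D" if D: "D \<in> rcosets\<^bsub>Y\<^esub> U2" for D
    using D s[OF D] Y.repr_independence[OF _ _ U2(1)] by (auto simp: RCOSETS_def)
  have cosX: "U1 #> x \<in> rcosets\<^bsub>X\<^esub> U1" if "x \<in> carrier X" for x using that by (auto simp: RCOSETS_def)
  have \<beta>C: "\<beta> C \<in> rcosets\<^bsub>Y\<^esub> U2" if "C \<in> rcosets\<^bsub>X\<^esub> U1" for C using \<beta> that by (auto simp: bij_betw_def)
  \<comment> \<open>With chosen coset representatives, \<open>u \<otimes> r C\<close> is sent to the
    product of \<open>\<phi> u\<close> and \<open>s (\<beta> C)\<close>.\<close>
  define h where "h x = \<phi> (x \<otimes> inv (r (U1 #> x))) \<otimes>\<^bsub>Y\<^esub> s (\<beta> (U1 #> x))" for x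
  have h_r: "h (u \<otimes> r C) = \<phi> u \<otimes>\<^bsub>Y\<^esub> s (\<beta> C)" if u: "u \<in> U1" and C: "C \<in> rcosets\<^bsub>X\<^esub> U1" for u C
  proof -
    have "u \<otimes> r C \<in> U1 #> r C" using u by (auto simp: r_coset_def)
    then have "U1 #> (u \<otimes> r C) = C"
      using X.repr_independence[OF _ r(2)[OF C] U1(1)] coset_r[OF C] by simp
    then show ?thesis using u U1X r(2)[OF C] by (simp add: h_def X.mult_inv_cancel subset_iff)
  qed
  have decomp: "\<exists>u\<in>U1. \<exists>C\<in>rcosets\<^bsub>X\<^esub> U1. x = u \<otimes> r C" if x: "x \<in> carrier X" for x
  proof -
    have "x \<in> U1 #> r (U1 #> x)" using coset_r[OF cosX[OF x]] X.rcos_self[OF x U1(1)] by simp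
    then show ?thesis using cosX[OF x] by (auto simp: r_coset_def)
  qed
  have h_eq: "h (u \<otimes> x) = \<phi> u \<otimes>\<^bsub>Y\<^esub> h x" if u: "u \<in> U1" and x: "x \<in> carrier X" for u x
  proof -
    obtain v C where v: "v \<in> U1" "C \<in> rcosets\<^bsub>X\<^esub> U1" "x = v \<otimes> r C" using decomp[OF x] by blast
    have "u \<otimes> v \<in> U1" using u v(1) subgroup.m_closed[OF U1(1)] by simp
    then have "h (u \<otimes> v \<otimes> r C) = \<phi> (u \<otimes> v) \<otimes>\<^bsub>Y\<^esub> s (\<beta> C)" using h_r v(2) by simp
    moreover have "u \<otimes> v \<otimes> r C = u \<otimes> x" using u v U1X r(2)[OF v(2)] by (simp add: X.m_assoc subset_iff)
    moreover have "\<phi> u \<otimes>\<^bsub>Y\<^esub> h x = \<phi> (u \<otimes> v) \<otimes>\<^bsub>Y\<^esub> s (\<beta> C)"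
      using h_r[OF v(1,2)] v(3) \<phi>(1)[OF u v(1)] \<phi>U[OF u] \<phi>U[OF v(1)] U2Y s(2)[OF \<beta>C[OF v(2)]]
      by (simp add: Y.m_assoc subset_iff)
    ultimately show ?thesis by simp
  qed
  have h_in: "h (u \<otimes> r C) \<in> \<beta> C" if u: "u \<in> U1" and C: "C \<in> rcosets\<^bsub>X\<^esub> U1" for u C
  proof -
    have "\<phi> u \<otimes>\<^bsub>Y\<^esub> s (\<beta> C) \<in> U2 #>\<^bsub>Y\<^esub> s (\<beta> C)" using \<phi>U[OF u] by (auto simp: r_coset_def)
    then show ?thesis using h_r[OF u C] coset_s[OF \<beta>C[OF C]] by simp
  qed
  have bij: "bij_betw h (carrier X) (carrier Y)"
  proof (rule bij_betw_imageI)
    show "inj_on h (carrier X)"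
    proof (rule inj_onI)
      fix x y assume x: "x \<in> carrier X" and y: "y \<in> carrier X" and eq: "h x = h y"
      obtain u C where u: "u \<in> U1" "C \<in> rcosets\<^bsub>X\<^esub> U1" "x = u \<otimes> r C" using decomp[OF x] by blast
      obtain v D where v: "v \<in> U1" "D \<in> rcosets\<^bsub>X\<^esub> U1" "y = v \<otimes> r D" using decomp[OF y] by blast
      have "h x \<in> \<beta> C" "h x \<in> \<beta> D" using h_in[OF u(1,2)] h_in[OF v(1,2)] u(3) v(3) eq by simp_all
      then have "\<beta> C = \<beta> D"
        using Y.rcos_disjoint[OF U2(1)] \<beta>C[OF u(2)] \<beta>C[OF v(2)] by (auto simp: pairwise_def disjnt_def)
      then have "C = D" using \<beta> u(2) v(2) by (auto simp: bij_betw_def inj_on_def)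
      then have "\<phi> u = \<phi> v"
        using eq h_r[OF u(1,2)] h_r[OF v(1,2)] u(3) v(3) \<phi>U[OF u(1)] \<phi>U[OF v(1)] U2Y s(2)[OF \<beta>C[OF u(2)]]
        by (simp add: subset_iff)
      then show "x = y" using \<phi>(2) u v \<open>C = D\<close> by (auto simp: bij_betw_def inj_on_def)
    qed
    have "h x \<in> carrier Y" if x: "x \<in> carrier X" for x
    proof -
      obtain u C where u: "u \<in> U1" "C \<in> rcosets\<^bsub>X\<^esub> U1" "x = u \<otimes> r C" using decomp[OF x] by blast
      then show ?thesis using h_in[OF u(1,2)] \<beta>C[OF u(2)] Y.rcosets_part_G[OF U2(1)] by blast
    qed
    moreover have "y \<in> h ` carrier X" if y: "y \<in> carrier Y" for y
    proof -
      obtain D where D: "D \<in> rcosets\<^bsub>Y\<^esub> U2" "y \<in> D" using Y.rcosets_part_G[OF U2(1)] y by blast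
      then obtain C where C: "C \<in> rcosets\<^bsub>X\<^esub> U1" "D = \<beta> C" using \<beta> by (auto simp: bij_betw_def)
      have "y \<in> U2 #>\<^bsub>Y\<^esub> s D" using coset_s D by simp
      then obtain u' where u': "u' \<in> U2" "y = u' \<otimes>\<^bsub>Y\<^esub> s D" by (auto simp: r_coset_def)
      then obtain u where u: "u \<in> U1" "u' = \<phi> u" using \<phi>(2) by (auto simp: bij_betw_def)
      have "y = h (u \<otimes> r C)" using h_r[OF u(1) C(1)] u u' C by simp
      moreover have "u \<otimes> r C \<in> carrier X" using u(1) U1X r(2)[OF C(1)] by auto
      ultimately show ?thesis by blast
    qed
    ultimately show "h ` carrier X = carrier Y" by blast
  qed
  \<comment> \<open>Openness of \<open>\<phi>\<close> provides the neighbourhoods for conjugation by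
    \<open>h\<close>; its continuity provides in \<open>nbhd2\<close> those for conjugation by the
    inverse.\<close>
  have nbhd1: "\<exists>k. \<forall>w\<in>W k. \<exists>u\<in>V m \<inter> U1. w = \<phi> u" for m
  proof -
    have "openin T (V m \<inter> U1)"
      using X.coset_clopen(1)[of \<one> m] U1(2) X.V_subgroup[of m]
      by (intro openin_Int) (auto simp: X.coset_mult_one subgroup.subset)
    then have "openin (subtopology T U1) (V m \<inter> U1)"
      by (simp add: openin_open_subtopology[OF U1(2)])
    then have "openin (subtopology U U2) (\<phi> ` (V m \<inter> U1))"
      using homeomorphic_imp_open_map[OF homeo] by (simp add: open_map_def)
    then have "openin U (\<phi> ` (V m \<inter> U1))"
      by (simp add: openin_open_subtopology[OF U2(2)])
    moreover have "\<one>\<^bsub>Y\<^esub> \<in> \<phi> ` (V m \<inter> U1)" using \<phi>1 one1 by (force intro: image_eqI[of _ _ \<one>])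
    ultimately obtain k where "\<forall>w\<in>W k. w \<otimes>\<^bsub>Y\<^esub> \<one>\<^bsub>Y\<^esub> \<in> \<phi> ` (V m \<inter> U1)" unfolding Y.openin_iff by blast
    then have "\<forall>w\<in>W k. \<exists>u\<in>V m \<inter> U1. w = \<phi> u" by (auto simp: image_iff)
    then show ?thesis ..
  qed
  have nbhd2: "\<exists>k. \<forall>v\<in>V k. \<exists>w\<in>W m \<inter> U2. v = inv_into U1 \<phi> w" for m
  proof -
    have "openin U (W m)"
      using Y.coset_clopen(1)[of "\<one>\<^bsub>Y\<^esub>" m] Y.V_subgroup[of m] by (simp add: Y.coset_mult_one subgroup.subset)
    then have "openin (subtopology U U2) (W m \<inter> U2)"
      by (auto simp: openin_open_subtopology[OF U2(2)] intro: openin_Int[OF _ U2(2)])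
    then have "openin (subtopology T U1) {u \<in> topspace (subtopology T U1). \<phi> u \<in> W m \<inter> U2}"
      using homeomorphic_imp_continuous_map[OF homeo] unfolding continuous_map_def by blast
    then have "openin T {u \<in> topspace (subtopology T U1). \<phi> u \<in> W m \<inter> U2}"
      by (simp add: openin_open_subtopology[OF U1(2)])
    moreover have "{u \<in> topspace (subtopology T U1). \<phi> u \<in> W m \<inter> U2} = {u \<in> U1. \<phi> u \<in> W m}"
      using U1X \<phi>U by auto
    ultimately have "openin T {u \<in> U1. \<phi> u \<in> W m}" by simp
    moreover have "\<one> \<in> {u \<in> U1. \<phi> u \<in> W m}" using \<phi>1 one1 by simp
    ultimately obtain k where k: "\<forall>v\<in>V k. v \<otimes> \<one> \<in> {u \<in> U1. \<phi> u \<in> W m}" unfolding X.openin_iff by blast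
    have "\<exists>w\<in>W m \<inter> U2. v = inv_into U1 \<phi> w" if "v \<in> V k" for v
    proof
      show "\<phi> v \<in> W m \<inter> U2" using k that \<phi>U by auto
      show "v = inv_into U1 \<phi> (\<phi> v)" using k that \<phi>(2) by (auto simp: bij_betw_inv_into_left)
    qed
    then show ?thesis by blast
  qed
  have inv_h_eq: "inv_into (carrier X) h (w \<otimes>\<^bsub>Y\<^esub> y) = inv_into U1 \<phi> w \<otimes> inv_into (carrier X) h y"
    if w: "w \<in> U2" and y: "y \<in> carrier Y" for w y
  proof -
    obtain u where u: "u \<in> U1" "w = \<phi> u" using w \<phi>(2) by (auto simp: bij_betw_def)
    obtain x where x: "x \<in> carrier X" "y = h x" using y bij by (auto simp: bij_betw_def)
    have "w \<otimes>\<^bsub>Y\<^esub> y = h (u \<otimes> x)" using h_eq u x by simp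
    moreover have "u \<otimes> x \<in> carrier X" using u U1X x by auto
    ultimately show ?thesis using x u \<phi>(2) bij by (simp add: bij_betw_inv_into_left)
  qed
  show ?thesis
  proof (rule permutation_monoid_conj_iso[OF bij])
    show "X.E \<subseteq> Bij (carrier X)" "Y.E \<subseteq> Bij (carrier Y)" using X.E_Bij Y.E_Bij by blast+
    show "(\<lambda>y\<in>carrier Y. h (f (inv_into (carrier X) h y))) \<in> Y.E" if "f \<in> X.E" for f
      using conj_E[OF bij h_eq nbhd1 that] .
    show "(\<lambda>x\<in>carrier X. inv_into (carrier X) h (f (h x))) \<in> X.E" if "f \<in> Y.E" for f
    proof -
      have "(\<lambda>x\<in>carrier X. inv_into (carrier X) h (f (inv_into (carrier Y) (inv_into (carrier X) h) x))) \<in> X.E"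
        using R.conj_E[OF bij_betw_inv_into[OF bij] inv_h_eq nbhd2 that] .
      moreover have "inv_into (carrier Y) (inv_into (carrier X) h) x = h x" if "x \<in> carrier X" for x
        using that bij by (simp add: inv_into_inv_into_eq)
      ultimately show ?thesis by (simp cong: restrict_cong)
    qed
  qed
qed

theorem commensurable_if_E_iso:
  assumes iso: "X.E.P \<cong> Y.E.P" and S: "finite S" "S \<subseteq> carrier X"
    and dense: "\<And>x n. x \<in> carrier X \<Longrightarrow> \<exists>d\<in>generate X S. d \<in> V n #> x"
  shows commensurable
proof -
  obtain \<Phi> where \<Phi>: "\<Phi> \<in> iso X.E.P Y.E.P" using iso by (auto simp: is_iso_def)
  interpret I: local_permutation_group_iso T X.E U Y.E \<Phi>
    by (intro local_permutation_group_iso.intro X.local_permutation_group_E Y.local_permutation_group_E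
        local_permutation_group_iso_axioms.intro) (simp add: \<Phi>)
  obtain h where bij: "bij_betw h (carrier X) (carrier Y)" and h: "homeomorphic_map T U h"
    and h\<Phi>: "\<And>f x. f \<in> X.E \<Longrightarrow> x \<in> carrier X \<Longrightarrow> h (f x) = \<Phi> f (h x)"
    using I.spatial by auto
  define k where "k = inv_into (carrier X) h"
  have hk: "h (k y) = y" "k y \<in> carrier X" if "y \<in> carrier Y" for y
    using bij that by (auto simp: k_def bij_betw_inv_into_right bij_betw_def inv_into_into)
  have kh: "k (h x) = x" "h x \<in> carrier Y" if "x \<in> carrier X" for x
    using bij that by (auto simp: k_def bij_betw_inv_into_left bij_betw_def)
  have k_cont: "continuous_map U T k"
  proof -
    obtain g where "homeomorphic_maps T U h g" using h homeomorphic_map_maps by blast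
    then have g: "continuous_map U T g" "\<And>x. x \<in> carrier X \<Longrightarrow> g (h x) = x"
      by (auto simp: homeomorphic_maps_def)
    show ?thesis
      by (rule continuous_map_eq[OF g(1)]) (use g(2) hk in force)
  qed
  \<comment> \<open>The left translation of \<open>Y\<close> by \<open>w\<close>, pulled back along
    \<open>h\<close>. The aim is to show that for small \<open>w\<close> it is a left translation of
    \<open>X\<close>.\<close>
  define L where "L w x = k (w \<otimes>\<^bsub>Y\<^esub> h x)" for w x
  have L: "L w x \<in> carrier X" if "w \<in> carrier Y" "x \<in> carrier X" for w x
    using that hk kh by (simp add: L_def)
  define M where "M n = {g \<in> carrier X. \<forall>w\<in>W n. \<forall>x\<in>carrier X. L w (x \<otimes> g) = L w x \<otimes> g}" for n
  \<comment> \<open>The isomorphism sends the right translation by \<open>g\<close> to an element of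
    \<open>Y.E\<close>, which commutes with the left translations by some \<open>W n\<close>; this
    \<open>n\<close> depends on \<open>g\<close>.\<close>
  have ex_M: "\<exists>n. g \<in> M n" if g: "g \<in> carrier X" for g
  proof -
    let ?R = "\<lambda>x\<in>carrier X. x \<otimes> g"
    have R: "?R \<in> X.E" using g by (rule X.right_mult_E)
    then have "\<Phi> ?R \<in> Y.E" using I.\<Phi>_bij by (auto simp: bij_betw_def)
    then obtain n where n: "\<And>w y. w \<in> W n \<Longrightarrow> y \<in> carrier Y \<Longrightarrow> \<Phi> ?R (w \<otimes>\<^bsub>Y\<^esub> y) = w \<otimes>\<^bsub>Y\<^esub> \<Phi> ?R y"
      using Y.E_obtain by blast
    have "L w (x \<otimes> g) = L w x \<otimes> g" if w: "w \<in> W n" and x: "x \<in> carrier X" for w x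
    proof -
      have wY: "w \<in> carrier Y" using w by simp
      have "h (L w x \<otimes> g) = \<Phi> ?R (h (L w x))" using h\<Phi>[OF R L[OF wY x]] L[OF wY x] by simp
      also have "h (L w x) = w \<otimes>\<^bsub>Y\<^esub> h x" using wY x kh hk by (simp add: L_def)
      also have "\<Phi> ?R (w \<otimes>\<^bsub>Y\<^esub> h x) = w \<otimes>\<^bsub>Y\<^esub> \<Phi> ?R (h x)" using n[OF w kh(2)[OF x]] .
      also have "\<Phi> ?R (h x) = h (x \<otimes> g)" using h\<Phi>[OF R x] x by simp
      finally have "k (h (L w x \<otimes> g)) = L w (x \<otimes> g)" by (simp add: L_def)
      then show ?thesis using kh(1) L[OF wY x] g by simp
    qed
    then show ?thesis using g by (auto simp: M_def)
  qed
  have M_mono: "M n \<subseteq> M m" if "n \<le> m" for n m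
    using Y.V_mono[OF that] by (auto simp: M_def)
  \<comment> \<open>Finiteness of \<open>S\<close> allows the largest of the depths to be
    taken.\<close>
  have "\<exists>n. S \<subseteq> M n"
  proof -
    obtain e where e: "\<And>g. g \<in> S \<Longrightarrow> g \<in> M (e g)" using ex_M S(2) by (metis subsetD)
    have "g \<in> M (Max (e ` S))" if g: "g \<in> S" for g
    proof -
      have "e g \<le> Max (e ` S)" using S(1) g by simp
      then show ?thesis using e[OF g] M_mono by blast
    qed
    then show ?thesis by blast
  qed
  then obtain n where n: "S \<subseteq> M n" ..
  have "subgroup (M n) X"
  proof (rule X.subgroupI)
    show "M n \<subseteq> carrier X" by (auto simp: M_def)
    have "\<one> \<in> M n" using L by (simp add: M_def)
    then show "M n \<noteq> {}" by auto
    show "inv g \<in> M n" if g: "g \<in> M n" for g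
    proof -
      have gX: "g \<in> carrier X" and gL: "\<And>w x. w \<in> W n \<Longrightarrow> x \<in> carrier X \<Longrightarrow> L w (x \<otimes> g) = L w x \<otimes> g"
        using g by (auto simp: M_def)
      have "L w (x \<otimes> inv g) = L w x \<otimes> inv g" if w: "w \<in> W n" and x: "x \<in> carrier X" for w x
      proof -
        have "L w x = L w (x \<otimes> inv g) \<otimes> g"
          using gL[OF w, of "x \<otimes> inv g"] x gX by (simp add: X.mult_inv_cancel)
        then show ?thesis using L w x gX by (simp add: X.mult_inv_cancel)
      qed
      then show ?thesis using gX by (simp add: M_def)
    qed
    show "g \<otimes> g' \<in> M n" if "g \<in> M n" "g' \<in> M n" for g g'
      using that L by (simp add: M_def X.m_assoc[symmetric])
  qed
  then have gen: "generate X S \<subseteq> M n" using n by (rule X.generate_subgroup_incl[rotated])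
  have L_cont: "continuous_map T T (L w)" if w: "w \<in> carrier Y" for w
  proof -
    have "continuous_map U U (\<lambda>y. w \<otimes>\<^bsub>Y\<^esub> y)"
      unfolding continuous_map_def
    proof (intro conjI allI impI)
      show "(\<lambda>y. w \<otimes>\<^bsub>Y\<^esub> y) \<in> topspace U \<rightarrow> topspace U" using w by simp
      fix A assume A: "openin U A"
      have "\<exists>n. \<forall>v\<in>W n. v \<otimes>\<^bsub>Y\<^esub> y \<in> {y \<in> carrier Y. w \<otimes>\<^bsub>Y\<^esub> y \<in> A}"
        if y: "y \<in> carrier Y" "w \<otimes>\<^bsub>Y\<^esub> y \<in> A" for y
      proof -
        have "\<exists>n. \<forall>v\<in>W n. v \<otimes>\<^bsub>Y\<^esub> (w \<otimes>\<^bsub>Y\<^esub> y) \<in> A" using A y by (simp add: Y.openin_iff)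
        then obtain n where n: "\<And>v. v \<in> W n \<Longrightarrow> v \<otimes>\<^bsub>Y\<^esub> (w \<otimes>\<^bsub>Y\<^esub> y) \<in> A" by auto
        have "w \<otimes>\<^bsub>Y\<^esub> (v \<otimes>\<^bsub>Y\<^esub> y) \<in> A" if v: "v \<in> W n" for v
        proof -
          have "(w \<otimes>\<^bsub>Y\<^esub> v \<otimes>\<^bsub>Y\<^esub> inv\<^bsub>Y\<^esub> w) \<otimes>\<^bsub>Y\<^esub> (w \<otimes>\<^bsub>Y\<^esub> y) \<in> A" using n v w by simp
          moreover have "(w \<otimes>\<^bsub>Y\<^esub> v \<otimes>\<^bsub>Y\<^esub> inv\<^bsub>Y\<^esub> w) \<otimes>\<^bsub>Y\<^esub> (w \<otimes>\<^bsub>Y\<^esub> y) = w \<otimes>\<^bsub>Y\<^esub> (v \<otimes>\<^bsub>Y\<^esub> y)"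
            using w y v by (simp add: Y.m_assoc[symmetric] Y.mult_inv_cancel)
          ultimately show ?thesis by simp
        qed
        then show ?thesis using y w by (intro exI[of _ n]) simp
      qed
      then show "openin U {y \<in> topspace U. w \<otimes>\<^bsub>Y\<^esub> y \<in> A}" by (auto simp: Y.openin_iff)
    qed
    then have "continuous_map T T (k \<circ> ((\<lambda>y. w \<otimes>\<^bsub>Y\<^esub> y) \<circ> h))"
      using homeomorphic_imp_continuous_map[OF h] k_cont by (intro continuous_map_compose)
    then show ?thesis by (simp add: L_def[abs_def] comp_def)
  qed
  have L_right: "L w (x \<otimes> g) = L w x \<otimes> g" if w: "w \<in> W n" and x: "x \<in> carrier X" "g \<in> carrier X" for w x g
  proof (rule X.commutes_right_mult_dense[OF L_cont dense _ x])
    show "w \<in> carrier Y" using w by simp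
    show "L w (x \<otimes> d) = L w x \<otimes> d" if "d \<in> generate X S" "x \<in> carrier X" for d x
      using that gen w by (auto simp: M_def)
  qed
  \<comment> \<open>A map commuting with all right translations is the left translation by its value
    at the unit.\<close>
  define \<theta> where "\<theta> w = L w \<one>" for w
  have \<theta>X: "\<theta> w \<in> carrier X" if "w \<in> W n" for w using L that by (simp add: \<theta>_def)
  have \<theta>: "L w x = \<theta> w \<otimes> x" if "w \<in> W n" "x \<in> carrier X" for w x
    using L_right[OF that(1) X.one_closed that(2)] that by (simp add: \<theta>_def)
  have h\<theta>: "h (\<theta> w \<otimes> x) = w \<otimes>\<^bsub>Y\<^esub> h x" if "w \<in> W n" "x \<in> carrier X" for w x
    using \<theta>[OF that] hk(1) kh(2) that by (metis L_def Y.V_carrier Y.m_closed)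
  define c where "c = h \<one>"
  have c: "c \<in> carrier Y" using kh by (simp add: c_def)
  \<comment> \<open>\<open>h\<close> need not preserve the unit. Dividing by \<open>c\<close> on the
    right corrects this without disturbing left equivariance, and makes \<open>\<phi>\<close> undo
    \<open>\<theta>\<close>.\<close>
  define \<phi> where "\<phi> x = h x \<otimes>\<^bsub>Y\<^esub> inv\<^bsub>Y\<^esub> c" for x
  have \<phi>\<theta>: "\<phi> (\<theta> w) = w" if "w \<in> W n" for w
    using h\<theta>[OF that X.one_closed] \<theta>X[OF that] c that by (simp add: \<phi>_def c_def[symmetric] Y.mult_inv_cancel)
  have \<theta>_mult: "\<theta> (w \<otimes>\<^bsub>Y\<^esub> w') = \<theta> w \<otimes> \<theta> w'" if w: "w \<in> W n" "w' \<in> W n" for w w'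
  proof -
    have "h (\<theta> w \<otimes> (\<theta> w' \<otimes> \<one>)) = w \<otimes>\<^bsub>Y\<^esub> (w' \<otimes>\<^bsub>Y\<^esub> h \<one>)"
      using h\<theta> w \<theta>X by (metis X.m_closed X.one_closed)
    also have "\<dots> = w \<otimes>\<^bsub>Y\<^esub> w' \<otimes>\<^bsub>Y\<^esub> h \<one>" using w c by (simp add: Y.m_assoc c_def)
    also have "\<dots> = h (\<theta> (w \<otimes>\<^bsub>Y\<^esub> w') \<otimes> \<one>)" using h\<theta> w by (metis X.one_closed Y.V_mult)
    finally have "k (h (\<theta> w \<otimes> \<theta> w')) = k (h (\<theta> (w \<otimes>\<^bsub>Y\<^esub> w')))" using \<theta>X w by simp
    then show ?thesis using \<theta>X w kh(1) by simp
  qed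
  define U1 where "U1 = \<theta> ` W n"
  \<comment> \<open>As a preimage of \<open>W n\<close> under a continuous map, \<open>U1\<close> is
    clopen.\<close>
  have U1_eq: "U1 = {x \<in> topspace T. \<phi> x \<in> W n}"
  proof (intro equalityI subsetI)
    fix x assume "x \<in> U1"
    then show "x \<in> {x \<in> topspace T. \<phi> x \<in> W n}" using \<phi>\<theta> \<theta>X by (auto simp: U1_def)
  next
    fix x assume "x \<in> {x \<in> topspace T. \<phi> x \<in> W n}"
    then have x: "x \<in> carrier X" "\<phi> x \<in> W n" by auto
    have "h (\<theta> (\<phi> x)) = \<phi> x \<otimes>\<^bsub>Y\<^esub> c" using h\<theta>[OF x(2) X.one_closed] \<theta>X[OF x(2)] by (simp add: c_def)
    also have "\<dots> = h x" using kh(2)[OF x(1)] c by (simp add: \<phi>_def Y.mult_inv_cancel)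
    finally have "\<theta> (\<phi> x) = x" using kh(1) \<theta>X[OF x(2)] x(1) by metis
    then show "x \<in> U1" using x(2) unfolding U1_def by (metis imageI)
  qed
  have \<phi>_homeo: "homeomorphic_map T U \<phi>"
  proof -
    have "homeomorphic_map U U (\<lambda>y\<in>carrier Y. y \<otimes>\<^bsub>Y\<^esub> inv\<^bsub>Y\<^esub> c)"
      using Y.E_homeo[OF Y.right_mult_E[of "inv\<^bsub>Y\<^esub> c"]] c by (simp add: homeo_def)
    then have "homeomorphic_map T U ((\<lambda>y\<in>carrier Y. y \<otimes>\<^bsub>Y\<^esub> inv\<^bsub>Y\<^esub> c) \<circ> h)"
      using h by (intro homeomorphic_map_compose)
    then show ?thesis
      by (rule homeomorphic_map_eq) (simp add: \<phi>_def kh)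
  qed
  have Wn: "W n = W n #>\<^bsub>Y\<^esub> \<one>\<^bsub>Y\<^esub>" using Y.V_subgroup[of n] by (simp add: Y.coset_mult_one subgroup.subset)
  have W_clopen: "openin U (W n)" "closedin U (W n)"
    using Y.coset_clopen[of "\<one>\<^bsub>Y\<^esub>" n] Wn by auto
  have U1_sub: "subgroup U1 X"
  proof (rule X.subgroupI)
    show "U1 \<subseteq> carrier X" using \<theta>X by (auto simp: U1_def)
    show "U1 \<noteq> {}" using Y.V_one[of n] unfolding U1_def by blast
    show "u \<otimes> v \<in> U1" if "u \<in> U1" "v \<in> U1" for u v
    proof -
      obtain w w' where w: "w \<in> W n" "u = \<theta> w" "w' \<in> W n" "v = \<theta> w'" using \<open>u \<in> U1\<close> \<open>v \<in> U1\<close> by (auto simp: U1_def)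
      then show ?thesis unfolding U1_def by (intro image_eqI[of _ _ "w \<otimes>\<^bsub>Y\<^esub> w'"]) (simp_all add: \<theta>_mult)
    qed
    have one: "\<theta> \<one>\<^bsub>Y\<^esub> = \<one>"
      using \<theta>_mult[of "\<one>\<^bsub>Y\<^esub>" "\<one>\<^bsub>Y\<^esub>"] \<theta>X[of "\<one>\<^bsub>Y\<^esub>"] by simp
    show "inv u \<in> U1" if u: "u \<in> U1" for u
    proof -
      obtain w where w: "w \<in> W n" "u = \<theta> w" using u by (auto simp: U1_def)
      have "\<theta> (inv\<^bsub>Y\<^esub> w) \<otimes> \<theta> w = \<one>" using \<theta>_mult[of "inv\<^bsub>Y\<^esub> w" w] w one by simp
      then have "inv u = \<theta> (inv\<^bsub>Y\<^esub> w)" using w \<theta>X by (simp add: X.inv_equality)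
      then show ?thesis using w by (simp add: U1_def)
    qed
  qed
  have "clopen_subgroup U1 X T"
    unfolding clopen_subgroup_def
  proof (intro conjI U1_sub)
    note cont = homeomorphic_imp_continuous_map[OF \<phi>_homeo]
    show "openin T U1" unfolding U1_eq using W_clopen(1) by (rule openin_continuous_map_preimage[OF cont])
    show "closedin T U1" unfolding U1_eq using W_clopen(2) by (rule closedin_continuous_map_preimage[OF cont])
  qed
  moreover have "clopen_subgroup (W n) Y U"
    using W_clopen Y.V_subgroup by (simp add: clopen_subgroup_def)
  moreover have \<phi>_iso: "\<phi> \<in> iso (X\<lparr>carrier := U1\<rparr>) (Y\<lparr>carrier := W n\<rparr>)"
  proof -
    have "bij_betw \<phi> U1 (W n)"
      by (rule bij_betw_byWitness[where f' = \<theta>]) (use \<phi>\<theta> in \<open>auto simp: U1_def\<close>)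
    moreover have "\<phi> (u \<otimes> v) = \<phi> u \<otimes>\<^bsub>Y\<^esub> \<phi> v" if uv: "u \<in> U1" "v \<in> U1" for u v
    proof -
      obtain w w' where w: "w \<in> W n" "u = \<theta> w" "w' \<in> W n" "v = \<theta> w'" using uv by (auto simp: U1_def)
      have "\<phi> (u \<otimes> v) = \<phi> (\<theta> (w \<otimes>\<^bsub>Y\<^esub> w'))" using w \<theta>_mult by simp
      then show ?thesis using w \<phi>\<theta> by simp
    qed
    ultimately show ?thesis by (auto simp: iso_def hom_def bij_betw_def)
  qed
  moreover have "homeomorphic_map (subtopology T U1) (subtopology U (W n)) \<phi>"
  proof (rule homeomorphic_map_subtopologies[OF \<phi>_homeo])
    have "\<phi> ` U1 = W n" using \<phi>_iso by (auto simp: iso_def bij_betw_def)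
    moreover have "topspace T \<inter> U1 = U1" "topspace U \<inter> W n = W n" unfolding U1_eq by auto
    ultimately show "\<phi> ` (topspace T \<inter> U1) = topspace U \<inter> W n" by simp
  qed
  \<comment> \<open>Equivariance makes \<open>h\<close> carry the coset \<open>U1 #> x\<close> onto
    the coset of \<open>W n\<close> through \<open>h x\<close>, so the indices agree.\<close>
  moreover have "bij_betw (\<lambda>C. h ` C) (rcosets\<^bsub>X\<^esub> U1) (rcosets\<^bsub>Y\<^esub> (W n))"
  proof (rule bij_betw_imageI)
    show "inj_on (\<lambda>C. h ` C) (rcosets\<^bsub>X\<^esub> U1)"
    proof (rule inj_onI)
      fix C D assume CD: "C \<in> rcosets\<^bsub>X\<^esub> U1" "D \<in> rcosets\<^bsub>X\<^esub> U1" "h ` C = h ` D"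
      moreover from CD have "C \<subseteq> carrier X" "D \<subseteq> carrier X" using X.rcosets_part_G[OF U1_sub] by blast+
      ultimately show "C = D" using bij inj_on_image_eq_iff unfolding bij_betw_def by metis
    qed
    have img: "h ` (U1 #> x) = W n #>\<^bsub>Y\<^esub> h x" if x: "x \<in> carrier X" for x
    proof -
      have "U1 #> x = (\<lambda>w. \<theta> w \<otimes> x) ` W n" by (auto simp: r_coset_def U1_def)
      then have "h ` (U1 #> x) = (\<lambda>w. w \<otimes>\<^bsub>Y\<^esub> h x) ` W n"
        using h\<theta>[OF _ x] by (simp add: image_image)
      then show ?thesis by (auto simp: r_coset_def)
    qed
    have "(\<lambda>C. h ` C) ` (rcosets\<^bsub>X\<^esub> U1) = (\<lambda>x. h ` (U1 #> x)) ` carrier X"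
      by (auto simp: RCOSETS_def)
    also have "\<dots> = (\<lambda>x. W n #>\<^bsub>Y\<^esub> h x) ` carrier X" by (rule image_cong[OF refl img])
    also have "\<dots> = (\<lambda>y. W n #>\<^bsub>Y\<^esub> y) ` (h ` carrier X)" by (simp add: image_image)
    also have "\<dots> = rcosets\<^bsub>Y\<^esub> (W n)" using bij by (auto simp: bij_betw_def RCOSETS_def)
    finally show "(\<lambda>C. h ` C) ` (rcosets\<^bsub>X\<^esub> U1) = rcosets\<^bsub>Y\<^esub> (W n)" .
  qed
  then have "finite_index X U1" "finite_index Y (W n)" "card (rcosets\<^bsub>X\<^esub> U1) = card (rcosets\<^bsub>Y\<^esub> (W n))"
    using Y.finite_rcosets_V[of n] bij_betw_finite bij_betw_same_card by (auto simp: finite_index_def)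
  ultimately show commensurable
    unfolding commensurable_def top_group_isomorphic_def by blast
qed

end

section \<open>Odometers\<close>

locale odometer_scale =
  fixes G :: "('a, 'm) monoid_scheme" and \<Gamma> :: "nat \<Rightarrow> 'a set"
  assumes G: "group G" and infinite: "infinite (carrier G)" and scale: "is_scale G \<Gamma>"
begin

interpretation G: group G by (rule G)

abbreviation "X \<equiv> odometer G \<Gamma>"
abbreviation "TX \<equiv> odometer_topology G \<Gamma>"
abbreviation "\<tau> \<equiv> odometer_embedding G \<Gamma>"

definition odometer_kernel :: "nat \<Rightarrow> (nat \<Rightarrow> 'a set) set" where
  "odometer_kernel n = {x \<in> carrier X. x n = \<Gamma> n}"

lemma scale_normal: "\<Gamma> n \<lhd> G"
  using scale by (simp add: is_scale_def)

lemma scale_subgroup: "subgroup (\<Gamma> n) G"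
  using scale_normal normal_imp_subgroup by blast

lemma scale_finite: "finite (carrier (G Mod \<Gamma> n))"
  using scale by (simp add: is_scale_def finite_index_def FactGroup_def)

lemma factor_group: "group (G Mod \<Gamma> n)"
  using normal.factorgroup_is_group scale_normal by blast

lemma scale_Suc: "\<Gamma> (Suc n) \<subseteq> \<Gamma> n"
  using scale by (simp add: is_scale_def decseq_Suc_iff)

lemma group_odometer_product: "group (odometer_product G \<Gamma>)"
  by (simp add: odometer_product_def factor_group)

lemma group_odometer: "group X"
proof -
  have "(odometer_product G \<Gamma>)\<lparr>carrier := carrier X\<rparr> = X" by (simp add: odometer_def)
  then show ?thesis
    using subgroup.subgroup_is_group[OF subgroup_odometer[OF scale] group_odometer_product] by simp
qed

interpretation X: group X by (rule group_odometer)

lemma odometer_carrier_iff: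
  "x \<in> carrier X \<longleftrightarrow> (\<forall>n. x n \<in> carrier (G Mod \<Gamma> n) \<and> quotient_projection G (\<Gamma> n) (x (Suc n)) = x n)"
  by (auto simp: odometer_def odometer_product_def)

lemma odometer_coord: "x \<in> carrier X \<Longrightarrow> x n \<in> carrier (G Mod \<Gamma> n)"
  by (simp add: odometer_carrier_iff)

lemma odometer_mult: "(x \<otimes>\<^bsub>X\<^esub> y) n = x n \<otimes>\<^bsub>G Mod \<Gamma> n\<^esub> y n"
  by (simp add: odometer_def odometer_product_def)

lemma odometer_one: "\<one>\<^bsub>X\<^esub> n = \<Gamma> n"
  by (simp add: odometer_def odometer_product_def FactGroup_def)

lemma coord_hom: "group_hom X (G Mod \<Gamma> n) (\<lambda>x. x n)"
  by (auto simp: group_hom_def group_hom_axioms_def hom_def group_odometer factor_group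
      odometer_coord odometer_mult simp del: mult_FactGroup)

lemma odometer_kernel_eq: "odometer_kernel n = kernel X (G Mod \<Gamma> n) (\<lambda>x. x n)"
  by (simp add: odometer_kernel_def kernel_def FactGroup_def)

lemma odometer_kernel_normal: "odometer_kernel n \<lhd> X"
  unfolding odometer_kernel_eq by (rule group_hom.normal_kernel[OF coord_hom])

lemma odometer_kernel_decseq: "decseq odometer_kernel"
proof (rule decseq_SucI)
  fix n
  have \<Gamma>: "quotient_projection G (\<Gamma> n) (\<Gamma> (Suc n)) = \<Gamma> n"
    using quotient_projection_rcos[OF scale_normal scale_normal scale_Suc G.one_closed, of n]
      scale_subgroup by (simp add: G.coset_mult_one subgroup.subset)
  have "x n = \<Gamma> n" if "x \<in> carrier X" "x (Suc n) = \<Gamma> (Suc n)" for x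
  proof -
    have "quotient_projection G (\<Gamma> n) (x (Suc n)) = x n" using that(1) by (simp add: odometer_carrier_iff)
    then show ?thesis using that(2) \<Gamma> by simp
  qed
  then show "odometer_kernel (Suc n) \<subseteq> odometer_kernel n"
    by (auto simp: odometer_kernel_def)
qed

lemma odometer_kernel_Inter: "(\<Inter>n. odometer_kernel n) = {\<one>\<^bsub>X\<^esub>}"
proof -
  have "x = \<one>\<^bsub>X\<^esub>" if "\<forall>n. x n = \<Gamma> n" for x
    using that by (intro ext) (simp add: odometer_one)
  then show ?thesis by (auto simp: odometer_kernel_def odometer_one)
qed

lemma embedding_closed: "g \<in> carrier G \<Longrightarrow> \<tau> g \<in> carrier X"
  by (rule odometer_embedding_closed[OF scale])

lemma embedding_hom: "\<tau> \<in> hom G X"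
proof (rule homI)
  fix g h assume gh: "g \<in> carrier G" "h \<in> carrier G"
  show "\<tau> (g \<otimes>\<^bsub>G\<^esub> h) = \<tau> g \<otimes>\<^bsub>X\<^esub> \<tau> h"
    using gh by (intro ext) (simp add: odometer_mult odometer_embedding_def normal.rcos_sum[OF scale_normal])
qed (rule embedding_closed)

lemma embedding_kernel: "g \<in> carrier G \<Longrightarrow> \<tau> g \<in> odometer_kernel n \<longleftrightarrow> g \<in> \<Gamma> n"
proof -
  assume g: "g \<in> carrier G"
  have "\<Gamma> n #>\<^bsub>G\<^esub> g = \<Gamma> n \<longleftrightarrow> g \<in> \<Gamma> n"
    using G.rcos_self[OF g scale_subgroup] G.coset_join2[OF g scale_subgroup] by metis
  then show ?thesis
    using embedding_closed[OF g] by (simp add: odometer_kernel_def odometer_embedding_def)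
qed

text \<open>A finite-index subgroup of an infinite group is infinite. A nontrivial element of
  \<open>\<Gamma> n\<close> escapes some \<open>\<Gamma> m\<close>, so its image is a nontrivial
  element of the kernel.\<close>

lemma odometer_kernel_nontrivial: "odometer_kernel n \<noteq> {\<one>\<^bsub>X\<^esub>}"
proof -
  have "\<exists>g\<in>\<Gamma> n. g \<noteq> \<one>\<^bsub>G\<^esub>"
  proof (rule ccontr)
    assume "\<not> ?thesis"
    then have "\<Gamma> n \<subseteq> {\<one>\<^bsub>G\<^esub>}" by auto
    then have "finite (\<Gamma> n)" by (rule finite_subset) simp
    then have "finite (\<Gamma> n #>\<^bsub>G\<^esub> g)" for g by (simp add: r_coset_def)
    then have "finite (\<Union>(rcosets\<^bsub>G\<^esub> \<Gamma> n))"
      using scale_finite[of n] by (auto simp: FactGroup_def RCOSETS_def)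
    then show False using infinite G.rcosets_part_G[OF scale_subgroup] by simp
  qed
  then obtain g where g: "g \<in> \<Gamma> n" "g \<noteq> \<one>\<^bsub>G\<^esub>" by blast
  then have gG: "g \<in> carrier G" using subgroup.mem_carrier scale_subgroup by metis
  obtain m where "g \<notin> \<Gamma> m" using scale g(2) by (auto simp: is_scale_def)
  then have "\<tau> g \<notin> odometer_kernel m" using embedding_kernel gG by simp
  then have "\<tau> g \<noteq> \<one>\<^bsub>X\<^esub>" by (auto simp: odometer_kernel_def odometer_one)
  then show ?thesis using embedding_kernel[OF gG] g(1) by blast
qed

lemma kernel_coset:
  assumes "x \<in> carrier X" "y \<in> carrier X" "y n = x n"
  shows "y \<otimes>\<^bsub>X\<^esub> inv\<^bsub>X\<^esub> x \<in> odometer_kernel n"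
proof -
  interpret h: group_hom X "G Mod \<Gamma> n" "\<lambda>x. x n" by (rule coord_hom)
  have "(y \<otimes>\<^bsub>X\<^esub> inv\<^bsub>X\<^esub> x) n = y n \<otimes>\<^bsub>G Mod \<Gamma> n\<^esub> inv\<^bsub>G Mod \<Gamma> n\<^esub> x n"
    using assms h.hom_inv[of x] by (simp add: odometer_mult del: mult_FactGroup)
  then have "(y \<otimes>\<^bsub>X\<^esub> inv\<^bsub>X\<^esub> x) n = \<one>\<^bsub>G Mod \<Gamma> n\<^esub>"
    using assms h.H.r_inv[OF odometer_coord] by simp
  then show ?thesis using assms by (simp add: odometer_kernel_def)
qed

lemma kernel_mult_coord:
  assumes "v \<in> odometer_kernel n" "x \<in> carrier X" "i \<le> n"
  shows "(v \<otimes>\<^bsub>X\<^esub> x) i = x i"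
proof -
  have "v \<in> odometer_kernel i" using odometer_kernel_decseq assms by (auto simp: decseq_def)
  then have "v i = \<one>\<^bsub>G Mod \<Gamma> i\<^esub>" by (simp add: odometer_kernel_def FactGroup_def)
  then show ?thesis
    using group.is_monoid[OF factor_group, THEN monoid.l_one, OF odometer_coord[OF assms(2)], of i]
    by (simp add: odometer_mult del: one_FactGroup mult_FactGroup)
qed

section \<open>The product topology in terms of coordinate kernels\<close>

abbreviation "product_space \<equiv> product_topology (\<lambda>n. discrete_topology (carrier (G Mod \<Gamma> n))) UNIV"

text \<open>A basic open set restricts finitely many coordinates, and a kernel element of sufficient
  depth changes none of them. Conversely, the coset of \<open>x\<close> is cut out by fixing the
  single coordinate \<open>x n\<close>.\<close>

lemma odometer_topology_openin_iff:
  "openin TX A \<longleftrightarrow> A \<subseteq> carrier X \<and> (\<forall>x\<in>A. \<exists>n. \<forall>v\<in>odometer_kernel n. v \<otimes>\<^bsub>X\<^esub> x \<in> A)"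
proof
  assume A: "openin TX A"
  then have AX: "A \<subseteq> carrier X" using openin_subset by fastforce
  obtain B where B: "openin product_space B" "A = B \<inter> carrier X"
    using A by (auto simp: odometer_topology_def openin_subtopology)
  have "\<exists>n. \<forall>v\<in>odometer_kernel n. v \<otimes>\<^bsub>X\<^esub> x \<in> A" if x: "x \<in> A" for x
  proof -
    have xX: "x \<in> carrier X" using x AX by blast
    obtain U where U: "finite {i. U i \<noteq> carrier (G Mod \<Gamma> i)}" "x \<in> Pi\<^sub>E UNIV U" "Pi\<^sub>E UNIV U \<subseteq> B"
      using B x by (auto simp: openin_product_topology_alt)
    \<comment> \<open>The inserted \<open>0\<close> covers the case in which no coordinate is
      restricted.\<close>
    define n where "n = Max (insert 0 {i. U i \<noteq> carrier (G Mod \<Gamma> i)})"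
    have "v \<otimes>\<^bsub>X\<^esub> x \<in> A" if v: "v \<in> odometer_kernel n" for v
    proof -
      have vx: "v \<otimes>\<^bsub>X\<^esub> x \<in> carrier X" using v xX by (simp add: odometer_kernel_def)
      have "(v \<otimes>\<^bsub>X\<^esub> x) i \<in> U i" for i
      proof (cases "U i = carrier (G Mod \<Gamma> i)")
        case False
        then have "i \<le> n" using U(1) by (simp add: n_def)
        then show ?thesis using kernel_mult_coord[OF v xX] U(2) by (auto simp: PiE_iff)
      qed (use odometer_coord[OF vx] in simp)
      then show ?thesis using U(3) vx B(2) by (auto simp: PiE_iff)
    qed
    then show ?thesis by blast
  qed
  then show "A \<subseteq> carrier X \<and> (\<forall>x\<in>A. \<exists>n. \<forall>v\<in>odometer_kernel n. v \<otimes>\<^bsub>X\<^esub> x \<in> A)" using AX by blast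
next
  assume A: "A \<subseteq> carrier X \<and> (\<forall>x\<in>A. \<exists>n. \<forall>v\<in>odometer_kernel n. v \<otimes>\<^bsub>X\<^esub> x \<in> A)"
  have "\<exists>B. openin TX B \<and> x \<in> B \<and> B \<subseteq> A" if x: "x \<in> A" for x
  proof -
    obtain n where n: "\<forall>v\<in>odometer_kernel n. v \<otimes>\<^bsub>X\<^esub> x \<in> A" using A x by blast
    have xX: "x \<in> carrier X" using A x by blast
    have "openin product_space {y \<in> topspace product_space. y n \<in> {x n}}"
      by (rule openin_continuous_map_preimage[OF continuous_map_product_coordinates])
        (use odometer_coord[OF xX] in auto)
    then have "openin TX ({y \<in> topspace product_space. y n \<in> {x n}} \<inter> carrier X)"
      unfolding odometer_topology_def openin_subtopology by blast
    moreover have "y \<in> A" if y: "y \<in> carrier X" "y n = x n" for y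
    proof -
      have "y \<otimes>\<^bsub>X\<^esub> inv\<^bsub>X\<^esub> x \<otimes>\<^bsub>X\<^esub> x \<in> A" using n kernel_coset[OF xX y] by blast
      then show ?thesis using y xX by (simp add: X.m_assoc)
    qed
    moreover have "x \<in> {y \<in> topspace product_space. y n \<in> {x n}} \<inter> carrier X"
      using odometer_coord[OF xX] xX by auto
    ultimately show ?thesis by blast
  qed
  then show "openin TX A" by (subst openin_subopen) blast
qed

text \<open>The odometer is a closed subset of a product of finite discrete spaces.\<close>

lemma odometer_compact: "compact_space TX"
proof -
  have cs: "compact_space product_space"
    by (simp add: compact_space_product_topology compact_space_discrete_topology scale_finite)
  have closed: "closedin product_space {x \<in> topspace product_space. x n = a}"
    if "a \<in> carrier (G Mod \<Gamma> n)" for n a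
    using closedin_continuous_map_preimage[OF continuous_map_product_coordinates, of n UNIV
        "\<lambda>n. discrete_topology (carrier (G Mod \<Gamma> n))" "{a}"] that by simp
  define Z where "Z n = {x \<in> topspace product_space. quotient_projection G (\<Gamma> n) (x (Suc n)) = x n}" for n
  have "closedin product_space (Z n)" for n
  proof -
    \<comment> \<open>Coordinates take finitely many values, so compatibility of two neighbours is a
      finite union of conditions that fix both.\<close>
    have "Z n = (\<Union>p\<in>{(a, b). a \<in> carrier (G Mod \<Gamma> (Suc n)) \<and> b \<in> carrier (G Mod \<Gamma> n) \<and>
          quotient_projection G (\<Gamma> n) a = b}.
        {x \<in> topspace product_space. x (Suc n) = fst p} \<inter> {x \<in> topspace product_space. x n = snd p})"
      by (auto simp: Z_def PiE_iff)
    moreover have "finite {(a, b). a \<in> carrier (G Mod \<Gamma> (Suc n)) \<and> b \<in> carrier (G Mod \<Gamma> n) \<and>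
          quotient_projection G (\<Gamma> n) a = b}"
      by (rule finite_subset[of _ "carrier (G Mod \<Gamma> (Suc n)) \<times> carrier (G Mod \<Gamma> n)"])
        (auto simp: scale_finite)
    ultimately show ?thesis
      using closed by (auto intro!: closedin_Union closedin_Int)
  qed
  then have "closedin product_space (\<Inter>n. Z n)" by (intro closedin_INT) auto
  moreover have "(\<Inter>n. Z n) = carrier X"
    by (auto simp: Z_def odometer_carrier_iff PiE_iff)
  ultimately have "compactin product_space (carrier X)" using closedin_compact_space cs by metis
  then show ?thesis by (simp add: odometer_topology_def compact_space_subtopology)
qed

lemma scaled_group_odometer: "scaled_group X odometer_kernel TX"
  by (intro scaled_group.intro scaled_group_axioms.intro group_odometer odometer_kernel_normal
      odometer_kernel_decseq odometer_kernel_Inter odometer_kernel_nontrivial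
      odometer_topology_openin_iff odometer_compact)

lemma embedding_dense:
  assumes x: "x \<in> carrier X"
  shows "\<exists>g\<in>carrier G. \<tau> g \<in> odometer_kernel n #>\<^bsub>X\<^esub> x"
proof -
  obtain g where g: "g \<in> carrier G" "x n = \<Gamma> n #>\<^bsub>G\<^esub> g"
    using odometer_coord[OF x, of n] by (auto simp: carrier_FactGroup)
  then have "\<tau> g \<otimes>\<^bsub>X\<^esub> inv\<^bsub>X\<^esub> x \<in> odometer_kernel n"
    using x embedding_closed by (intro kernel_coset) (auto simp: odometer_embedding_def)
  then have "\<tau> g \<otimes>\<^bsub>X\<^esub> inv\<^bsub>X\<^esub> x \<otimes>\<^bsub>X\<^esub> x \<in> odometer_kernel n #>\<^bsub>X\<^esub> x"
    by (auto simp: r_coset_def)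
  then show ?thesis using g(1) x embedding_closed[OF g(1)] by (auto simp: X.m_assoc)
qed

text \<open>The preimage of the \<open>n\<close>-th kernel in \<open>G\<close> is
  \<open>\<Gamma> n\<close>, so the index condition of \<open>stabilized_eq\<close> is part of the
  scale.\<close>

lemma stabilized_Aut_odometer:
  "stabilized_Aut G TX (odometer_action G \<Gamma>)
    = permutation_monoid (carrier X) (scaled_group.E X odometer_kernel)"
proof (rule scaled_group.stabilized_eq[OF scaled_group_odometer G embedding_hom embedding_dense])
  show "finite_index G {g \<in> carrier G. \<tau> g \<in> odometer_kernel n}" for n
  proof -
    have "{g \<in> carrier G. \<tau> g \<in> odometer_kernel n} = \<Gamma> n"
      using embedding_kernel subgroup.mem_carrier[OF scale_subgroup] by blast
    then show ?thesis using scale by (simp add: is_scale_def)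
  qed
  show "odometer_action G \<Gamma> g x = \<tau> g \<otimes>\<^bsub>X\<^esub> x" if "g \<in> carrier G" "x \<in> carrier X" for g x
    using that by (simp add: odometer_action_def)
qed

lemma odometer_finitely_generated:
  assumes "finitely_generated G"
  obtains S where "finite S" "S \<subseteq> carrier X"
    "\<And>x n. x \<in> carrier X \<Longrightarrow> \<exists>d\<in>generate X S. d \<in> odometer_kernel n #>\<^bsub>X\<^esub> x"
proof -
  interpret h: group_hom G X \<tau>
    by (simp add: group_hom_def group_hom_axioms_def G group_odometer embedding_hom)
  obtain S where S: "finite S" "S \<subseteq> carrier G" "generate G S = carrier G"
    using assms by (auto simp: finitely_generated_def)
  have "generate X (\<tau> ` S) = \<tau> ` carrier G" using h.generate_img[OF S(2)] S(3) by simp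
  moreover have "\<tau> ` S \<subseteq> carrier X" using S(2) embedding_closed by auto
  ultimately show thesis
    using that[of "\<tau> ` S"] S(1) embedding_dense by simp
qed

end

theorem theorem1p3:
  fixes G :: "('a, 'm) monoid_scheme" and H :: "('b, 'n) monoid_scheme"
    and \<Gamma> :: "nat \<Rightarrow> 'a set" and \<Delta> :: "nat \<Rightarrow> 'b set"
  assumes "group G" "infinite (carrier G)" "finitely_generated G" "residually_finite G"
    and "group H" "infinite (carrier H)" "finitely_generated H" "residually_finite H"
    and "is_scale G \<Gamma>" and "is_scale H \<Delta>"
  defines "X \<equiv> odometer G \<Gamma>" and "TX \<equiv> odometer_topology G \<Gamma>"
    and "Y \<equiv> odometer H \<Delta>" and "TY \<equiv> odometer_topology H \<Delta>"
  defines "S1 \<equiv> stabilized_Aut G TX (odometer_action G \<Gamma>)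
                  \<cong> stabilized_Aut H TY (odometer_action H \<Delta>)"
    and "S2 \<equiv> topological_full_group X TX (left_action X)
                  \<cong> topological_full_group Y TY (left_action Y)"
    and "S3 \<equiv> topological_full_group X TX (right_action X)
                  \<cong> topological_full_group Y TY (right_action Y)"
    and "S4 \<equiv> \<exists>U1 U2. clopen_subgroup U1 X TX \<and> clopen_subgroup U2 Y TY \<and>
                  top_group_isomorphic (X\<lparr>carrier := U1\<rparr>) (subtopology TX U1)
                    (Y\<lparr>carrier := U2\<rparr>) (subtopology TY U2) \<and>
                  finite_index X U1 \<and> finite_index Y U2 \<and>
                  card (rcosets\<^bsub>X\<^esub> U1) = card (rcosets\<^bsub>Y\<^esub> U2)"
  shows "(S1 \<longleftrightarrow> S2) \<and> (S2 \<longleftrightarrow> S3) \<and> (S3 \<longleftrightarrow> S4)"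
proof -
  interpret GX: odometer_scale G \<Gamma> using assms(1,2,9) by (rule odometer_scale.intro)
  interpret HY: odometer_scale H \<Delta> using assms(5,6,10) by (rule odometer_scale.intro)
  interpret scaled_group_pair X "GX.odometer_kernel" TX Y "HY.odometer_kernel" TY
    unfolding X_def TX_def Y_def TY_def
    by (intro scaled_group_pair.intro GX.scaled_group_odometer HY.scaled_group_odometer)
  obtain S where S: "finite S" "S \<subseteq> carrier X"
    "\<And>x n. x \<in> carrier X \<Longrightarrow> \<exists>d\<in>generate X S. d \<in> GX.odometer_kernel n #>\<^bsub>X\<^esub> x"
    using GX.odometer_finitely_generated[OF assms(3)] unfolding X_def by metis
  have 1: "stabilized_Aut G TX (odometer_action G \<Gamma>) = X.E.P"
    unfolding X_def TX_def using GX.stabilized_Aut_odometer .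
  have 2: "stabilized_Aut H TY (odometer_action H \<Delta>) = Y.E.P"
    unfolding Y_def TY_def using HY.stabilized_Aut_odometer .
  \<comment> \<open>Each of the four statements is compared with the isomorphism of the two groups
    \<open>E\<close>.\<close>
  have S1: "S1 \<longleftrightarrow> X.E.P \<cong> Y.E.P" by (simp add: S1_def 1 2)
  have S2: "S2 \<longleftrightarrow> X.E.P \<cong> Y.E.P"
    unfolding S2_def
  proof
    assume "topological_full_group X TX (left_action X) \<cong> topological_full_group Y TY (left_action Y)"
    from iso_trans[OF iso_trans[OF X.full_left_iso' this] Y.full_left_iso] show "X.E.P \<cong> Y.E.P" .
  next
    assume "X.E.P \<cong> Y.E.P"
    from iso_trans[OF iso_trans[OF X.full_left_iso this] Y.full_left_iso']
    show "topological_full_group X TX (left_action X) \<cong> topological_full_group Y TY (left_action Y)" .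
  qed
  have S3: "S3 \<longleftrightarrow> X.E.P \<cong> Y.E.P" by (simp add: S3_def X.full_right_eq Y.full_right_eq)
  have S4: "S4 \<longleftrightarrow> X.E.P \<cong> Y.E.P"
    using E_iso_if_commensurable commensurable_if_E_iso[OF _ S]
    unfolding S4_def commensurable_def by blast
  show ?thesis using S1 S2 S3 S4 by simp
qed

end
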